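(* Let $(M^n,g,\xi,\lambda,\rho)$ be a compact almost Ricci-Bourguignon soliton with scalar curvature $S$. Then $$\int_M\left|\operatorname{Ric}-\frac{S}{n}g\right|^2=\frac{n-2}{2n}\int_M g(\nabla S,\xi).$$
   Context: Manifolds are smooth and without boundary. An almost Ricci-Bourguignon (almost RB) soliton $(M^n,g,\xi,\lambda,\rho)$ is an $n$-dimensional Riemannian manifold $(M^n,g)$ with a smooth vector field $\xi$ (the potential field), a smooth function $\lambda$ on $M$ (the soliton function) and a real constant $\rho$ such that $\operatorname{Ric}+\frac12\mathcal{L}_\xi g=(\lambda+\rho S)g$, where $\operatorname{Ric}$ is the Ricci tensor, $S$ the scalar curvature and $\mathcal{L}_\xi$ the Lie derivative. Norms of symmetric 2-tensors are the usual (Hilbert-Schmidt) norms induced by $g$; integrals are with respect to the Riemannian volume. *)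

theory Defs
  imports "HOL-Analysis.Analysis"
begin

primrec Ck_on :: "nat \<Rightarrow> 'a::euclidean_space set \<Rightarrow> ('a \<Rightarrow> 'b::real_normed_vector) \<Rightarrow> bool" where
  "Ck_on 0 U f \<longleftrightarrow> continuous_on U f"
| "Ck_on (Suc k) U f \<longleftrightarrow> (\<forall>x\<in>U. f differentiable (at x)) \<and>
     (\<forall>v. Ck_on k U (\<lambda>x. frechet_derivative f (at x) v))"

definition smooth_on :: "'a::euclidean_space set \<Rightarrow> ('a \<Rightarrow> 'b::real_normed_vector) \<Rightarrow> bool" where
  "smooth_on U f \<longleftrightarrow> (\<forall>k. Ck_on k U f)"

text \<open>A chart is a domain together with a coordinate map, whose values outside the domain are
  irrelevant. The dimension of the manifold is \<^term>\<open>CARD('n)\<close>. No maximality is required of an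
  atlas: every atlas determines the smooth structure.\<close>

type_synonym ('a, 'n) chart = "'a set \<times> ('a \<Rightarrow> real ^ 'n)"

abbreviation chart_dom :: "('a, 'n) chart \<Rightarrow> 'a set" where
  "chart_dom \<equiv> fst"

abbreviation coords :: "('a, 'n) chart \<Rightarrow> 'a \<Rightarrow> real ^ 'n" where
  "coords \<equiv> snd"

definition chart_image :: "('a, 'n) chart \<Rightarrow> (real ^ 'n) set" where
  "chart_image c = coords c ` chart_dom c"

definition chart_inv :: "('a, 'n) chart \<Rightarrow> real ^ 'n \<Rightarrow> 'a" where
  "chart_inv c = inv_into (chart_dom c) (coords c)"

definition transition :: "('a, 'n) chart \<Rightarrow> ('a, 'n) chart \<Rightarrow> real ^ 'n \<Rightarrow> real ^ 'n" where
  "transition c d = coords d \<circ> chart_inv c"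

definition smooth_atlas :: "'a topology \<Rightarrow> ('a, 'n::finite) chart set \<Rightarrow> bool" where
  "smooth_atlas M A \<longleftrightarrow>
     (\<Union>c\<in>A. chart_dom c) = topspace M \<and>
     (\<forall>c\<in>A. openin M (chart_dom c) \<and> open (chart_image c) \<and>
        homeomorphic_map (subtopology M (chart_dom c)) (top_of_set (chart_image c)) (coords c)) \<and>
     (\<forall>c\<in>A. \<forall>d\<in>A. smooth_on (coords c ` (chart_dom c \<inter> chart_dom d)) (transition c d))"

definition smooth_manifold :: "'a topology \<Rightarrow> ('a, 'n::finite) chart set \<Rightarrow> bool" where
  "smooth_manifold M A \<longleftrightarrow> Hausdorff_space M \<and> second_countable M \<and> smooth_atlas M A"

definition charts_at :: "('a, 'n) chart set \<Rightarrow> 'a \<Rightarrow> ('a, 'n) chart set" where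
  "charts_at A p = {c \<in> A. p \<in> chart_dom c}"

text \<open>An arbitrary chart around a point, used below to evaluate quantities whose value does not
  depend on the chart.\<close>

definition chart_at :: "('a, 'n) chart set \<Rightarrow> 'a \<Rightarrow> ('a, 'n) chart" where
  "chart_at A p = (SOME c. c \<in> charts_at A p)"

definition smooth_function :: "('a, 'n::finite) chart set \<Rightarrow> ('a \<Rightarrow> real) \<Rightarrow> bool" where
  "smooth_function A f \<longleftrightarrow> (\<forall>c\<in>A. smooth_on (chart_image c) (f \<circ> chart_inv c))"

text \<open>A tangent vector at a point assigns to every chart around the point its components in that
  chart, components in different charts being related by the differential of the transition map.
  The value at all other charts is fixed to \<open>0\<close>, so that a tangent vector is determined by its
  components. Addition and scaling are pointwise.\<close>

type_synonym ('a, 'n) tvec = "('a, 'n) chart \<Rightarrow> real ^ 'n"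

definition tangent_space :: "('a, 'n::finite) chart set \<Rightarrow> 'a \<Rightarrow> ('a, 'n) tvec set" where
  "tangent_space A p = {v.
     (\<forall>c\<in>charts_at A p. \<forall>d\<in>charts_at A p.
        v d = frechet_derivative (transition c d) (at (coords c p)) (v c)) \<and>
     (\<forall>c. c \<notin> charts_at A p \<longrightarrow> v c = 0)}"

text \<open>The coordinate vector \<open>\<partial>\<^sub>i\<close> of the chart \<open>c\<close> at the point \<open>p\<close>.\<close>

definition coord_vec :: "('a, 'n::finite) chart set \<Rightarrow> ('a, 'n) chart \<Rightarrow> 'a \<Rightarrow> 'n \<Rightarrow> ('a, 'n) tvec" where
  "coord_vec A c p i = (\<lambda>d. if d \<in> charts_at A p
     then frechet_derivative (transition c d) (at (coords c p)) (axis i 1) else 0)"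

text \<open>Covariant 2-tensor fields: only the values on tangent vectors at the given point matter.\<close>

type_synonym ('a, 'n) tensor2 = "'a \<Rightarrow> ('a, 'n) tvec \<Rightarrow> ('a, 'n) tvec \<Rightarrow> real"

definition tensor_comp ::
  "('a, 'n::finite) chart set \<Rightarrow> ('a, 'n) chart \<Rightarrow> ('a, 'n) tensor2 \<Rightarrow> 'a \<Rightarrow> real ^ 'n ^ 'n" where
  "tensor_comp A c T p = (\<chi> i j. T p (coord_vec A c p i) (coord_vec A c p j))"

definition inner_product_on_tangent ::
  "('a, 'n::finite) chart set \<Rightarrow> 'a \<Rightarrow> (('a, 'n) tvec \<Rightarrow> ('a, 'n) tvec \<Rightarrow> real) \<Rightarrow> bool" where
  "inner_product_on_tangent A p B \<longleftrightarrow>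
     (\<forall>u\<in>tangent_space A p. \<forall>v\<in>tangent_space A p. B u v = B v u) \<and>
     (\<forall>u\<in>tangent_space A p. \<forall>v\<in>tangent_space A p. \<forall>w\<in>tangent_space A p.
        B (\<lambda>c. u c + v c) w = B u w + B v w) \<and>
     (\<forall>r. \<forall>u\<in>tangent_space A p. \<forall>v\<in>tangent_space A p. B (\<lambda>c. r *\<^sub>R u c) v = r * B u v) \<and>
     (\<forall>u\<in>tangent_space A p. u \<noteq> (\<lambda>c. 0) \<longrightarrow> B u u > 0)"

definition riemannian_metric ::
  "'a topology \<Rightarrow> ('a, 'n::finite) chart set \<Rightarrow> ('a, 'n) tensor2 \<Rightarrow> bool" where
  "riemannian_metric M A g \<longleftrightarrow>
     (\<forall>p\<in>topspace M. inner_product_on_tangent A p (g p)) \<and>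
     (\<forall>c\<in>A. smooth_on (chart_image c) (\<lambda>x. tensor_comp A c g (chart_inv c x)))"

definition smooth_vector_field ::
  "'a topology \<Rightarrow> ('a, 'n::finite) chart set \<Rightarrow> ('a \<Rightarrow> ('a, 'n) tvec) \<Rightarrow> bool" where
  "smooth_vector_field M A \<xi> \<longleftrightarrow>
     (\<forall>p\<in>topspace M. \<xi> p \<in> tangent_space A p) \<and>
     (\<forall>c\<in>A. smooth_on (chart_image c) (\<lambda>x. \<xi> (chart_inv c x) c))"

definition differential ::
  "('a, 'n::finite) chart set \<Rightarrow> ('a \<Rightarrow> real) \<Rightarrow> 'a \<Rightarrow> ('a, 'n) tvec \<Rightarrow> real" where
  "differential A f p v = (let c = chart_at A p in
     frechet_derivative (f \<circ> chart_inv c) (at (coords c p)) (v c))"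

definition grad ::
  "('a, 'n::finite) chart set \<Rightarrow> ('a, 'n) tensor2 \<Rightarrow> ('a \<Rightarrow> real) \<Rightarrow> 'a \<Rightarrow> ('a, 'n) tvec" where
  "grad A g f p = (THE v. v \<in> tangent_space A p \<and>
     (\<forall>w\<in>tangent_space A p. g p v w = differential A f p w))"

text \<open>\<open>G\<close> is the matrix of metric components on an open subset of Euclidean space; vector fields
  there are identified with their component functions.\<close>

definition partial :: "'n \<Rightarrow> (real ^ 'n::finite \<Rightarrow> real) \<Rightarrow> real ^ 'n \<Rightarrow> real" where
  "partial i f x = frechet_derivative f (at x) (axis i 1)"

text \<open>The Christoffel symbol \<open>\<Gamma>\<^sup>k\<^sub>i\<^sub>j\<close> of the Levi-Civita connection.\<close>

definition christoffel :: "(real ^ 'n \<Rightarrow> real ^ 'n ^ 'n) \<Rightarrow> 'n::finite \<Rightarrow> 'n \<Rightarrow> 'n \<Rightarrow> real ^ 'n \<Rightarrow> real" where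
  "christoffel G k i j x = (\<Sum>l\<in>UNIV. matrix_inv (G x) $ k $ l *
     (partial i (\<lambda>y. G y $ j $ l) x + partial j (\<lambda>y. G y $ i $ l) x
        - partial l (\<lambda>y. G y $ i $ j) x)) / 2"

definition cov_deriv ::
  "(real ^ 'n \<Rightarrow> real ^ 'n ^ 'n) \<Rightarrow> (real ^ 'n \<Rightarrow> real ^ 'n) \<Rightarrow> (real ^ 'n \<Rightarrow> real ^ 'n) \<Rightarrow>
     real ^ 'n::finite \<Rightarrow> real ^ 'n" where
  "cov_deriv G X Y x = frechet_derivative Y (at x) (X x) +
     (\<chi> k. \<Sum>i\<in>UNIV. \<Sum>j\<in>UNIV. christoffel G k i j x * X x $ i * Y x $ j)"

definition lie_bracket ::
  "(real ^ 'n \<Rightarrow> real ^ 'n) \<Rightarrow> (real ^ 'n \<Rightarrow> real ^ 'n) \<Rightarrow> real ^ 'n::finite \<Rightarrow> real ^ 'n" where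
  "lie_bracket X Y x = frechet_derivative Y (at x) (X x) - frechet_derivative X (at x) (Y x)"

definition curvature ::
  "(real ^ 'n \<Rightarrow> real ^ 'n ^ 'n) \<Rightarrow> (real ^ 'n \<Rightarrow> real ^ 'n) \<Rightarrow> (real ^ 'n \<Rightarrow> real ^ 'n) \<Rightarrow>
     (real ^ 'n \<Rightarrow> real ^ 'n) \<Rightarrow> real ^ 'n::finite \<Rightarrow> real ^ 'n" where
  "curvature G X Y Z x = cov_deriv G X (cov_deriv G Y Z) x - cov_deriv G Y (cov_deriv G X Z) x
     - cov_deriv G (lie_bracket X Y) Z x"

text \<open>\<open>Ric(Y, Z)\<close> is the trace of \<open>X \<mapsto> R(X, Y)Z\<close>.\<close>

definition ricci_matrix ::
  "(real ^ 'n \<Rightarrow> real ^ 'n ^ 'n) \<Rightarrow> real ^ 'n::finite \<Rightarrow> real ^ 'n ^ 'n" where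
  "ricci_matrix G x = (\<chi> i j. \<Sum>k\<in>UNIV.
     curvature G (\<lambda>_. axis k 1) (\<lambda>_. axis i 1) (\<lambda>_. axis j 1) x $ k)"

text \<open>\<open>(\<L>\<^sub>X g)(Y, Z) = X (g(Y, Z)) - g([X, Y], Z) - g(Y, [X, Z])\<close> for coordinate fields \<open>Y, Z\<close>.\<close>

definition lie_matrix ::
  "(real ^ 'n \<Rightarrow> real ^ 'n ^ 'n) \<Rightarrow> (real ^ 'n \<Rightarrow> real ^ 'n) \<Rightarrow> real ^ 'n::finite \<Rightarrow> real ^ 'n ^ 'n" where
  "lie_matrix G X x = (\<chi> i j.
     frechet_derivative (\<lambda>y. G y $ i $ j) (at x) (X x)
     - lie_bracket X (\<lambda>_. axis i 1) x \<bullet> (G x *v axis j 1)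
     - axis i 1 \<bullet> (G x *v lie_bracket X (\<lambda>_. axis j 1) x))"

definition local_metric ::
  "('a, 'n::finite) chart set \<Rightarrow> ('a, 'n) tensor2 \<Rightarrow> ('a, 'n) chart \<Rightarrow> real ^ 'n \<Rightarrow> real ^ 'n ^ 'n" where
  "local_metric A g c x = tensor_comp A c g (chart_inv c x)"

definition ricci :: "('a, 'n::finite) chart set \<Rightarrow> ('a, 'n) tensor2 \<Rightarrow> ('a, 'n) tensor2" where
  "ricci A g p u v = (let c = chart_at A p in
     u c \<bullet> (ricci_matrix (local_metric A g c) (coords c p) *v v c))"

definition lie_derivative ::
  "('a, 'n::finite) chart set \<Rightarrow> ('a \<Rightarrow> ('a, 'n) tvec) \<Rightarrow> ('a, 'n) tensor2 \<Rightarrow> ('a, 'n) tensor2" where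
  "lie_derivative A \<xi> g p u v = (let c = chart_at A p in
     u c \<bullet> (lie_matrix (local_metric A g c) (\<lambda>x. \<xi> (chart_inv c x) c) (coords c p) *v v c))"

definition scalar_curvature :: "('a, 'n::finite) chart set \<Rightarrow> ('a, 'n) tensor2 \<Rightarrow> 'a \<Rightarrow> real" where
  "scalar_curvature A g p = (let c = chart_at A p; H = matrix_inv (tensor_comp A c g p) in
     \<Sum>i\<in>UNIV. \<Sum>j\<in>UNIV. H $ i $ j * tensor_comp A c (ricci A g) p $ i $ j)"

text \<open>The Hilbert-Schmidt norm: \<open>|T|\<^sup>2 = g\<^sup>i\<^sup>k g\<^sup>j\<^sup>l T\<^sub>i\<^sub>j T\<^sub>k\<^sub>l\<close>.\<close>

definition tensor_norm ::
  "('a, 'n::finite) chart set \<Rightarrow> ('a, 'n) tensor2 \<Rightarrow> ('a, 'n) tensor2 \<Rightarrow> 'a \<Rightarrow> real" where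
  "tensor_norm A g T p =
     (let c = chart_at A p; H = matrix_inv (tensor_comp A c g p); t = tensor_comp A c T p in
      sqrt (\<Sum>i\<in>UNIV. \<Sum>j\<in>UNIV. \<Sum>k\<in>UNIV. \<Sum>l\<in>UNIV. H $ i $ k * H $ j $ l * t $ i $ j * t $ k $ l))"

text \<open>The Riemannian volume is the Borel measure with density \<open>sqrt (det (g\<^sub>i\<^sub>j))\<close> with respect to
  Lebesgue measure in each chart.\<close>

definition borel_sets_of :: "'a topology \<Rightarrow> 'a set set" where
  "borel_sets_of M = sigma_sets (topspace M) {U. openin M U}"

definition is_riemannian_volume ::
  "'a topology \<Rightarrow> ('a, 'n::finite) chart set \<Rightarrow> ('a, 'n) tensor2 \<Rightarrow> 'a measure \<Rightarrow> bool" where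
  "is_riemannian_volume M A g \<mu> \<longleftrightarrow>
     space \<mu> = topspace M \<and> sets \<mu> = borel_sets_of M \<and>
     (\<forall>c\<in>A. \<forall>B\<in>borel_sets_of M. B \<subseteq> chart_dom c \<longrightarrow>
        emeasure \<mu> B =
          (\<integral>\<^sup>+x. indicator (coords c ` B) x * ennreal (sqrt (det (local_metric A g c x))) \<partial>lborel))"

definition riemannian_volume ::
  "'a topology \<Rightarrow> ('a, 'n::finite) chart set \<Rightarrow> ('a, 'n) tensor2 \<Rightarrow> 'a measure" where
  "riemannian_volume M A g = (THE \<mu>. is_riemannian_volume M A g \<mu>)"

definition almost_RB_soliton ::
  "'a topology \<Rightarrow> ('a, 'n::finite) chart set \<Rightarrow> ('a, 'n) tensor2 \<Rightarrow> ('a \<Rightarrow> ('a, 'n) tvec) \<Rightarrow>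
     ('a \<Rightarrow> real) \<Rightarrow> real \<Rightarrow> bool" where
  "almost_RB_soliton M A g \<xi> lam \<rho> \<longleftrightarrow>
     smooth_manifold M A \<and> riemannian_metric M A g \<and> smooth_vector_field M A \<xi> \<and>
     smooth_function A lam \<and>
     (\<forall>p\<in>topspace M. \<forall>u\<in>tangent_space A p. \<forall>v\<in>tangent_space A p.
        ricci A g p u v + 1 / 2 * lie_derivative A \<xi> g p u v =
          (lam p + \<rho> * scalar_curvature A g p) * g p u v)"

end

theory Submission
  imports Defs
begin

text \<open>Let \<open>E = Ric - (S/n) g\<close> and let \<open>Y\<close> be the vector field dual to \<open>E(\<xi>, \<cdot>)\<close>. The contracted
  second Bianchi identity gives \<open>div E = (1/2 - 1/n) dS\<close>, and the soliton equation says that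
  \<open>\<L>\<^sub>\<xi> g\<close> is \<open>-2E\<close> up to a multiple of \<open>g\<close>; as \<open>E\<close> is traceless,
  \<open>div Y = (1/2 - 1/n) \<langle>\<nabla>S, \<xi>\<rangle> + \<langle>E, \<L>\<^sub>\<xi> g\<rangle>/2 = (1/2 - 1/n) \<langle>\<nabla>S, \<xi>\<rangle> - |E|\<^sup>2\<close>, which integrates to zero.

  In a chart the connection is a tuple of matrices \<open>A\<^sub>a = (\<Gamma>\<^sup>k\<^sub>a\<^sub>b)\<close> with curvature
  \<open>R\<^sub>a\<^sub>b = \<partial>\<^sub>aA\<^sub>b - \<partial>\<^sub>bA\<^sub>a + [A\<^sub>a, A\<^sub>b]\<close>. In this form the Bianchi identity holds in any noncommutative
  ring, and a coordinate change is the gauge transformation \<open>P A\<^sub>a = \<partial>\<^sub>aP + A'\<^sub>a P\<close> with the Jacobian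
  matrix \<open>P\<close>, from which the tensoriality of \<open>Ric\<close> and \<open>\<L>\<^sub>\<xi> g\<close> follows.\<close>

section \<open>Functions of class \<open>C\<^sup>k\<close>\<close>

text \<open>The definitions create obligations that come before the geometry. Ricci tensor, Lie
  derivative, scalar curvature, norm and differential are evaluated in one arbitrarily selected
  chart, so each needs the same expression in every chart. Gradient and volume are definite
  descriptions, so existence and uniqueness must be proved. The norm is a square root that the
  theorem squares, so its radicand must be nonnegative. The gauge law is not obtained by
  transforming the formula of the Christoffel symbols: the transformed matrices are again metric and
  torsion-free, and such a connection is unique. The symmetry of \<open>Ric\<close> needed for the
  divergence is read off the soliton equation, whose other terms are symmetric. That
  \<open>div Y\<close> has integral zero is reduced by a partition of unity to partial derivatives
  of compactly supported functions. Each partition function is differentiated only once, so class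
  C^1 is enough and the bump functions can be piecewise polynomial.\<close>

lemma frechet_derivative_at':
  "(f has_derivative F) (at x) \<Longrightarrow> frechet_derivative f (at x) = F"
  using frechet_derivative_at by blast

lemma frechet_derivative_cong_open:
  assumes "open U" "x \<in> U" "\<And>y. y \<in> U \<Longrightarrow> f y = g y"
  shows "frechet_derivative f (at x) = frechet_derivative g (at x)"
proof -
  have "(f has_derivative F) (at x) \<longleftrightarrow> (g has_derivative F) (at x)" for F
    using assms by (metis has_derivative_transform_within_open)
  then show ?thesis by (simp add: frechet_derivative_def)
qed

lemma differentiable_cong_open:
  assumes "open U" "x \<in> U" "\<And>y. y \<in> U \<Longrightarrow> f y = g y"
  shows "f differentiable (at x) \<longleftrightarrow> g differentiable (at x)"
  using assms unfolding differentiable_def by (metis has_derivative_transform_within_open)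

text \<open>Derivatives at points of an open set see only nearby values, so agreement on
  \<open>U\<close> passes to every derivative function. The closure lemmas below use this to replace
  a derivative by its computed formula.\<close>

lemma Ck_on_cong:
  assumes "open U" "\<And>x. x \<in> U \<Longrightarrow> f x = g x"
  shows "Ck_on k U f \<longleftrightarrow> Ck_on k U g"
  using assms(2)
proof (induction k arbitrary: f g)
  case 0
  then show ?case using continuous_on_cong by fastforce
next
  case (Suc k)
  have 1: "frechet_derivative f (at x) = frechet_derivative g (at x)" if "x \<in> U" for x
    by (rule frechet_derivative_cong_open[OF assms(1) that]) (simp add: Suc)
  have 2: "f differentiable (at x) \<longleftrightarrow> g differentiable (at x)" if "x \<in> U" for x
    by (rule differentiable_cong_open[OF assms(1) that]) (simp add: Suc)
  have "Ck_on k U (\<lambda>x. frechet_derivative f (at x) v) \<longleftrightarrow> Ck_on k U (\<lambda>x. frechet_derivative g (at x) v)" for v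
    by (rule Suc.IH) (simp add: 1)
  with 2 show ?case by simp
qed

lemma Ck_on_subset: "Ck_on k U f \<Longrightarrow> V \<subseteq> U \<Longrightarrow> Ck_on k V f"
  by (induction k arbitrary: f) (auto intro: continuous_on_subset)

lemma differentiable_imp_continuous_on_at:
  "(\<And>x. x \<in> U \<Longrightarrow> f differentiable (at x)) \<Longrightarrow> continuous_on U f"
  by (meson continuous_at_imp_continuous_on differentiable_imp_continuous_within)

lemma Ck_on_SucD: "Ck_on (Suc k) U f \<Longrightarrow> Ck_on k U f"
proof (induction k arbitrary: f)
  case 0
  then show ?case by (auto intro: differentiable_imp_continuous_on_at)
next
  case (Suc k)
  from Suc.prems have "Ck_on k U (\<lambda>x. frechet_derivative f (at x) v)" for v
    by (intro Suc.IH) (metis Ck_on.simps(2))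
  then show ?case using Suc.prems by simp
qed

lemma Ck_on_le: "Ck_on m U f \<Longrightarrow> k \<le> m \<Longrightarrow> Ck_on k U f"
proof (induction m)
  case (Suc m)
  then show ?case using Ck_on_SucD le_SucE by metis
qed simp

lemma Ck_on_continuous: "Ck_on k U f \<Longrightarrow> continuous_on U f"
  using Ck_on_le[of k U f 0] by simp

lemma smooth_on_subset: "smooth_on U f \<Longrightarrow> V \<subseteq> U \<Longrightarrow> smooth_on V f"
  by (auto simp: smooth_on_def intro: Ck_on_subset)

lemma Ck_on_differentiable: "Ck_on (Suc k) U f \<Longrightarrow> x \<in> U \<Longrightarrow> f differentiable (at x)"
  by simp

lemma Ck_on_deriv: "Ck_on (Suc k) U f \<Longrightarrow> Ck_on k U (\<lambda>x. frechet_derivative f (at x) v)"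
  by simp

lemma frechet_derivativeD:
  "f differentiable (at x) \<Longrightarrow> (f has_derivative frechet_derivative f (at x)) (at x)"
  using frechet_derivative_works by blast

lemma Ck_on_const [simp]: "Ck_on k U (\<lambda>x. c)"
  by (induction k arbitrary: c) auto

lemma frechet_derivative_add:
  assumes "f differentiable (at x)" "g differentiable (at x)"
  shows "frechet_derivative (\<lambda>x. f x + g x) (at x) v = frechet_derivative f (at x) v + frechet_derivative g (at x) v"
  using frechet_derivative_at'[OF has_derivative_add[OF frechet_derivativeD frechet_derivativeD, OF assms]]
  by (simp add: fun_eq_iff)

lemma Ck_on_add:
  assumes "open U"
  shows "Ck_on k U f \<Longrightarrow> Ck_on k U g \<Longrightarrow> Ck_on k U (\<lambda>x. f x + g x)"
proof (induction k arbitrary: f g)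
  case 0
  then show ?case by (auto intro: continuous_on_add)
next
  case (Suc k)
  have "Ck_on k U (\<lambda>x. frechet_derivative (\<lambda>x. f x + g x) (at x) v)" for v
  proof (rule Ck_on_cong[THEN iffD1, OF assms])
    show "Ck_on k U (\<lambda>x. frechet_derivative f (at x) v + frechet_derivative g (at x) v)"
      using Suc by auto
  qed (use Suc in \<open>simp add: frechet_derivative_add\<close>)
  then show ?case using Suc by (auto intro!: derivative_intros)
qed

lemma Ck_on_sum:
  assumes "open U" "\<And>i. i \<in> I \<Longrightarrow> Ck_on k U (f i)"
  shows "Ck_on k U (\<lambda>x. \<Sum>i\<in>I. f i x)"
  using assms(2) by (induction I rule: infinite_finite_induct) (auto intro!: Ck_on_add[OF assms(1)])

lemma frechet_derivative_bounded_linear: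
  assumes "bounded_linear L" "f differentiable (at x)"
  shows "frechet_derivative (\<lambda>x. L (f x)) (at x) v = L (frechet_derivative f (at x) v)"
  using frechet_derivative_at'[OF bounded_linear.has_derivative[OF assms(1) frechet_derivativeD[OF assms(2)]]]
  by (simp add: fun_eq_iff)

lemma differentiable_bounded_linear:
  assumes "bounded_linear L" "f differentiable (at x)"
  shows "(\<lambda>x. L (f x)) differentiable (at x)"
  using bounded_linear.has_derivative[OF assms(1) frechet_derivativeD[OF assms(2)]]
  by (rule differentiableI)

lemma Ck_on_bounded_linear:
  assumes "open U" "bounded_linear L"
  shows "Ck_on k U f \<Longrightarrow> Ck_on k U (\<lambda>x. L (f x))"
proof (induction k arbitrary: f)
  case 0
  then show ?case using assms(2) bounded_linear.continuous_on by auto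
next
  case (Suc k)
  have "Ck_on k U (\<lambda>x. frechet_derivative (\<lambda>x. L (f x)) (at x) v)" for v
  proof (rule Ck_on_cong[THEN iffD1, OF assms(1)])
    show "Ck_on k U (\<lambda>x. L (frechet_derivative f (at x) v))"
      using Suc by auto
  qed (use Suc.prems in \<open>simp add: frechet_derivative_bounded_linear[OF assms(2)]\<close>)
  then show ?case using Suc assms by (auto intro!: differentiable_bounded_linear[OF assms(2)])
qed

lemma frechet_derivative_bilinear:
  assumes "bounded_bilinear P" "f differentiable (at x)" "g differentiable (at x)"
  shows "frechet_derivative (\<lambda>x. P (f x) (g x)) (at x) v =
     P (f x) (frechet_derivative g (at x) v) + P (frechet_derivative f (at x) v) (g x)"
  using frechet_derivative_at'[OF bounded_bilinear.FDERIV[OF assms(1) frechet_derivativeD frechet_derivativeD, OF assms(2,3)]]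
  by (simp add: fun_eq_iff)

lemma differentiable_bilinear:
  assumes "bounded_bilinear P" "f differentiable (at x)" "g differentiable (at x)"
  shows "(\<lambda>x. P (f x) (g x)) differentiable (at x)"
  using bounded_bilinear.FDERIV[OF assms(1) frechet_derivativeD frechet_derivativeD, OF assms(2,3)]
  by (rule differentiableI)

text \<open>One Leibniz rule serves real, scalar, matrix and inner products alike. Each summand of
  the derivative contains one undifferentiated factor, which is lowered to order \<open>k\<close>
  before the induction hypothesis applies.\<close>

lemma Ck_on_bilinear:
  assumes "open U" "bounded_bilinear P"
  shows "Ck_on k U f \<Longrightarrow> Ck_on k U g \<Longrightarrow> Ck_on k U (\<lambda>x. P (f x) (g x))"
proof (induction k arbitrary: f g)
  case 0
  then show ?case using assms(2) bounded_bilinear.continuous_on by auto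
next
  case (Suc k)
  have "Ck_on k U (\<lambda>x. frechet_derivative (\<lambda>x. P (f x) (g x)) (at x) v)" for v
  proof (rule Ck_on_cong[THEN iffD1, OF assms(1)])
    show "Ck_on k U (\<lambda>x. P (f x) (frechet_derivative g (at x) v) + P (frechet_derivative f (at x) v) (g x))"
      using Suc.prems Ck_on_SucD[OF Suc.prems(1)] Ck_on_SucD[OF Suc.prems(2)]
      by (intro Ck_on_add[OF assms(1)] Suc.IH) simp_all
  qed (use Suc.prems in \<open>simp add: frechet_derivative_bilinear[OF assms(2)]\<close>)
  then show ?case using Suc.prems by (auto intro: differentiable_bilinear[OF assms(2)])
qed

lemmas Ck_on_mult = Ck_on_bilinear[OF _ bounded_bilinear_mult]
lemmas Ck_on_scaleR = Ck_on_bilinear[OF _ bounded_bilinear_scaleR]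

lemma Ck_on_minus: "open U \<Longrightarrow> Ck_on k U f \<Longrightarrow> Ck_on k U (\<lambda>x. - f x)"
  by (rule Ck_on_bounded_linear[OF _ bounded_linear_minus[OF bounded_linear_ident]])

lemma Ck_on_diff:
  assumes "open U" "Ck_on k U f" "Ck_on k U g"
  shows "Ck_on k U (\<lambda>x. f x - g x)"
  using Ck_on_add[OF assms(1,2) Ck_on_minus[OF assms(1,3)]] by simp

lemma Ck_on_prod:
  fixes f :: "'i \<Rightarrow> 'a::euclidean_space \<Rightarrow> real"
  assumes "open U" "\<And>i. i \<in> I \<Longrightarrow> Ck_on k U (f i)"
  shows "Ck_on k U (\<lambda>x. \<Prod>i\<in>I. f i x)"
  using assms(2) by (induction I rule: infinite_finite_induct) (auto intro!: Ck_on_mult[OF assms(1)])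

lemma Ck_on_ident: "Ck_on k U (\<lambda>x::'a::euclidean_space. x)"
proof (cases k)
  case (Suc m)
  have "frechet_derivative (\<lambda>x::'a. x) (at x) v = v" for x v
    using frechet_derivative_at'[OF has_derivative_ident] by metis
  then show ?thesis by (simp add: Suc)
qed (simp add: continuous_on_id)

text \<open>The derivative of \<open>1/f\<close> contains \<open>1/f\<close> again, but only to
  order \<open>k\<close>, so the induction runs on \<open>k\<close> with \<open>f\<close>
  fixed.\<close>

lemma Ck_on_inverse:
  fixes f :: "'a::euclidean_space \<Rightarrow> real"
  assumes U: "open U" and nz: "\<And>x. x \<in> U \<Longrightarrow> f x \<noteq> 0"
  shows "Ck_on k U f \<Longrightarrow> Ck_on k U (\<lambda>x. inverse (f x))"
proof (induction k)
  case 0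
  then show ?case using nz by (auto intro!: continuous_on_inverse)
next
  case (Suc k)
  have D: "((\<lambda>x. inverse (f x)) has_derivative
      (\<lambda>v. - (inverse (f x) * frechet_derivative f (at x) v * inverse (f x)))) (at x)" if "x \<in> U" for x
    using that Suc.prems by (intro Deriv.has_derivative_inverse frechet_derivativeD nz) auto
  have "Ck_on k U (\<lambda>x. frechet_derivative (\<lambda>x. inverse (f x)) (at x) v)" for v
  proof (rule Ck_on_cong[THEN iffD1, OF U])
    show "Ck_on k U (\<lambda>x. - (inverse (f x) * frechet_derivative f (at x) v * inverse (f x)))"
      using Suc.prems Ck_on_SucD[OF Suc.prems] by (intro Ck_on_minus U Ck_on_mult Suc.IH) simp_all
  qed (use D frechet_derivative_at' in force)
  then show ?case using D by (auto intro: differentiableI)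
qed

lemma frechet_derivative_compose:
  assumes "f differentiable (at x)" "g differentiable (at (f x))"
  shows "frechet_derivative (\<lambda>x. g (f x)) (at x) v = frechet_derivative g (at (f x)) (frechet_derivative f (at x) v)"
  using frechet_derivative_at'[OF diff_chain_at[OF frechet_derivativeD[OF assms(1)] frechet_derivativeD[OF assms(2)]]]
  by (simp add: o_def fun_eq_iff)

lemma differentiable_compose_at:
  assumes "f differentiable (at x)" "g differentiable (at (f x))"
  shows "(\<lambda>x. g (f x)) differentiable (at x)"
  using diff_chain_at[OF frechet_derivativeD[OF assms(1)] frechet_derivativeD[OF assms(2)]]
  by (auto simp: o_def intro: differentiableI)

lemma frechet_derivative_expand:
  fixes f :: "'a::euclidean_space \<Rightarrow> 'b::real_normed_vector"
  assumes "f differentiable (at x)"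
  shows "frechet_derivative f (at x) v = (\<Sum>b\<in>Basis. (v \<bullet> b) *\<^sub>R frechet_derivative f (at x) b)"
proof -
  have l: "linear (frechet_derivative f (at x))"
    using assms by (rule linear_frechet_derivative)
  have "frechet_derivative f (at x) v = frechet_derivative f (at x) (\<Sum>b\<in>Basis. (v \<bullet> b) *\<^sub>R b)"
    by (simp add: euclidean_representation)
  also have "\<dots> = (\<Sum>b\<in>Basis. (v \<bullet> b) *\<^sub>R frechet_derivative f (at x) b)"
    by (simp add: linear_sum[OF l] linear_cmul[OF l] o_def)
  finally show ?thesis .
qed

text \<open>\<open>Ck_on\<close> differentiates in fixed directions, whereas the chain rule applies
  the derivative of \<open>g\<close> to a moving vector. Expanding that vector in the basis leaves
  fixed directional derivatives of \<open>g\<close> composed with \<open>f\<close>, to which the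
  induction hypothesis for arbitrary \<open>g\<close> applies.\<close>

lemma Ck_on_compose:
  fixes f :: "'a::euclidean_space \<Rightarrow> 'b::euclidean_space" and g :: "'b \<Rightarrow> 'c::real_normed_vector"
  assumes U: "open U" and V: "f ` U \<subseteq> V"
  shows "Ck_on k U f \<Longrightarrow> Ck_on k V g \<Longrightarrow> Ck_on k U (\<lambda>x. g (f x))"
proof (induction k arbitrary: g)
  case 0
  then show ?case using V by (auto intro: continuous_on_compose2)
next
  case (Suc k)
  have d: "f differentiable (at x)" "g differentiable (at (f x))" if "x \<in> U" for x
    using that Suc.prems V by auto
  have "Ck_on k U (\<lambda>x. frechet_derivative (\<lambda>x. g (f x)) (at x) v)" for v
  proof (rule Ck_on_cong[THEN iffD1, OF U])
    show "Ck_on k U (\<lambda>x. \<Sum>b\<in>Basis. (frechet_derivative f (at x) v \<bullet> b) *\<^sub>R frechet_derivative g (at (f x)) b)"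
      using Suc.prems Ck_on_SucD[OF Suc.prems(1)]
      by (intro Ck_on_sum U Ck_on_scaleR Suc.IH Ck_on_bounded_linear[OF _ bounded_linear_inner_left]) simp_all
  qed (simp add: d frechet_derivative_compose frechet_derivative_expand[where f=g, symmetric])
  then show ?case using d by (auto intro: differentiable_compose_at)
qed

section \<open>Vector- and matrix-valued functions\<close>

lemma vec_eq_sum_axis: "(v::real^'n) = (\<Sum>i\<in>UNIV. v $ i *\<^sub>R axis i 1)"
  using basis_expansion[of v] by (simp add: scalar_mult_eq_scaleR)

lemma bounded_linear_axis: "bounded_linear (\<lambda>v::'a::real_normed_vector. axis i v :: 'a^'n)"
proof (rule bounded_linear_intro[where K=1])
  show "axis i (x + y) = axis i x + axis i y" for x y :: 'a
    by (simp add: vec_eq_iff axis_def)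
  show "axis i (r *\<^sub>R x) = r *\<^sub>R axis i x" for r and x :: 'a
    by (simp add: vec_eq_iff axis_def)
  show "norm (axis i x) \<le> norm x * 1" for x :: 'a
    by (simp add: norm_vec_def axis_def L2_set_def if_distrib[of norm] if_distrib[of "\<lambda>z. z\<^sup>2"] cong: if_cong)
qed

lemma Ck_on_vec:
  fixes f :: "'a::euclidean_space \<Rightarrow> 'b::real_normed_vector^'n"
  assumes "open U" "\<And>i. Ck_on k U (\<lambda>x. f x $ i)"
  shows "Ck_on k U f"
proof -
  have eq: "(\<Sum>i\<in>UNIV. axis i (f x $ i)) = f x" for x
    by (simp add: vec_eq_iff axis_def)
  have "Ck_on k U (\<lambda>x. \<Sum>i\<in>UNIV. axis i (f x $ i))"
    by (intro Ck_on_sum Ck_on_bounded_linear[OF _ bounded_linear_axis] assms)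
  then show ?thesis by (simp only: eq)
qed

lemma Ck_on_nth: "open U \<Longrightarrow> Ck_on k U f \<Longrightarrow> Ck_on k U (\<lambda>x. f x $ i)"
  by (rule Ck_on_bounded_linear[OF _ bounded_linear_vec_nth])

lemma frechet_derivative_nth:
  "f differentiable (at x) \<Longrightarrow> frechet_derivative (\<lambda>x. f x $ i) (at x) v = frechet_derivative f (at x) v $ i"
  by (rule frechet_derivative_bounded_linear[OF bounded_linear_vec_nth])

lemma differentiable_nth: "f differentiable (at x) \<Longrightarrow> (\<lambda>x. f x $ i) differentiable (at x)"
  by (rule differentiable_bounded_linear[OF bounded_linear_vec_nth])

lemma bounded_bilinear_matrix_mult: "bounded_bilinear ((**) :: real^'n^'m \<Rightarrow> real^'p^'n \<Rightarrow> real^'p^'m)"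
proof (subst bilinear_conv_bounded_bilinear[symmetric], unfold bilinear_def, intro conjI allI linearI)
  fix A B :: "real^'n^'m" and C D :: "real^'p^'n" and r :: real
  show "A ** (C + D) = A ** C + A ** D" by (rule matrix_add_ldistrib)
  show "(A + B) ** C = A ** C + B ** C"
    by (simp add: matrix_matrix_mult_def vec_eq_iff sum.distrib distrib_right)
  show "A ** (r *\<^sub>R C) = r *\<^sub>R (A ** C)"
    by (simp add: matrix_matrix_mult_def vec_eq_iff sum_distrib_left mult.left_commute)
  show "(r *\<^sub>R A) ** C = r *\<^sub>R (A ** C)"
    by (simp add: matrix_matrix_mult_def vec_eq_iff sum_distrib_left mult.assoc)
qed

lemma bounded_linear_transpose: "bounded_linear (transpose :: real^'n^'m \<Rightarrow> real^'m^'n)"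
  by (rule linear_conv_bounded_linear[THEN iffD1], rule linearI) (auto simp: transpose_def vec_eq_iff)

lemmas Ck_on_matrix_mult = Ck_on_bilinear[OF _ bounded_bilinear_matrix_mult]
lemmas frechet_derivative_matrix_mult = frechet_derivative_bilinear[OF bounded_bilinear_matrix_mult]
lemmas differentiable_matrix_mult = differentiable_bilinear[OF bounded_bilinear_matrix_mult]

lemma Ck_on_det:
  fixes G :: "'a::euclidean_space \<Rightarrow> real^'n^'n"
  assumes "open U" "Ck_on k U G"
  shows "Ck_on k U (\<lambda>x. det (G x))"
  unfolding det_def
  by (intro Ck_on_sum Ck_on_mult Ck_on_prod Ck_on_nth assms Ck_on_const)

lemma matrix_inv_unique:
  fixes A B :: "real^'n^'n"
  assumes "A ** B = mat 1"
  shows "matrix_inv A = B"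
proof -
  have BA: "B ** A = mat 1" using assms matrix_left_right_inverse by blast
  have "A ** matrix_inv A = mat 1 \<and> matrix_inv A ** A = mat 1"
    unfolding matrix_inv_def by (rule someI[of _ B]) (use assms BA in simp)
  then have "B ** (A ** matrix_inv A) = B" by simp
  then show ?thesis by (simp add: matrix_mul_assoc BA)
qed

lemma matrix_inv_mult:
  fixes A :: "real^'n^'n"
  assumes "det A \<noteq> 0"
  shows "A ** matrix_inv A = mat 1" "matrix_inv A ** A = mat 1"
proof -
  obtain B where B: "A ** B = mat 1"
    using assms invertible_det_nz[of A] by (auto simp: invertible_def)
  show "A ** matrix_inv A = mat 1" using B matrix_inv_unique by metis
  then show "matrix_inv A ** A = mat 1" using matrix_left_right_inverse by blast
qed

lemma matrix_vector_mult_axis_nth: "((A::real^'n^'m) *v axis j 1) $ i = A $ i $ j"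
  by (simp add: matrix_vector_mult_basis column_def)

text \<open>By Cramer's rule each entry of the inverse is a quotient of determinants;
  \<open>?B\<close> is \<open>G x\<close> with column \<open>i\<close> replaced by
  \<open>axis j 1\<close>.\<close>

lemma Ck_on_matrix_inv:
  fixes G :: "'a::euclidean_space \<Rightarrow> real^'n^'n"
  assumes U: "open U" and G: "Ck_on k U G" and nz: "\<And>x. x \<in> U \<Longrightarrow> det (G x) \<noteq> 0"
  shows "Ck_on k U (\<lambda>x. matrix_inv (G x))"
proof (intro Ck_on_vec U)
  fix i j
  let ?B = "\<lambda>x. \<chi> r c. if c = i then (axis j 1 :: real^'n) $ r else G x $ r $ c"
  have eq: "det (?B x) * inverse (det (G x)) = matrix_inv (G x) $ i $ j" if "x \<in> U" for x
  proof -
    have "G x *v (matrix_inv (G x) *v axis j 1) = axis j 1"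
      by (simp add: matrix_vector_mul_assoc matrix_inv_mult nz that)
    then have "matrix_inv (G x) *v axis j 1 = (\<chi> k. det (\<chi> r c. if c = k then (axis j 1 :: real^'n) $ r else G x $ r $ c) / det (G x))"
      using cramer[OF nz[OF that]] by blast
    then have "(matrix_inv (G x) *v axis j 1) $ i = det (?B x) / det (G x)"
      by simp
    then show ?thesis
      by (simp only: matrix_vector_mult_axis_nth divide_inverse)
  qed
  have "Ck_on k U ?B"
  proof (intro Ck_on_vec U)
    fix r c
    show "Ck_on k U (\<lambda>x. ?B x $ r $ c)"
      using Ck_on_nth[OF U Ck_on_nth[OF U G]] by (cases "c = i") auto
  qed
  then have "Ck_on k U (\<lambda>x. det (?B x) * inverse (det (G x)))"
    by (intro Ck_on_mult U Ck_on_det Ck_on_inverse nz G)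
  then show "Ck_on k U (\<lambda>x. matrix_inv (G x) $ i $ j)"
    by (rule Ck_on_cong[THEN iffD1, OF U eq, rotated])
qed

section \<open>Symmetry of second derivatives\<close>

lemma has_real_derivative_along_line:
  assumes "f differentiable (at (a + s *\<^sub>R u))"
  shows "((\<lambda>s. f (a + s *\<^sub>R u)) has_real_derivative frechet_derivative f (at (a + s *\<^sub>R u)) u) (at s)"
proof -
  have "((\<lambda>s. a + s *\<^sub>R u) has_derivative (\<lambda>r. r *\<^sub>R u)) (at s)"
    by (auto intro!: derivative_eq_intros)
  from diff_chain_at[OF this frechet_derivativeD[OF assms]]
  have "((\<lambda>s. f (a + s *\<^sub>R u)) has_derivative (\<lambda>r. frechet_derivative f (at (a + s *\<^sub>R u)) (r *\<^sub>R u))) (at s)"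
    by (simp add: o_def)
  moreover have "(\<lambda>r. frechet_derivative f (at (a + s *\<^sub>R u)) (r *\<^sub>R u)) = (*) (frechet_derivative f (at (a + s *\<^sub>R u)) u)"
    by (rule ext) (simp add: linear_cmul[OF linear_frechet_derivative[OF assms]])
  ultimately show ?thesis by (simp add: has_field_derivative_def)
qed

text \<open>The mean value theorem is applied twice: in direction \<open>u\<close> to the difference
  of \<open>f\<close> along two parallel segments, then in direction \<open>v\<close> to the
  resulting directional derivative. The second difference is symmetric in \<open>u\<close> and
  \<open>v\<close>, the derivative on the right is not visibly so.\<close>

lemma second_difference_mean_value:
  fixes f :: "'a::euclidean_space \<Rightarrow> real"
  assumes f: "Ck_on 2 U f" and t: "0 < t" and sub: "cball x (t * (norm u + norm v)) \<subseteq> U"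
  obtains y where "y \<in> cball x (t * (norm u + norm v))"
    "f (x + t *\<^sub>R u + t *\<^sub>R v) - f (x + t *\<^sub>R u) - f (x + t *\<^sub>R v) + f x
      = t * t * frechet_derivative (\<lambda>y. frechet_derivative f (at y) u) (at y) v"
proof -
  have mem: "x + s *\<^sub>R u + r *\<^sub>R v \<in> cball x (t * (norm u + norm v))" if "0 \<le> s" "s \<le> t" "0 \<le> r" "r \<le> t" for s r
  proof -
    have "norm (s *\<^sub>R u + r *\<^sub>R v) \<le> s * norm u + r * norm v"
      using that norm_triangle_ineq[of "s *\<^sub>R u" "r *\<^sub>R v"] by simp
    also have "\<dots> \<le> t * (norm u + norm v)"
      using that by (simp add: distrib_left add_mono mult_right_mono)
    finally show ?thesis
      using norm_minus_cancel[of "s *\<^sub>R u + r *\<^sub>R v"] by (simp add: dist_norm add.assoc)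
  qed
  have d1: "f differentiable (at y)" if "y \<in> U" for y
    using f that by (simp add: numeral_2_eq_2)
  have d2: "(\<lambda>y. frechet_derivative f (at y) u) differentiable (at y)" if "y \<in> U" for y
    using f that by (simp add: numeral_2_eq_2)
  let ?\<phi> = "\<lambda>s. f ((x + t *\<^sub>R v) + s *\<^sub>R u) - f (x + s *\<^sub>R u)"
  have "\<exists>s>0. s < t \<and> ?\<phi> t - ?\<phi> 0 = (t - 0) *
     (frechet_derivative f (at ((x + t *\<^sub>R v) + s *\<^sub>R u)) u - frechet_derivative f (at (x + s *\<^sub>R u)) u)"
  proof (rule MVT2[OF t])
    fix s assume s: "0 \<le> s" "s \<le> t"
    have "(x + t *\<^sub>R v) + s *\<^sub>R u \<in> U" "x + s *\<^sub>R u \<in> U"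
      using mem[of s t] mem[of s 0] s t sub by (auto simp: algebra_simps)
    then show "(?\<phi> has_real_derivative frechet_derivative f (at ((x + t *\<^sub>R v) + s *\<^sub>R u)) u
        - frechet_derivative f (at (x + s *\<^sub>R u)) u) (at s)"
      by (intro DERIV_diff has_real_derivative_along_line d1)
  qed
  then obtain s where s: "0 < s" "s < t" "?\<phi> t - ?\<phi> 0 = t *
     (frechet_derivative f (at ((x + t *\<^sub>R v) + s *\<^sub>R u)) u - frechet_derivative f (at (x + s *\<^sub>R u)) u)"
    by auto
  let ?\<psi> = "\<lambda>r. frechet_derivative f (at ((x + s *\<^sub>R u) + r *\<^sub>R v)) u"
  have "\<exists>r>0. r < t \<and> ?\<psi> t - ?\<psi> 0 = (t - 0) *
     frechet_derivative (\<lambda>y. frechet_derivative f (at y) u) (at ((x + s *\<^sub>R u) + r *\<^sub>R v)) v"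
  proof (rule MVT2[OF t])
    fix r assume r: "0 \<le> r" "r \<le> t"
    have "(x + s *\<^sub>R u) + r *\<^sub>R v \<in> U"
      using mem[of s r] r s sub by auto
    then show "(?\<psi> has_real_derivative frechet_derivative (\<lambda>y. frechet_derivative f (at y) u) (at ((x + s *\<^sub>R u) + r *\<^sub>R v)) v) (at r)"
      by (rule has_real_derivative_along_line[OF d2])
  qed
  then obtain r where r: "0 < r" "r < t" "?\<psi> t - ?\<psi> 0 = t *
     frechet_derivative (\<lambda>y. frechet_derivative f (at y) u) (at ((x + s *\<^sub>R u) + r *\<^sub>R v)) v"
    by auto
  show thesis
  proof (rule that)
    show "x + s *\<^sub>R u + r *\<^sub>R v \<in> cball x (t * (norm u + norm v))"
      using mem[of s r] r s by simp
    show "f (x + t *\<^sub>R u + t *\<^sub>R v) - f (x + t *\<^sub>R u) - f (x + t *\<^sub>R v) + f x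
      = t * t * frechet_derivative (\<lambda>y. frechet_derivative f (at y) u) (at (x + s *\<^sub>R u + r *\<^sub>R v)) v"
      using s(3) r(3) by (simp add: algebra_simps)
  qed
qed

text \<open>The same second difference is \<open>t * t\<close> times a mixed derivative in either
  order, taken at two points near \<open>x\<close>. By continuity both mixed derivatives are within
  \<open>e/2\<close> of their values at \<open>x\<close>.\<close>

lemma second_derivative_commute_real:
  fixes f :: "'a::euclidean_space \<Rightarrow> real"
  assumes U: "open U" "x \<in> U" and f: "Ck_on 2 U f"
  shows "frechet_derivative (\<lambda>y. frechet_derivative f (at y) u) (at x) v
       = frechet_derivative (\<lambda>y. frechet_derivative f (at y) v) (at x) u"
proof -
  let ?A = "\<lambda>x. frechet_derivative (\<lambda>y. frechet_derivative f (at y) u) (at x) v"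
  let ?B = "\<lambda>x. frechet_derivative (\<lambda>y. frechet_derivative f (at y) v) (at x) u"
  have c: "continuous_on U ?A" "continuous_on U ?B"
    using f by (simp_all add: numeral_2_eq_2)
  have "\<bar>?A x - ?B x\<bar> \<le> e" if e: "0 < e" for e
  proof -
    from c U have "isCont ?A x" "isCont ?B x"
      by (simp_all add: continuous_on_eq_continuous_at)
    then have "(?A \<longlongrightarrow> ?A x) (nhds x)" "(?B \<longlongrightarrow> ?B x) (nhds x)"
      using tendsto_at_iff_tendsto_nhds[of ?A x] tendsto_at_iff_tendsto_nhds[of ?B x]
      by (simp_all only: isCont_def)
    from tendstoD[OF this(1), of "e/2"] tendstoD[OF this(2), of "e/2"] e
    have "\<forall>\<^sub>F y in nhds x. dist (?A y) (?A x) < e/2" "\<forall>\<^sub>F y in nhds x. dist (?B y) (?B x) < e/2"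
      by simp_all
    moreover have "\<forall>\<^sub>F y in nhds x. y \<in> U"
      using U by (rule eventually_nhds_in_open)
    ultimately have "\<forall>\<^sub>F y in nhds x. dist (?A y) (?A x) < e/2 \<and> dist (?B y) (?B x) < e/2 \<and> y \<in> U"
      by (intro eventually_conj)
    then obtain d where d: "d > 0" "\<And>y. dist y x < d \<Longrightarrow> dist (?A y) (?A x) < e/2 \<and> dist (?B y) (?B x) < e/2 \<and> y \<in> U"
      unfolding eventually_nhds_metric by auto
    \<comment> \<open>The summand \<open>1\<close> keeps the denominator positive when
      \<open>u\<close> and \<open>v\<close> vanish; the bound
      \<open>t * (norm u + norm v) < d\<close> puts the whole closed ball into the
      neighbourhood.\<close>
    define t where "t = d / (2 * (norm u + norm v + 1))"
    have pos: "norm u + norm v + 1 > 0"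
      using norm_ge_zero[of u] norm_ge_zero[of v] by linarith
    have t: "t > 0" using d pos by (simp add: t_def)
    have "t * (norm u + norm v) < t * (2 * (norm u + norm v + 1))"
      using t pos by (intro mult_strict_left_mono) (simp_all add: distrib_left)
    also have "\<dots> = d"
      using pos by (simp add: t_def)
    finally have near: "dist y x < d" if "y \<in> cball x (t * (norm u + norm v))" for y
      using that by (simp add: dist_commute)
    then have sub: "cball x (t * (norm u + norm v)) \<subseteq> U" using d by blast
    obtain y where y: "y \<in> cball x (t * (norm u + norm v))"
      "f (x + t *\<^sub>R u + t *\<^sub>R v) - f (x + t *\<^sub>R u) - f (x + t *\<^sub>R v) + f x = t * t * ?A y"
      using second_difference_mean_value[OF f t sub] by blast
    have sub': "cball x (t * (norm v + norm u)) \<subseteq> U" using sub by (simp add: add.commute)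
    obtain z where z: "z \<in> cball x (t * (norm v + norm u))"
      "f (x + t *\<^sub>R v + t *\<^sub>R u) - f (x + t *\<^sub>R v) - f (x + t *\<^sub>R u) + f x = t * t * ?B z"
      using second_difference_mean_value[OF f t sub'] by blast
    have "f (x + t *\<^sub>R v + t *\<^sub>R u) = f (x + t *\<^sub>R u + t *\<^sub>R v)"
      by (simp only: add.commute add.left_commute)
    then have "t * t * ?A y = t * t * ?B z"
      unfolding y(2)[symmetric] z(2)[symmetric] by simp
    then have "?A y = ?B z" using t by simp
    moreover have "dist (?A y) (?A x) < e/2" using d(2)[OF near[OF y(1)]] by blast
    moreover have "dist (?B z) (?B x) < e/2" using d(2)[OF near] z(1) by (simp add: add.commute)
    moreover have "\<bar>a - b\<bar> \<le> e" if "p = q" "dist p a < e / 2" "dist q b < e / 2" for a b p q :: real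
      using that unfolding dist_real_def by linarith
    ultimately show ?thesis by blast
  qed
  then have "\<bar>?A x - ?B x\<bar> \<le> 0"
    using field_le_epsilon[of "\<bar>?A x - ?B x\<bar>" 0] by simp
  then show ?thesis by (simp only: abs_le_zero_iff right_minus_eq)
qed

lemma second_derivative_commute:
  fixes f :: "'a::euclidean_space \<Rightarrow> 'b::euclidean_space"
  assumes U: "open U" "x \<in> U" and f: "Ck_on 2 U f"
  shows "frechet_derivative (\<lambda>y. frechet_derivative f (at y) u) (at x) v
       = frechet_derivative (\<lambda>y. frechet_derivative f (at y) v) (at x) u"
proof (rule euclidean_eqI)
  fix b :: 'b
  have bl: "bounded_linear (\<lambda>z::'b. z \<bullet> b)" by (rule bounded_linear_inner_left)
  have d: "f differentiable (at y)" "(\<lambda>y. frechet_derivative f (at y) w) differentiable (at y)" if "y \<in> U" for y w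
    using f that by (simp_all add: numeral_2_eq_2)
  have *: "frechet_derivative (\<lambda>y. frechet_derivative f (at y) u) (at x) v \<bullet> b
    = frechet_derivative (\<lambda>y. frechet_derivative (\<lambda>z. f z \<bullet> b) (at y) u) (at x) v" for u v
  proof -
    have "frechet_derivative (\<lambda>y. frechet_derivative (\<lambda>z. f z \<bullet> b) (at y) u) (at x)
      = frechet_derivative (\<lambda>y. frechet_derivative f (at y) u \<bullet> b) (at x)"
      by (rule frechet_derivative_cong_open[OF U])
        (simp add: frechet_derivative_bounded_linear[OF bl] d)
    then show ?thesis
      using frechet_derivative_bounded_linear[OF bl d(2)[OF U(2)]] by simp
  qed
  show "frechet_derivative (\<lambda>y. frechet_derivative f (at y) u) (at x) v \<bullet> b
    = frechet_derivative (\<lambda>y. frechet_derivative f (at y) v) (at x) u \<bullet> b"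
    unfolding * by (rule second_derivative_commute_real[OF U Ck_on_bounded_linear[OF U(1) bl f]])
qed

section \<open>Derivative of the determinant\<close>

text \<open>A permutation other than the identity moves at least two points. After one factor of its
  Leibniz product has been differentiated, another off-diagonal entry of \<open>mat 1\<close>
  remains, so only the identity permutation contributes, and it contributes the trace.\<close>

lemma has_derivative_det_mat_1:
  "((det :: real^'n^'n \<Rightarrow> real) has_derivative trace) (at (mat 1))"
proof -
  let ?P = "{p. p permutes (UNIV :: 'n set)}"
  have bl: "bounded_linear (\<lambda>A::real^'n^'n. A $ i $ j)" for i j
    by (intro bounded_linear_compose[OF bounded_linear_vec_nth bounded_linear_vec_nth])
  have 1: "((\<lambda>A::real^'n^'n. det A) has_derivative
     (\<lambda>K. \<Sum>p\<in>?P. of_int (sign p) * (\<Sum>i\<in>UNIV. K $ i $ p i * (\<Prod>j\<in>UNIV - {i}. (mat 1 :: real^'n^'n) $ j $ p j)))) (at (mat 1))"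
    unfolding det_def
    by (intro has_derivative_sum has_derivative_mult_right has_derivative_prod bounded_linear_imp_has_derivative bl)
  have 2: "(\<Sum>i\<in>UNIV. K $ i $ p i * (\<Prod>j\<in>UNIV - {i}. (mat 1 :: real^'n^'n) $ j $ p j)) = 0"
    if p: "p permutes UNIV" "p \<noteq> id" for p :: "'n \<Rightarrow> 'n" and K :: "real^'n^'n"
  proof (rule sum.neutral, rule ballI)
    fix i :: 'n
    obtain a where a: "p a \<noteq> a" using p(2) by (auto simp: fun_eq_iff)
    then have "p (p a) \<noteq> p a" using permutes_inj[OF p(1)] by (auto simp: inj_def)
    with a obtain b where b: "p b \<noteq> b" "b \<noteq> i" by metis
    then have "\<exists>j\<in>UNIV - {i}. (mat 1 :: real^'n^'n) $ j $ p j = 0"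
      by (intro bexI[of _ b]) (auto simp: mat_def)
    then show "K $ i $ p i * (\<Prod>j\<in>UNIV - {i}. (mat 1 :: real^'n^'n) $ j $ p j) = 0"
      using prod_zero[of "UNIV - {i}" "\<lambda>j. (mat 1 :: real^'n^'n) $ j $ p j"] by simp
  qed
  have 3: "(\<Sum>p\<in>?P. of_int (sign p) * (\<Sum>i\<in>UNIV. K $ i $ p i * (\<Prod>j\<in>UNIV - {i}. (mat 1 :: real^'n^'n) $ j $ p j)))
     = trace K" for K :: "real^'n^'n"
  proof -
    have "(\<Sum>p\<in>?P. of_int (sign p) * (\<Sum>i\<in>UNIV. K $ i $ p i * (\<Prod>j\<in>UNIV - {i}. (mat 1 :: real^'n^'n) $ j $ p j)))
      = (\<Sum>p\<in>{id}. of_int (sign p) * (\<Sum>i\<in>UNIV. K $ i $ p i * (\<Prod>j\<in>UNIV - {i}. (mat 1 :: real^'n^'n) $ j $ p j)))"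
      by (rule sum.mono_neutral_right) (auto simp: permutes_id 2 finite_permutations)
    also have "\<dots> = trace K"
      by (simp add: sign_id mat_def trace_def)
    finally show ?thesis .
  qed
  show ?thesis using 1 unfolding 3 by simp
qed

text \<open>Jacobi's formula at a general matrix: factoring out \<open>det (G x)\<close> leaves the
  determinant of \<open>?H ** G y\<close>, which is \<open>mat 1\<close> at
  \<open>y = x\<close>.\<close>

lemma frechet_derivative_det:
  fixes G :: "'a::euclidean_space \<Rightarrow> real^'n^'n"
  assumes G: "G differentiable (at x)" and nz: "det (G x) \<noteq> 0"
  shows "frechet_derivative (\<lambda>y. det (G y)) (at x) v
     = det (G x) * trace (matrix_inv (G x) ** frechet_derivative G (at x) v)"
    "(\<lambda>y. det (G y)) differentiable (at x)"
proof -
  let ?H = "matrix_inv (G x)"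
  have "det (G x) * det ?H = 1"
    using matrix_inv_mult(1)[OF nz] by (metis det_I det_mul)
  then have eq: "(\<lambda>y. det (G y)) = (\<lambda>y. det (G x) * det (?H ** G y))"
    by (simp add: fun_eq_iff det_mul flip: mult.assoc)
  have "((\<lambda>y. ?H ** G y) has_derivative (\<lambda>v. ?H ** frechet_derivative G (at x) v)) (at x)"
    by (rule bounded_linear.has_derivative[OF bounded_bilinear.bounded_linear_right[OF bounded_bilinear_matrix_mult]])
       (rule frechet_derivativeD[OF G])
  from diff_chain_at[OF this, of det trace]
  have "((\<lambda>y. det (?H ** G y)) has_derivative (\<lambda>v. trace (?H ** frechet_derivative G (at x) v))) (at x)"
    using has_derivative_det_mat_1 matrix_inv_mult(2)[OF nz] by (simp add: o_def)
  then have "((\<lambda>y. det (G y)) has_derivative (\<lambda>v. det (G x) * trace (?H ** frechet_derivative G (at x) v))) (at x)"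
    by (subst eq) (rule has_derivative_mult_right)
  then show "frechet_derivative (\<lambda>y. det (G y)) (at x) v = det (G x) * trace (?H ** frechet_derivative G (at x) v)"
    "(\<lambda>y. det (G y)) differentiable (at x)"
    by (simp_all only: frechet_derivative_at' differentiableI)
qed

section \<open>Matrix algebra and partial derivatives\<close>

abbreviation pd :: "'n \<Rightarrow> (real^'n::finite \<Rightarrow> 'b::real_normed_vector) \<Rightarrow> real^'n \<Rightarrow> 'b" where
  "pd a f x \<equiv> frechet_derivative f (at x) (axis a 1)"

lemma matrix_add_rdistrib: "((A::real^'n^'m) + B) ** (C::real^'p^'n) = A ** C + B ** C"
  by (rule bounded_bilinear.add_left[OF bounded_bilinear_matrix_mult])

lemma matrix_diff_ldistrib: "(A::real^'n^'m) ** ((B::real^'p^'n) - C) = A ** B - A ** C"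
  by (rule bounded_bilinear.diff_right[OF bounded_bilinear_matrix_mult])

lemma matrix_diff_rdistrib: "((A::real^'n^'m) - B) ** (C::real^'p^'n) = A ** C - B ** C"
  by (rule bounded_bilinear.diff_left[OF bounded_bilinear_matrix_mult])

lemma matrix_minus_left: "(- (A::real^'n^'m)) ** (C::real^'p^'n) = - (A ** C)"
  by (rule bounded_bilinear.minus_left[OF bounded_bilinear_matrix_mult])

lemma matrix_minus_right: "(A::real^'n^'m) ** (- (C::real^'p^'n)) = - (A ** C)"
  by (rule bounded_bilinear.minus_right[OF bounded_bilinear_matrix_mult])

lemma matrix_scaleR_left: "(r *\<^sub>R (A::real^'n^'m)) ** (C::real^'p^'n) = r *\<^sub>R (A ** C)"
  by (rule bounded_bilinear.scaleR_left[OF bounded_bilinear_matrix_mult])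

lemma matrix_scaleR_right: "(A::real^'n^'m) ** (r *\<^sub>R (C::real^'p^'n)) = r *\<^sub>R (A ** C)"
  by (rule bounded_bilinear.scaleR_right[OF bounded_bilinear_matrix_mult])

lemmas matrix_algebra = matrix_add_ldistrib matrix_add_rdistrib matrix_diff_ldistrib matrix_diff_rdistrib
  matrix_minus_left matrix_minus_right matrix_scaleR_left matrix_scaleR_right

lemma transpose_add: "transpose ((A::real^'n^'m) + B) = transpose A + transpose B"
  and transpose_diff: "transpose ((A::real^'n^'m) - B) = transpose A - transpose B"
  and transpose_minus: "transpose (- (A::real^'n^'m)) = - transpose A"
  and transpose_scaleR: "transpose (r *\<^sub>R (A::real^'n^'m)) = r *\<^sub>R transpose A"
  by (simp_all add: transpose_def vec_eq_iff)

lemmas transpose_algebra = transpose_add transpose_diff transpose_minus transpose_scaleR matrix_transpose_mul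

lemma trace_transpose: "trace (transpose (A::real^'n^'n)) = trace A"
  by (simp add: trace_def transpose_def)

lemma trace_scaleR: "trace (r *\<^sub>R (A::real^'n^'n)) = r * trace A"
  by (simp add: trace_def sum_distrib_left)

lemma matrix_mult_nth: "((A::real^'n^'m) ** B) $ i $ j = (\<Sum>k\<in>UNIV. A $ i $ k * B $ k $ j)"
  by (simp add: matrix_matrix_mult_def)

lemma matrix_vector_nth: "((A::real^'n^'m) *v w) $ i = (\<Sum>k\<in>UNIV. A $ i $ k * w $ k)"
  by (simp add: matrix_vector_mult_def)

lemma transpose_nth: "transpose A $ i $ j = A $ j $ i"
  by (simp add: transpose_def)

lemma transpose_eq_minus_nth: "transpose (M::real^'n^'n) = - M \<Longrightarrow> M $ d $ c = - M $ c $ d"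
  by (drule arg_cong[where f="\<lambda>A. A $ c $ d"]) (simp only: transpose_nth vector_uminus_component)

lemma frechet_derivative_sum:
  assumes "\<And>i. i \<in> I \<Longrightarrow> f i differentiable (at x)"
  shows "frechet_derivative (\<lambda>x. \<Sum>i\<in>I. f i x) (at x) v = (\<Sum>i\<in>I. frechet_derivative (f i) (at x) v)"
proof -
  have "((\<lambda>x. \<Sum>i\<in>I. f i x) has_derivative (\<lambda>v. \<Sum>i\<in>I. frechet_derivative (f i) (at x) v)) (at x)"
    by (intro has_derivative_sum frechet_derivativeD assms)
  from frechet_derivative_at'[OF this] show ?thesis by metis
qed

lemma frechet_derivative_diff:
  assumes "f differentiable (at x)" "g differentiable (at x)"
  shows "frechet_derivative (\<lambda>x. f x - g x) (at x) v = frechet_derivative f (at x) v - frechet_derivative g (at x) v"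
  using frechet_derivative_at'[OF has_derivative_diff[OF frechet_derivativeD frechet_derivativeD, OF assms]] by metis

lemma frechet_derivative_const_zero: "frechet_derivative (\<lambda>y. c) (at x) v = 0"
  using frechet_derivative_const by metis

lemma frechet_derivative_pd:
  fixes f :: "real^'n::finite \<Rightarrow> 'b::real_normed_vector"
  assumes "f differentiable (at x)"
  shows "frechet_derivative f (at x) v = (\<Sum>a\<in>UNIV. v $ a *\<^sub>R pd a f x)"
proof -
  have l: "linear (frechet_derivative f (at x))"
    using assms by (rule linear_frechet_derivative)
  have "frechet_derivative f (at x) v = frechet_derivative f (at x) (\<Sum>a\<in>UNIV. v $ a *\<^sub>R axis a 1)"
    using vec_eq_sum_axis[of v] by simp
  also have "\<dots> = (\<Sum>a\<in>UNIV. v $ a *\<^sub>R pd a f x)"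
    by (simp only: linear_sum[OF l] linear_cmul[OF l] o_def)
  finally show ?thesis .
qed

lemma bounded_linear_matrix_vector_left: "bounded_linear (\<lambda>M::real^'n^'m. M *v w)"
  by (rule linear_conv_bounded_linear[THEN iffD1], rule linearI)
     (auto simp: matrix_vector_mult_def vec_eq_iff sum.distrib distrib_right sum_distrib_left mult.assoc)

lemma bounded_bilinear_matrix_vector: "bounded_bilinear ((*v) :: real^'n^'m \<Rightarrow> real^'n \<Rightarrow> real^'m)"
proof (subst bilinear_conv_bounded_bilinear[symmetric], unfold bilinear_def, intro conjI allI)
  show "linear ((*v) A)" for A :: "real^'n^'m" by simp
  show "linear (\<lambda>A::real^'n^'m. A *v w)" for w
    using bounded_linear_matrix_vector_left bounded_linear.linear by blast
qed

lemma matrix_mult_sum_right: "(A::real^'n^'n) ** (\<Sum>c\<in>I. f c) = (\<Sum>c\<in>I. A ** f c)"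
  by (rule bounded_bilinear.sum_right[OF bounded_bilinear_matrix_mult])

lemma matrix_mult_sum_left: "(\<Sum>c\<in>I. f c) ** (A::real^'n^'n) = (\<Sum>c\<in>I. f c ** A)"
  by (rule bounded_bilinear.sum_left[OF bounded_bilinear_matrix_mult])

lemma transpose_sum: "transpose (\<Sum>c\<in>I. (f c :: real^'n^'n)) = (\<Sum>c\<in>I. transpose (f c))"
  using linear_sum[OF bounded_linear.linear[OF bounded_linear_transpose], of f I] by (simp add: o_def)

lemma pd_nth2:
  assumes "f differentiable (at x)"
  shows "pd e (\<lambda>y. f y $ i $ j) x = pd e f x $ i $ j"
  using assms by (simp add: frechet_derivative_nth differentiable_nth)

section \<open>The Bianchi identities as algebra\<close>

text \<open>Read \<open>D a b\<close> as the derivative of \<open>A b\<close> in direction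
  \<open>a\<close>, and \<open>DD a b c\<close> as the second derivatives of \<open>A c\<close>.
  Second derivatives cancel by symmetry, terms with one derivative cancel in pairs, and the cubic
  terms cancel by the Jacobi identity for commutators.\<close>

lemma gauge_bianchi_algebra:
  fixes A :: "'n::finite \<Rightarrow> real^'n^'n"
  assumes DD: "\<And>a b c. DD a b c = DD b a c"
  shows "(DD e a b - DD e b a + (A a ** D e b + D e a ** A b) - (A b ** D e a + D e b ** A a)
      + A e ** (D a b - D b a + A a ** A b - A b ** A a) - (D a b - D b a + A a ** A b - A b ** A a) ** A e)
   + (DD a b e - DD a e b + (A b ** D a e + D a b ** A e) - (A e ** D a b + D a e ** A b)
      + A a ** (D b e - D e b + A b ** A e - A e ** A b) - (D b e - D e b + A b ** A e - A e ** A b) ** A a)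
   + (DD b e a - DD b a e + (A e ** D b a + D b e ** A a) - (A a ** D b e + D b a ** A e)
      + A b ** (D e a - D a e + A e ** A a - A a ** A e) - (D e a - D a e + A e ** A a - A a ** A e) ** A b)
   = 0"
  \<comment> \<open>The three instances fix one order for each pair of differentiation indices;
    afterwards the claim is cancellation among signed monomials.\<close>
  apply (simp only: DD[of e a] DD[of b e] DD[of b a] matrix_algebra matrix_mul_assoc)
  apply (simp only: diff_conv_add_uminus minus_add_distrib minus_minus)
  apply (simp only: add_ac minus_add_cancel add_minus_cancel)
  apply simp
  done

lemma sum_sym_antisym:
  fixes f g :: "'n::finite \<Rightarrow> 'n \<Rightarrow> real"
  assumes "\<And>a b. f a b = f b a" "\<And>a b. g a b = - g b a"
  shows "(\<Sum>a\<in>UNIV. \<Sum>b\<in>UNIV. f a b * g a b) = 0"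
proof -
  have "(\<Sum>a\<in>UNIV. \<Sum>b\<in>UNIV. f a b * g a b) = (\<Sum>a\<in>UNIV. \<Sum>b\<in>UNIV. f b a * g b a)"
    by (rule sum.swap)
  also have "\<dots> = - (\<Sum>a\<in>UNIV. \<Sum>b\<in>UNIV. f a b * g a b)"
    unfolding sum_negf[symmetric]
  proof (intro sum.cong refl)
    fix a b show "f b a * g b a = - (f a b * g a b)"
      using assms(1)[of a b] assms(2)[of b a] by simp
  qed
  finally show ?thesis by simp
qed

text \<open>Here \<open>k a b d c\<close> is the curvature with matrix indices \<open>d\<close> and
  \<open>c\<close> both raised, \<open>\<gamma> e d f\<close> the Christoffel symbol with upper
  index \<open>d\<close>, and \<open>p\<close> the Ricci tensor with one index raised.
  \<open>\<beta>\<close> corrects only the upper indices: the corrections for \<open>a\<close> and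
  \<open>b\<close> would cancel in the cyclic sum by symmetry of \<open>\<gamma>\<close>.
  Contracting \<open>a\<close> with \<open>d\<close> and \<open>b\<close> with \<open>c\<close>, the
  first term gives the derivative of the scalar curvature and the other two give the same
  divergence, whence the factor 2.\<close>

lemma contracted_bianchi_algebra:
  fixes k :: "'n::finite \<Rightarrow> 'n \<Rightarrow> 'n \<Rightarrow> 'n \<Rightarrow> real" and dk :: "'n \<Rightarrow> 'n \<Rightarrow> 'n \<Rightarrow> 'n \<Rightarrow> 'n \<Rightarrow> real"
    and \<gamma> :: "'n \<Rightarrow> 'n \<Rightarrow> 'n \<Rightarrow> real"
  defines "\<beta> \<equiv> \<lambda>e a b d c. dk e a b d c + (\<Sum>f\<in>UNIV. \<gamma> e d f * k a b f c) + (\<Sum>f\<in>UNIV. k a b d f * \<gamma> e c f)"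
    and "p \<equiv> \<lambda>e c. \<Sum>m\<in>UNIV. k m e m c"
    and "dp \<equiv> \<lambda>a e c. \<Sum>m\<in>UNIV. dk a m e m c"
  assumes k1: "\<And>a b d c. k a b d c = - k b a d c" and k2: "\<And>a b d c. k a b d c = - k a b c d"
    and dk1: "\<And>e a b d c. dk e a b d c = - dk e b a d c" and dk2: "\<And>e a b d c. dk e a b d c = - dk e a b c d"
    and \<gamma>: "\<And>e d f. \<gamma> e d f = \<gamma> f d e"
    and bianchi: "\<And>e a b d c. \<beta> e a b d c + \<beta> a b e d c + \<beta> b e a d c = 0"
  shows "(\<Sum>b\<in>UNIV. dp e b b)
    = 2 * (\<Sum>a\<in>UNIV. dp a e a + (\<Sum>f\<in>UNIV. \<gamma> a a f * p e f) - (\<Sum>f\<in>UNIV. \<gamma> a f e * p f a))"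
proof -
  let ?S = "\<lambda>h. \<Sum>a\<in>(UNIV::'n set). \<Sum>b\<in>(UNIV::'n set). (h a b :: real)"
  \<comment> \<open>Two antisymmetries cancel their signs here; \<open>p2\<close> and
    \<open>p3\<close> use only one and keep the minus sign.\<close>
  have p1: "(\<Sum>b\<in>UNIV. k a b f b) = p a f" for a f
    unfolding p_def by (intro sum.cong refl) (metis k1 k2 minus_minus)
  have p2: "(\<Sum>b\<in>UNIV. k b e f b) = - p e f" for e f
    unfolding p_def sum_negf[symmetric] by (intro sum.cong refl k2)
  have p3: "(\<Sum>a\<in>UNIV. k e a a f) = - p e f" for e f
    unfolding p_def sum_negf[symmetric] by (intro sum.cong refl k1)
  have T1: "?S (\<lambda>a b. \<beta> e a b a b) = (\<Sum>b\<in>UNIV. dp e b b) + 2 * ?S (\<lambda>a f. \<gamma> e a f * p a f)"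
  proof -
    have "?S (\<lambda>a b. dk e a b a b) = (\<Sum>b\<in>UNIV. dp e b b)"
      unfolding dp_def by (rule sum.swap)
    moreover have "?S (\<lambda>a b. \<Sum>f\<in>UNIV. \<gamma> e a f * k a b f b) = ?S (\<lambda>a f. \<gamma> e a f * p a f)"
    proof (rule sum.cong[OF refl])
      fix a :: 'n
      have "(\<Sum>b\<in>UNIV. \<Sum>f\<in>UNIV. \<gamma> e a f * k a b f b) = (\<Sum>f\<in>UNIV. \<Sum>b\<in>UNIV. \<gamma> e a f * k a b f b)"
        by (rule sum.swap)
      then show "(\<Sum>b\<in>UNIV. \<Sum>f\<in>UNIV. \<gamma> e a f * k a b f b) = (\<Sum>f\<in>UNIV. \<gamma> e a f * p a f)"
        by (simp only: sum_distrib_left[symmetric] p1)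
    qed
    moreover have "?S (\<lambda>a b. \<Sum>f\<in>UNIV. k a b a f * \<gamma> e b f) = ?S (\<lambda>b f. \<gamma> e b f * p b f)"
    proof -
      have "?S (\<lambda>a b. \<Sum>f\<in>UNIV. k a b a f * \<gamma> e b f) = (\<Sum>b\<in>UNIV. \<Sum>a\<in>UNIV. \<Sum>f\<in>UNIV. k a b a f * \<gamma> e b f)"
        by (rule sum.swap)
      also have "\<dots> = (\<Sum>b\<in>UNIV. \<Sum>f\<in>UNIV. \<Sum>a\<in>UNIV. k a b a f * \<gamma> e b f)"
        by (rule sum.cong[OF refl]) (rule sum.swap)
      also have "\<dots> = ?S (\<lambda>b f. \<gamma> e b f * p b f)"
        unfolding p_def by (simp add: sum_distrib_left mult.commute)
      finally show ?thesis .
    qed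
    ultimately show ?thesis by (simp add: \<beta>_def sum.distrib)
  qed
  have T2: "?S (\<lambda>a b. \<beta> a b e a b) = - (\<Sum>a\<in>UNIV. dp a e a) - ?S (\<lambda>a f. \<gamma> a a f * p e f)"
  proof -
    have "?S (\<lambda>a b. dk a b e a b) = - (\<Sum>a\<in>UNIV. dp a e a)"
      unfolding dp_def sum_negf[symmetric] by (intro sum.cong refl dk2)
    moreover have "?S (\<lambda>a b. \<Sum>f\<in>UNIV. \<gamma> a a f * k b e f b) = - ?S (\<lambda>a f. \<gamma> a a f * p e f)"
      unfolding sum_negf[symmetric]
    proof (rule sum.cong[OF refl])
      fix a :: 'n
      have "(\<Sum>b\<in>UNIV. \<Sum>f\<in>UNIV. \<gamma> a a f * k b e f b) = (\<Sum>f\<in>UNIV. \<Sum>b\<in>UNIV. \<gamma> a a f * k b e f b)"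
        by (rule sum.swap)
      then show "(\<Sum>b\<in>UNIV. \<Sum>f\<in>UNIV. \<gamma> a a f * k b e f b) = (\<Sum>f\<in>UNIV. - (\<gamma> a a f * p e f))"
        by (simp add: sum_distrib_left[symmetric] p2)
    qed
    \<comment> \<open>\<open>\<gamma>\<close> is symmetric in its lower indices \<open>a\<close> and
      \<open>f\<close>, in which \<open>k\<close> is antisymmetric.\<close>
    moreover have "?S (\<lambda>a b. \<Sum>f\<in>UNIV. k b e a f * \<gamma> a b f) = 0"
    proof -
      have "?S (\<lambda>a b. \<Sum>f\<in>UNIV. k b e a f * \<gamma> a b f) = (\<Sum>b\<in>UNIV. \<Sum>a\<in>UNIV. \<Sum>f\<in>UNIV. k b e a f * \<gamma> a b f)"
        by (rule sum.swap)
      also have "\<dots> = (\<Sum>b\<in>UNIV. \<Sum>a\<in>UNIV. \<Sum>f\<in>UNIV. \<gamma> a b f * k b e a f)"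
        by (simp only: mult.commute)
      also have "\<dots> = 0"
        by (intro sum.neutral ballI sum_sym_antisym \<gamma> k2)
      finally show ?thesis .
    qed
    ultimately show ?thesis by (simp add: \<beta>_def sum.distrib)
  qed
  have T3: "?S (\<lambda>a b. \<beta> b e a a b) = - (\<Sum>a\<in>UNIV. dp a e a) - ?S (\<lambda>a f. \<gamma> a a f * p e f)"
  proof -
    have "?S (\<lambda>a b. dk b e a a b) = (\<Sum>b\<in>UNIV. \<Sum>a\<in>UNIV. dk b e a a b)"
      by (rule sum.swap)
    also have "\<dots> = - (\<Sum>a\<in>UNIV. dp a e a)"
      unfolding dp_def sum_negf[symmetric] by (intro sum.cong refl dk1)
    finally have "?S (\<lambda>a b. dk b e a a b) = - (\<Sum>a\<in>UNIV. dp a e a)" .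
    moreover have "?S (\<lambda>a b. \<Sum>f\<in>UNIV. \<gamma> b a f * k e a f b) = 0"
    proof -
      have "(\<Sum>b\<in>UNIV. \<Sum>f\<in>UNIV. \<gamma> b a f * k e a f b) = 0" for a
        by (rule sum_sym_antisym) (use \<gamma> k2 in blast)+
      then show ?thesis by simp
    qed
    moreover have "?S (\<lambda>a b. \<Sum>f\<in>UNIV. k e a a f * \<gamma> b b f) = - ?S (\<lambda>a f. \<gamma> a a f * p e f)"
    proof -
      have "?S (\<lambda>a b. \<Sum>f\<in>UNIV. k e a a f * \<gamma> b b f) = (\<Sum>b\<in>UNIV. \<Sum>a\<in>UNIV. \<Sum>f\<in>UNIV. k e a a f * \<gamma> b b f)"
        by (rule sum.swap)
      also have "\<dots> = (\<Sum>b\<in>UNIV. \<Sum>f\<in>UNIV. \<Sum>a\<in>UNIV. k e a a f * \<gamma> b b f)"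
        by (rule sum.cong[OF refl]) (rule sum.swap)
      also have "\<dots> = - ?S (\<lambda>b f. \<gamma> b b f * p e f)"
        by (simp only: sum_distrib_right[symmetric] p3) (simp add: sum_negf mult.commute)
      finally show ?thesis .
    qed
    ultimately show ?thesis by (simp add: \<beta>_def sum.distrib)
  qed
  have arith: "s = 2 * d + 2 * c - 2 * q2"
    if "t1 + t2 + t3 = 0" "q1 = q2" "t1 = s + 2 * q1" "t2 = - d - c" "t3 = - d - c"
    for s d c q1 q2 t1 t2 t3 :: real
    using that by linarith
  have "?S (\<lambda>a b. \<beta> e a b a b) + ?S (\<lambda>a b. \<beta> a b e a b) + ?S (\<lambda>a b. \<beta> b e a a b) = 0"
    by (simp only: sum.distrib[symmetric] bianchi) simp
  moreover have "?S (\<lambda>a f. \<gamma> e a f * p a f) = ?S (\<lambda>a f. \<gamma> a f e * p f a)"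
  proof -
    have "?S (\<lambda>a f. \<gamma> e a f * p a f) = ?S (\<lambda>a f. \<gamma> e f a * p f a)" by (rule sum.swap)
    also have "\<dots> = ?S (\<lambda>a f. \<gamma> a f e * p f a)" by (intro sum.cong refl) (metis \<gamma>)
    finally show ?thesis .
  qed
  ultimately have "(\<Sum>b\<in>UNIV. dp e b b) = 2 * (\<Sum>a\<in>UNIV. dp a e a) + 2 * ?S (\<lambda>a f. \<gamma> a a f * p e f) - 2 * ?S (\<lambda>a f. \<gamma> a f e * p f a)"
    by (rule arith[OF _ _ T1 T2 T3])
  also have "\<dots> = 2 * (\<Sum>a\<in>UNIV. dp a e a + (\<Sum>f\<in>UNIV. \<gamma> a a f * p e f) - (\<Sum>f\<in>UNIV. \<gamma> a f e * p f a))"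
    by (simp only: sum.distrib sum_subtractf distrib_left right_diff_distrib)
  finally show ?thesis .
qed

section \<open>Curvature in a coordinate patch\<close>

definition conn :: "(real^'n::finite \<Rightarrow> real^'n^'n) \<Rightarrow> 'n \<Rightarrow> real^'n \<Rightarrow> real^'n^'n" where
  "conn G a x = (\<chi> k b. christoffel G k a b x)"

definition curv :: "(real^'n::finite \<Rightarrow> real^'n^'n) \<Rightarrow> 'n \<Rightarrow> 'n \<Rightarrow> real^'n \<Rightarrow> real^'n^'n" where
  "curv G a b x = pd a (conn G b) x - pd b (conn G a) x + conn G a x ** conn G b x - conn G b x ** conn G a x"

lemma sum_axis_mult: "(\<Sum>i\<in>UNIV. f i * (axis a 1 :: real^'n::finite) $ i) = f a"
  by (simp add: axis_def if_distrib cong: if_cong)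

lemma cov_deriv_axis:
  "cov_deriv G (\<lambda>_. axis a 1) Y x = pd a Y x + conn G a x *v Y x"
proof -
  have "(\<Sum>i\<in>UNIV. \<Sum>j\<in>UNIV. christoffel G k i j x * axis a 1 $ i * Y x $ j) = (conn G a x *v Y x) $ k" for k
  proof -
    have "(\<Sum>i\<in>UNIV. \<Sum>j\<in>UNIV. christoffel G k i j x * axis a 1 $ i * Y x $ j)
      = (\<Sum>i\<in>UNIV. (\<Sum>j\<in>UNIV. christoffel G k i j x * Y x $ j) * axis a 1 $ i)"
      by (simp add: sum_distrib_right sum_distrib_left ac_simps)
    then show ?thesis by (simp add: sum_axis_mult conn_def matrix_vector_mult_def)
  qed
  then show ?thesis by (simp add: cov_deriv_def vec_eq_iff)
qed

text \<open>Constant fields have vanishing brackets, so the invariant definition collapses to the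
  commutator of the operators \<open>pd a + conn G a\<close>.\<close>

lemma curvature_axis:
  assumes "\<And>a. conn G a differentiable (at x)"
  shows "curvature G (\<lambda>_. axis a 1) (\<lambda>_. axis b 1) (\<lambda>_. axis c 1) x = curv G a b x *v axis c 1"
proof -
  have 1: "cov_deriv G (\<lambda>_. axis b 1) (\<lambda>_. axis c 1) = (\<lambda>x. conn G b x *v axis c 1)" for b
    by (rule ext) (simp add: cov_deriv_axis frechet_derivative_const_zero)
  have 2: "lie_bracket (\<lambda>_. axis a 1) (\<lambda>_. axis b 1) = (\<lambda>_. 0 :: real^'a)"
    by (rule ext) (simp add: lie_bracket_def frechet_derivative_const_zero)
  have 3: "cov_deriv G (\<lambda>_. 0) (\<lambda>_. axis c 1) x = 0"
    by (simp add: cov_deriv_def frechet_derivative_const_zero vec_eq_iff)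
  have 4: "cov_deriv G (\<lambda>_. axis a 1) (\<lambda>x. conn G b x *v axis c 1) x
      = (pd a (conn G b) x + conn G a x ** conn G b x) *v axis c 1" for a b
    by (simp add: cov_deriv_axis matrix_vector_mul_assoc matrix_vector_mult_add_rdistrib
        frechet_derivative_bounded_linear[OF bounded_linear_matrix_vector_left assms])
  show ?thesis
    unfolding curvature_def 1 2 3 4 curv_def
    by (simp add: matrix_vector_mult_diff_rdistrib matrix_vector_mult_add_rdistrib)
qed

lemma ricci_matrix_nth:
  assumes "\<And>a. conn G a differentiable (at x)"
  shows "ricci_matrix G x $ b $ c = (\<Sum>a\<in>UNIV. curv G a b x $ a $ c)"
  by (simp add: ricci_matrix_def curvature_axis[OF assms] matrix_vector_mult_axis_nth)

text \<open>On the segment from \<open>mat 1\<close> to \<open>G\<close> every matrix is positive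
  definite, hence has no kernel. So the determinant has no zero there, and by the intermediate value
  theorem it keeps the sign it has at \<open>mat 1\<close>.\<close>

lemma det_pos_of_pos_def:
  fixes G :: "real^'n^'n"
  assumes "\<And>v. v \<noteq> 0 \<Longrightarrow> 0 < v \<bullet> (G *v v)"
  shows "0 < det G"
proof (rule ccontr)
  assume neg: "\<not> 0 < det G"
  let ?M = "\<lambda>t::real. mat 1 + t *\<^sub>R (G - mat 1)"
  have "continuous_on {0..1} (\<lambda>t. det (?M t))"
    by (rule Ck_on_continuous[where k=0, OF Ck_on_subset[where U=UNIV]])
       (intro Ck_on_det Ck_on_add Ck_on_bounded_linear[OF _ bounded_linear_scaleR_left] Ck_on_ident Ck_on_const open_UNIV, simp)
  moreover have "det (?M 1) \<le> 0" "0 \<le> det (?M 0)" using neg by auto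
  ultimately obtain t where t: "0 \<le> t" "t \<le> 1" "det (?M t) = 0"
    using IVT2'[of "\<lambda>t. det (?M t)" 1 0 0] by auto
  then obtain v where v: "v \<noteq> 0" "?M t *v v = 0"
    using invertible_det_nz[of "?M t"] invertible_left_inverse[of "?M t"] matrix_left_invertible_ker[of "?M t"] by blast
  have "?M t *v v = (1 - t) *\<^sub>R v + t *\<^sub>R (G *v v)"
    by (simp add: matrix_vector_mult_add_rdistrib matrix_vector_mult_diff_rdistrib scaleR_matrix_vector_assoc[symmetric] algebra_simps)
  then have "v \<bullet> (?M t *v v) = (1 - t) * (v \<bullet> v) + t * (v \<bullet> (G *v v))"
    by (simp add: inner_add_right)
  moreover have "0 < (1 - t) * (v \<bullet> v) + t * (v \<bullet> (G *v v))"
  proof (cases "t = 0")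
    case False
    then have "0 < t * (v \<bullet> (G *v v))" using t assms[OF v(1)] by simp
    then show ?thesis using t by (simp add: add_nonneg_pos)
  qed (use v in simp)
  ultimately show False using v by simp
qed

text \<open>Metric components on any open set of coordinate space, without reference to a chart, so
  that the overlap of two charts is an instance as well.\<close>

locale metric_patch =
  fixes U :: "(real^'n::finite) set" and G :: "real^'n \<Rightarrow> real^'n^'n"
  assumes open_U: "open U" and smooth_G: "smooth_on U G"
    and sym_G: "\<And>x. x \<in> U \<Longrightarrow> transpose (G x) = G x"
    and pos_G: "\<And>x v. x \<in> U \<Longrightarrow> v \<noteq> 0 \<Longrightarrow> 0 < v \<bullet> (G x *v v)"
begin

abbreviation "H x \<equiv> matrix_inv (G x)"

lemma det_pos: "x \<in> U \<Longrightarrow> 0 < det (G x)"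
  using det_pos_of_pos_def pos_G by blast

lemma det_nz: "x \<in> U \<Longrightarrow> det (G x) \<noteq> 0"
  using det_pos by force

lemma G_H: "x \<in> U \<Longrightarrow> G x ** H x = mat 1" and H_G: "x \<in> U \<Longrightarrow> H x ** G x = mat 1"
  using matrix_inv_mult det_nz by blast+

lemma G_H_assoc: "x \<in> U \<Longrightarrow> G x ** (H x ** B) = B" and H_G_assoc: "x \<in> U \<Longrightarrow> H x ** (G x ** B) = B"
  by (simp_all add: matrix_mul_assoc G_H H_G)

lemma sym_H: assumes "x \<in> U" shows "transpose (H x) = H x"
proof -
  have "G x ** transpose (H x) = transpose (H x ** G x)"
    by (simp add: matrix_transpose_mul sym_G assms)
  also have "\<dots> = mat 1" by (simp add: H_G assms transpose_mat)
  finally show ?thesis using matrix_inv_unique by metis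
qed

lemma Ck_G: "Ck_on k U G"
  using smooth_G by (simp add: smooth_on_def)

lemma Ck_H: "Ck_on k U H"
  by (intro Ck_on_matrix_inv open_U Ck_G det_nz)

lemma Ck_pd_G: "Ck_on k U (pd a G)"
  using Ck_on_deriv[OF Ck_G] by blast

lemma pd_G_sym: "x \<in> U \<Longrightarrow> pd a G x $ i $ j = pd a G x $ j $ i"
proof -
  assume x: "x \<in> U"
  have "pd a G x = frechet_derivative (\<lambda>y. transpose (G y)) (at x) (axis a 1)"
    by (rule arg_cong[where f="\<lambda>F. F (axis a 1)"], rule frechet_derivative_cong_open[OF open_U x]) (simp add: sym_G)
  also have "\<dots> = transpose (pd a G x)"
    by (rule frechet_derivative_bounded_linear[OF bounded_linear_transpose Ck_on_differentiable[OF Ck_G x]])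
  finally show ?thesis by (metis transpose_nth)
qed

lemma partial_G: "x \<in> U \<Longrightarrow> partial a (\<lambda>y. G y $ i $ j) x = pd a G x $ i $ j"
  unfolding partial_def
  using Ck_on_differentiable[OF Ck_G] by (simp add: frechet_derivative_nth differentiable_nth)

lemma conn_nth:
  "x \<in> U \<Longrightarrow> conn G a x $ k $ b = (\<Sum>l\<in>UNIV. H x $ k $ l * (pd a G x $ b $ l + pd b G x $ a $ l - pd l G x $ a $ b)) / 2"
  by (simp add: conn_def christoffel_def partial_G)

lemma Ck_conn: "Ck_on k U (conn G a)"
proof (intro Ck_on_vec open_U)
  fix i b
  let ?f = "\<lambda>x. (1/2) * (\<Sum>l\<in>UNIV. H x $ i $ l * (pd a G x $ b $ l + pd b G x $ a $ l - pd l G x $ a $ b))"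
  have "Ck_on k U ?f"
    by (intro Ck_on_mult Ck_on_sum Ck_on_diff Ck_on_add Ck_on_const open_U
        Ck_on_nth[OF open_U Ck_on_nth[OF open_U Ck_H]] Ck_on_nth[OF open_U Ck_on_nth[OF open_U Ck_pd_G]])
  then show "Ck_on k U (\<lambda>x. conn G a x $ i $ b)"
    by (rule Ck_on_cong[THEN iffD1, OF open_U, rotated]) (simp add: conn_nth)
qed

lemma conn_differentiable: "x \<in> U \<Longrightarrow> conn G a differentiable (at x)"
  by (rule Ck_on_differentiable[OF Ck_conn])

lemma conn_sym: "x \<in> U \<Longrightarrow> conn G a x $ k $ b = conn G b x $ k $ a"
  using pd_G_sym[of x] by (simp add: conn_nth add.commute[of "pd a G x $ _ $ _"])

text \<open>Lowering the upper index cancels the inverse metric and leaves the Christoffel symbols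
  of the first kind, in which compatibility is a linear identity.\<close>

lemma G_conn_nth:
  assumes x: "x \<in> U"
  shows "(G x ** conn G a x) $ l $ b = (pd a G x $ b $ l + pd b G x $ a $ l - pd l G x $ a $ b) / 2"
proof -
  let ?w = "\<chi> l. (pd a G x $ b $ l + pd b G x $ a $ l - pd l G x $ a $ b) / 2"
  have "(\<chi> k. conn G a x $ k $ b) = H x *v ?w"
    by (simp add: vec_eq_iff conn_nth x matrix_vector_nth sum_divide_distrib)
  then have "(G x *v (\<chi> k. conn G a x $ k $ b)) $ l = ?w $ l"
    by (simp add: matrix_vector_mul_assoc G_H x)
  then show ?thesis by (simp add: matrix_mult_nth matrix_vector_nth)
qed

text \<open>Adding a Christoffel symbol of the first kind to the one with \<open>b\<close> and
  \<open>l\<close> exchanged doubles the derivative in direction \<open>a\<close> and cancels the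
  other two.\<close>

lemma metric_compat:
  assumes x: "x \<in> U"
  shows "pd a G x = transpose (conn G a x) ** G x + G x ** conn G a x"
proof -
  have "transpose (conn G a x) ** G x = transpose (G x ** conn G a x)"
    by (simp add: matrix_transpose_mul sym_G x)
  then show ?thesis
    using pd_G_sym[OF x] by (simp add: vec_eq_iff transpose_nth G_conn_nth x field_simps)
qed

text \<open>Differentiating \<open>G ** H = mat 1\<close> carries metric compatibility over: the
  inverse metric is parallel too.\<close>

lemma pd_H:
  assumes x: "x \<in> U"
  shows "pd a H x = - (H x ** transpose (conn G a x) + conn G a x ** H x)"
proof -
  have "frechet_derivative (\<lambda>y. G y ** H y) (at x) (axis a 1) = frechet_derivative (\<lambda>y. mat 1) (at x) (axis a 1)"
    by (rule arg_cong[where f="\<lambda>F. F (axis a 1)"], rule frechet_derivative_cong_open[OF open_U x]) (simp add: G_H)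
  then have "G x ** pd a H x + pd a G x ** H x = 0"
    by (simp add: frechet_derivative_const_zero
        frechet_derivative_matrix_mult[OF Ck_on_differentiable[OF Ck_G x] Ck_on_differentiable[OF Ck_H x]])
  then have "H x ** (G x ** pd a H x) = - (H x ** (pd a G x ** H x))"
    by (metis add_eq_0_iff2 matrix_minus_right)
  then show ?thesis
    by (simp add: H_G_assoc x metric_compat matrix_algebra matrix_mul_assoc[symmetric] G_H)
qed

abbreviation "R a b \<equiv> curv G a b"

lemma R_eq: "R a b = (\<lambda>x. pd a (conn G b) x - pd b (conn G a) x + conn G a x ** conn G b x - conn G b x ** conn G a x)"
  by (simp add: curv_def fun_eq_iff)

lemma Ck_R: "Ck_on k U (R a b)"
  unfolding R_eq
  by (intro Ck_on_diff Ck_on_add open_U Ck_on_matrix_mult Ck_conn Ck_on_deriv[OF Ck_conn])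

lemma R_antisym: "R a b x = - R b a x"
  by (simp add: curv_def)

lemma second_commute: "Ck_on 2 U f \<Longrightarrow> x \<in> U \<Longrightarrow> pd a (pd b f) x = pd b (pd a f) x"
  for f :: "real^'n \<Rightarrow> 'b::euclidean_space"
  by (rule second_derivative_commute[OF open_U])

lemmas diff_conn = Ck_on_differentiable[OF Ck_conn] Ck_on_differentiable[OF Ck_on_deriv[OF Ck_conn]]

text \<open>Compatibility applied twice expresses the second derivatives of \<open>G\<close> through
  the connection. Their symmetry says exactly that the curvature matrices are skew-adjoint for the
  metric.\<close>

lemma R_metric:
  assumes x: "x \<in> U"
  shows "transpose (R a b x) ** G x + G x ** R a b x = 0"
proof -
  have "pd a (pd b G) x = transpose (pd a (conn G b) x) ** G x + transpose (conn G b x) ** pd a G x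
      + (pd a G x ** conn G b x + G x ** pd a (conn G b) x)" for a b
  proof -
    have "pd a (pd b G) x = frechet_derivative (\<lambda>y. transpose (conn G b y) ** G y + G y ** conn G b y) (at x) (axis a 1)"
      by (rule arg_cong[where f="\<lambda>F. F (axis a 1)"], rule frechet_derivative_cong_open[OF open_U x]) (simp add: metric_compat)
    then show ?thesis
      using x by (simp add: frechet_derivative_add frechet_derivative_matrix_mult differentiable_matrix_mult
          diff_conn differentiable_bounded_linear[OF bounded_linear_transpose]
          frechet_derivative_bounded_linear[OF bounded_linear_transpose] Ck_on_differentiable[OF Ck_G] ac_simps)
  qed
  then have "transpose (pd a (conn G b) x) ** G x + transpose (conn G b x) ** pd a G x
      + (pd a G x ** conn G b x + G x ** pd a (conn G b) x)
    = transpose (pd b (conn G a) x) ** G x + transpose (conn G a x) ** pd b G x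
      + (pd b G x ** conn G a x + G x ** pd b (conn G a) x)"
    using second_commute[OF Ck_G x, of a b] by metis
  then show ?thesis
    by (simp add: curv_def metric_compat x matrix_algebra transpose_algebra matrix_mul_assoc algebra_simps)
qed

lemma second_bianchi:
  assumes x: "x \<in> U"
  shows "(pd e (R a b) x + conn G e x ** R a b x - R a b x ** conn G e x)
    + (pd a (R b e) x + conn G a x ** R b e x - R b e x ** conn G a x)
    + (pd b (R e a) x + conn G b x ** R e a x - R e a x ** conn G b x) = 0"
proof -
  have *: "pd e (R a b) x = pd e (pd a (conn G b)) x - pd e (pd b (conn G a)) x
     + (conn G a x ** pd e (conn G b) x + pd e (conn G a) x ** conn G b x)
     - (conn G b x ** pd e (conn G a) x + pd e (conn G b) x ** conn G a x)" for e a b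
    unfolding R_eq
    using x by (simp add: frechet_derivative_add frechet_derivative_diff frechet_derivative_matrix_mult
        differentiable_matrix_mult diff_conn)
  have c: "pd e (pd a (conn G c)) x = pd a (pd e (conn G c)) x" for a e c
    by (rule second_commute[OF Ck_conn x])
  show ?thesis
    unfolding * curv_def
    by (rule gauge_bianchi_algebra[where A="\<lambda>a. conn G a x" and D="\<lambda>a b. pd a (conn G b) x"
          and DD="\<lambda>a b c. pd a (pd b (conn G c)) x"]) (rule c)
qed

text \<open>Right multiplication by the inverse metric raises the last index. \<open>RH a b\<close>
  then has two upper matrix indices, so its antisymmetry is plain skewness of a matrix and its
  covariant derivative treats rows and columns alike.\<close>

definition ricH :: "real^'n \<Rightarrow> real^'n^'n" where "ricH x = ricci_matrix G x ** H x"
definition scal :: "real^'n \<Rightarrow> real" where "scal x = (\<Sum>i\<in>UNIV. \<Sum>j\<in>UNIV. H x $ i $ j * ricci_matrix G x $ i $ j)"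
definition RH :: "'n \<Rightarrow> 'n \<Rightarrow> real^'n \<Rightarrow> real^'n^'n" where "RH a b x = R a b x ** H x"

lemma ricci_nth: "x \<in> U \<Longrightarrow> ricci_matrix G x $ b $ c = (\<Sum>a\<in>UNIV. R a b x $ a $ c)"
  using ricci_matrix_nth[OF conn_differentiable] by blast

lemma Ck_ricci: "Ck_on k U (ricci_matrix G)"
proof (intro Ck_on_vec open_U)
  fix b c
  have "Ck_on k U (\<lambda>x. \<Sum>a\<in>UNIV. R a b x $ a $ c)"
    by (intro Ck_on_sum open_U Ck_on_nth[OF open_U Ck_on_nth[OF open_U Ck_R]])
  then show "Ck_on k U (\<lambda>x. ricci_matrix G x $ b $ c)"
    by (rule Ck_on_cong[THEN iffD1, OF open_U, rotated]) (simp add: ricci_nth)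
qed

lemma ricH_nth: "x \<in> U \<Longrightarrow> ricH x $ b $ c = (\<Sum>a\<in>UNIV. RH a b x $ a $ c)"
  unfolding ricH_def RH_def matrix_mult_nth
  by (simp add: ricci_nth sum_distrib_right) (rule sum.swap)

lemma scal_eq_trace: "x \<in> U \<Longrightarrow> scal x = trace (ricH x)"
proof -
  assume x: "x \<in> U"
  have "H x $ i $ j = H x $ j $ i" for i j using sym_H[OF x] by (metis transpose_nth)
  then show ?thesis
    by (simp add: scal_def trace_def ricH_def matrix_mult_nth mult.commute)
qed

lemma Ck_RH: "Ck_on k U (RH a b)"
  unfolding RH_def[abs_def] by (intro Ck_on_matrix_mult open_U Ck_R Ck_H)

lemma Ck_ricH: "Ck_on k U ricH"
  unfolding ricH_def[abs_def] by (intro Ck_on_matrix_mult open_U Ck_ricci Ck_H)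

lemma Ck_scal: "Ck_on k U scal"
  unfolding scal_def[abs_def]
  by (intro Ck_on_sum Ck_on_mult open_U Ck_on_nth[OF open_U Ck_on_nth[OF open_U Ck_ricci]]
      Ck_on_nth[OF open_U Ck_on_nth[OF open_U Ck_H]])

lemma RH_antisym1: "RH a b x = - RH b a x"
  unfolding RH_def by (subst R_antisym) (simp add: matrix_algebra)

lemma RH_antisym2:
  assumes x: "x \<in> U"
  shows "transpose (RH a b x) = - RH a b x"
proof -
  have "H x ** (transpose (R a b x) ** G x + G x ** R a b x) ** H x = 0"
    by (simp add: R_metric x)
  then have "H x ** transpose (R a b x) + R a b x ** H x = 0"
    by (simp add: matrix_algebra matrix_mul_assoc[symmetric] G_H H_G_assoc x)
  then show ?thesis
    by (simp add: RH_def matrix_transpose_mul sym_H x add_eq_0_iff2)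
qed

text \<open>Raising an index commutes with covariant differentiation because the inverse metric is
  parallel by \<open>pd_H\<close>; so \<open>second_bianchi\<close> can be multiplied by
  \<open>H x\<close>.\<close>

lemma pd_RH:
  assumes x: "x \<in> U"
  shows "pd e (RH a b) x + conn G e x ** RH a b x + RH a b x ** transpose (conn G e x)
    = (pd e (R a b) x + conn G e x ** R a b x - R a b x ** conn G e x) ** H x"
  unfolding RH_def[abs_def]
  by (simp add: frechet_derivative_matrix_mult Ck_on_differentiable[OF Ck_R x] Ck_on_differentiable[OF Ck_H x]
      pd_H x matrix_algebra matrix_mul_assoc algebra_simps)

lemma pd_congI:
  assumes "x \<in> U" "\<And>y. y \<in> U \<Longrightarrow> f y = g y"
  shows "pd a f x = pd a g x"
  using frechet_derivative_cong_open[OF open_U assms(1), of f g] assms(2) by simp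

text \<open>The transpose puts the raised index of \<open>ricH\<close> into the row, which makes it
  an endomorphism. The summand is then its covariant derivative in direction \<open>a\<close>, and
  the sum is the divergence of the Ricci tensor.\<close>

lemma contracted_bianchi:
  assumes x: "x \<in> U"
  shows "pd e scal x = 2 * (\<Sum>a\<in>UNIV. (pd a (\<lambda>y. transpose (ricH y)) x
     + conn G a x ** transpose (ricH x) - transpose (ricH x) ** conn G a x) $ a $ e)"
proof -
  note dRH = Ck_on_differentiable[OF Ck_RH x]
  have dRH1: "pd e (RH a b) x $ d $ c = - pd e (RH b a) x $ d $ c" for e a b d c
  proof -
    have "pd e (RH a b) x = pd e (\<lambda>y. - RH b a y) x"
      by (rule pd_congI[OF x]) (rule RH_antisym1)
    also have "\<dots> = - pd e (RH b a) x"
      by (rule frechet_derivative_bounded_linear[OF bounded_linear_minus[OF bounded_linear_ident] dRH])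
    finally show ?thesis by simp
  qed
  have dRH2: "pd e (RH a b) x $ d $ c = - pd e (RH a b) x $ c $ d" for e a b d c
  proof -
    have "transpose (pd e (RH a b) x) = pd e (\<lambda>y. transpose (RH a b y)) x"
      by (rule frechet_derivative_bounded_linear[OF bounded_linear_transpose dRH, symmetric])
    also have "\<dots> = pd e (\<lambda>y. - RH a b y) x"
      by (rule pd_congI[OF x]) (rule RH_antisym2)
    also have "\<dots> = - pd e (RH a b) x"
      by (rule frechet_derivative_bounded_linear[OF bounded_linear_minus[OF bounded_linear_ident] dRH])
    finally show ?thesis by (rule transpose_eq_minus_nth)
  qed
  have bianchi: "(pd e (RH a b) x $ d $ c + (\<Sum>f\<in>UNIV. conn G e x $ d $ f * RH a b x $ f $ c) + (\<Sum>f\<in>UNIV. RH a b x $ d $ f * conn G e x $ c $ f))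
    + (pd a (RH b e) x $ d $ c + (\<Sum>f\<in>UNIV. conn G a x $ d $ f * RH b e x $ f $ c) + (\<Sum>f\<in>UNIV. RH b e x $ d $ f * conn G a x $ c $ f))
    + (pd b (RH e a) x $ d $ c + (\<Sum>f\<in>UNIV. conn G b x $ d $ f * RH e a x $ f $ c) + (\<Sum>f\<in>UNIV. RH e a x $ d $ f * conn G b x $ c $ f)) = 0"
    for e a b d c
  proof -
    have "(pd e (RH a b) x + conn G e x ** RH a b x + RH a b x ** transpose (conn G e x))
      + (pd a (RH b e) x + conn G a x ** RH b e x + RH b e x ** transpose (conn G a x))
      + (pd b (RH e a) x + conn G b x ** RH e a x + RH e a x ** transpose (conn G b x)) = 0"
      unfolding pd_RH[OF x] matrix_add_rdistrib[symmetric] second_bianchi[OF x] by simp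
    then have "((pd e (RH a b) x + conn G e x ** RH a b x + RH a b x ** transpose (conn G e x))
      + (pd a (RH b e) x + conn G a x ** RH b e x + RH b e x ** transpose (conn G a x))
      + (pd b (RH e a) x + conn G b x ** RH e a x + RH e a x ** transpose (conn G b x))) $ d $ c = 0"
      by (simp only: zero_index)
    then show ?thesis by (simp only: vector_add_component matrix_mult_nth transpose_nth)
  qed
  have dricH: "pd a ricH x $ e $ c = (\<Sum>m\<in>UNIV. pd a (RH m e) x $ m $ c)" for a e c
  proof -
    have "pd a ricH x $ e $ c = pd a (\<lambda>y. ricH y $ e $ c) x"
      by (rule pd_nth2[OF Ck_on_differentiable[OF Ck_ricH x], symmetric])
    also have "\<dots> = pd a (\<lambda>y. \<Sum>m\<in>UNIV. RH m e y $ m $ c) x"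
      by (rule pd_congI[OF x]) (rule ricH_nth)
    also have "\<dots> = (\<Sum>m\<in>UNIV. pd a (\<lambda>y. RH m e y $ m $ c) x)"
      by (intro frechet_derivative_sum differentiable_nth dRH)
    also have "\<dots> = (\<Sum>m\<in>UNIV. pd a (RH m e) x $ m $ c)"
      by (intro sum.cong refl pd_nth2 dRH)
    finally show ?thesis .
  qed
  have dscal: "pd e scal x = (\<Sum>b\<in>UNIV. pd e ricH x $ b $ b)"
  proof -
    have "pd e scal x = pd e (\<lambda>y. \<Sum>b\<in>UNIV. ricH y $ b $ b) x"
      by (rule pd_congI[OF x]) (simp add: scal_eq_trace trace_def)
    also have "\<dots> = (\<Sum>b\<in>UNIV. pd e (\<lambda>y. ricH y $ b $ b) x)"
      by (intro frechet_derivative_sum differentiable_nth Ck_on_differentiable[OF Ck_ricH x])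
    also have "\<dots> = (\<Sum>b\<in>UNIV. pd e ricH x $ b $ b)"
      by (intro sum.cong refl pd_nth2 Ck_on_differentiable[OF Ck_ricH x])
    finally show ?thesis .
  qed
  have tr: "pd a (\<lambda>y. transpose (ricH y)) x = transpose (pd a ricH x)" for a
    by (rule frechet_derivative_bounded_linear[OF bounded_linear_transpose Ck_on_differentiable[OF Ck_ricH x]])
  have k1: "RH a b x $ d $ c = - RH b a x $ d $ c" for a b d c
    by (subst RH_antisym1) simp
  have k2: "RH a b x $ d $ c = - RH a b x $ c $ d" for a b d c
    by (rule transpose_eq_minus_nth[OF RH_antisym2[OF x]])
  have "(\<Sum>b\<in>UNIV. \<Sum>m\<in>UNIV. pd e (RH m b) x $ m $ b)
    = 2 * (\<Sum>a\<in>UNIV. (\<Sum>m\<in>UNIV. pd a (RH m e) x $ m $ a)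
        + (\<Sum>f\<in>UNIV. conn G a x $ a $ f * (\<Sum>m\<in>UNIV. RH m e x $ m $ f))
        - (\<Sum>f\<in>UNIV. conn G a x $ f $ e * (\<Sum>m\<in>UNIV. RH m f x $ m $ a)))"
    by (rule contracted_bianchi_algebra[where k="\<lambda>a b d c. RH a b x $ d $ c" and dk="\<lambda>e a b d c. pd e (RH a b) x $ d $ c"
          and \<gamma>="\<lambda>e d f. conn G e x $ d $ f"])
       (fact k1 k2 dRH1 dRH2 conn_sym[OF x] bianchi)+
  then show ?thesis
    unfolding dscal dricH
    by (simp add: tr transpose_nth matrix_mult_nth dricH ricH_nth x mult.commute)
qed

end

section \<open>Lie derivative of the metric and divergence of the soliton field\<close>

definition nabla :: "(real^'n::finite \<Rightarrow> real^'n^'n) \<Rightarrow> (real^'n \<Rightarrow> real^'n) \<Rightarrow> real^'n \<Rightarrow> real^'n^'n" where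
  "nabla G X x = (\<chi> k a. (pd a X x + conn G a x *v X x) $ k)"

context metric_patch
begin

text \<open>Compatibility splits the derivative of \<open>G\<close> along \<open>X\<close> into two
  Christoffel terms. By symmetry of the lower indices each of them is the correction that turns a
  partial derivative of \<open>X\<close> into a covariant one.\<close>

lemma lie_matrix_eq:
  assumes x: "x \<in> U" and X: "X differentiable (at x)"
  shows "lie_matrix G X x = G x ** nabla G X x + transpose (G x ** nabla G X x)"
proof -
  have br: "lie_bracket X (\<lambda>_. axis i 1) x = - pd i X x" for i
    by (simp add: lie_bracket_def frechet_derivative_const_zero)
  have sym: "G x $ i $ j = G x $ j $ i" for i j
    using arg_cong[OF sym_G[OF x], of "\<lambda>A. A $ j $ i"] by (simp only: transpose_nth)
  have der: "frechet_derivative (\<lambda>y. G y $ i $ j) (at x) (X x) = (\<Sum>a\<in>UNIV. X x $ a * pd a G x $ i $ j)" for i j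
  proof -
    have d: "G differentiable (at x)" by (rule Ck_on_differentiable[OF Ck_G x])
    show ?thesis
      using frechet_derivative_pd[OF d, of "X x"] d
      by (simp add: differentiable_nth frechet_derivative_nth)
  qed
  have 1: "v \<bullet> (G x *v axis j 1) = (\<Sum>k\<in>UNIV. G x $ j $ k * v $ k)" for v j
    by (simp add: inner_vec_def matrix_vector_mult_axis_nth sym[of j] mult.commute)
  have 2: "axis i 1 \<bullet> (G x *v w) = (\<Sum>k\<in>UNIV. G x $ i $ k * w $ k)" for w i
    by (simp add: inner_axis' matrix_vector_nth)
  have c: "(\<Sum>a\<in>UNIV. X x $ a * (\<Sum>k\<in>UNIV. G x $ i $ k * conn G a x $ k $ j))
    = (\<Sum>k\<in>UNIV. G x $ i $ k * (\<Sum>a\<in>UNIV. conn G j x $ k $ a * X x $ a))" for i j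
  proof -
    have "(\<Sum>a\<in>UNIV. X x $ a * (\<Sum>k\<in>UNIV. G x $ i $ k * conn G a x $ k $ j))
      = (\<Sum>a\<in>UNIV. \<Sum>k\<in>UNIV. G x $ i $ k * (conn G j x $ k $ a * X x $ a))"
      by (simp add: sum_distrib_left conn_sym[OF x, of _ _ j] mult_ac)
    also have "\<dots> = (\<Sum>k\<in>UNIV. \<Sum>a\<in>UNIV. G x $ i $ k * (conn G j x $ k $ a * X x $ a))"
      by (rule sum.swap)
    finally show ?thesis by (simp only: sum_distrib_left)
  qed
  have pdG: "pd a G x $ i $ j = (\<Sum>k\<in>UNIV. G x $ j $ k * conn G a x $ k $ i) + (\<Sum>k\<in>UNIV. G x $ i $ k * conn G a x $ k $ j)" for a i j
    by (simp add: metric_compat x matrix_mult_nth transpose_nth sym[of _ j] mult.commute)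
  show ?thesis
  proof (subst vec_eq_iff, intro allI, subst vec_eq_iff, intro allI)
    fix i j
    have "lie_matrix G X x $ i $ j = (\<Sum>a\<in>UNIV. X x $ a * pd a G x $ i $ j)
       + (\<Sum>k\<in>UNIV. G x $ j $ k * pd i X x $ k) + (\<Sum>k\<in>UNIV. G x $ i $ k * pd j X x $ k)"
      by (simp add: lie_matrix_def der br 1 2 sum_negf)
    also have "(\<Sum>a\<in>UNIV. X x $ a * pd a G x $ i $ j)
      = (\<Sum>k\<in>UNIV. G x $ j $ k * (\<Sum>a\<in>UNIV. conn G i x $ k $ a * X x $ a))
      + (\<Sum>k\<in>UNIV. G x $ i $ k * (\<Sum>a\<in>UNIV. conn G j x $ k $ a * X x $ a))"
      by (simp only: pdG distrib_left sum.distrib c)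
    finally show "lie_matrix G X x $ i $ j = (G x ** nabla G X x + transpose (G x ** nabla G X x)) $ i $ j"
      by (simp add: matrix_mult_nth transpose_nth nabla_def matrix_vector_nth distrib_left sum.distrib)
  qed
qed

text \<open>In Jacobi's formula both summands of \<open>metric_compat\<close> contribute the trace
  of \<open>conn G a x\<close>; the square root removes the resulting factor 2.\<close>

lemma pd_sqrt_det:
  assumes x: "x \<in> U"
  shows "pd a (\<lambda>y. sqrt (det (G y))) x = sqrt (det (G x)) * trace (conn G a x)"
    and "(\<lambda>y. sqrt (det (G y))) differentiable (at x)"
proof -
  note d = frechet_derivative_det[OF Ck_on_differentiable[OF Ck_G x] det_nz[OF x]]
  have D: "((\<lambda>y. sqrt (det (G y))) has_derivative
     (\<lambda>v. frechet_derivative (\<lambda>y. det (G y)) (at x) v * (inverse (sqrt (det (G x))) / 2))) (at x)"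
    by (rule DERIV_compose_FDERIV[OF DERIV_real_sqrt[OF det_pos[OF x]] frechet_derivativeD[OF d(2)]])
  have "trace (H x ** (transpose (conn G a x) ** G x)) = trace (conn G a x)"
    by (subst trace_mul_sym) (simp add: matrix_mul_assoc[symmetric] G_H x trace_transpose)
  then have "pd a (\<lambda>y. det (G y)) x = det (G x) * (2 * trace (conn G a x))"
    by (simp add: d(1) metric_compat x matrix_algebra trace_add H_G_assoc)
  moreover have "det (G x) = sqrt (det (G x)) * sqrt (det (G x))" using det_pos[OF x] by simp
  ultimately show "pd a (\<lambda>y. sqrt (det (G y))) x = sqrt (det (G x)) * trace (conn G a x)"
    using det_pos[OF x] by (simp add: frechet_derivative_at'[OF D] field_simps)
  show "(\<lambda>y. sqrt (det (G y))) differentiable (at x)" using D by (rule differentiableI)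
qed

text \<open>Order 1 is all that integration by parts takes from the volume density.\<close>

lemma Ck_sqrt_det: "Ck_on 1 U (\<lambda>y. sqrt (det (G y)))"
proof -
  have "continuous_on U (\<lambda>x. frechet_derivative (\<lambda>y. sqrt (det (G y))) (at x) v)" for v
  proof (rule continuous_on_cong[THEN iffD1, OF refl])
    have c: "continuous_on U (\<lambda>y. sqrt (det (G y)))"
      by (intro differentiable_imp_continuous_on_at pd_sqrt_det)
    show "continuous_on U (\<lambda>x. \<Sum>a\<in>UNIV. v $ a *\<^sub>R (sqrt (det (G x)) * trace (conn G a x)))"
      unfolding trace_def
      by (intro continuous_intros c Ck_on_continuous[OF Ck_on_nth[OF open_U Ck_on_nth[OF open_U Ck_conn]]])
    show "(\<Sum>a\<in>UNIV. v $ a *\<^sub>R (sqrt (det (G x)) * trace (conn G a x))) = frechet_derivative (\<lambda>y. sqrt (det (G y))) (at x) v"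
      if "x \<in> U" for x
      by (simp only: frechet_derivative_pd[OF pd_sqrt_det(2)[OF that], of v] pd_sqrt_det(1)[OF that])
  qed
  then show ?thesis using pd_sqrt_det(2) by (simp add: One_nat_def)
qed

text \<open>The tensor E of the overview in coordinates.\<close>

definition tfric :: "real^'n \<Rightarrow> real^'n^'n" where
  "tfric x = ricci_matrix G x - (scal x / real CARD('n)) *\<^sub>R G x"

lemma Ck_tfric: "Ck_on k U tfric"
  unfolding tfric_def[abs_def] divide_inverse
  by (intro Ck_on_diff Ck_on_scaleR Ck_on_mult Ck_on_const open_U Ck_ricci Ck_scal Ck_G)

text \<open>As a trace, the quadruple sum becomes accessible to cyclic permutation and to invariance
  under conjugation.\<close>

lemma norm_eq_trace:
  assumes x: "x \<in> U"
  shows "(\<Sum>i\<in>UNIV. \<Sum>j\<in>UNIV. \<Sum>k\<in>UNIV. \<Sum>l\<in>UNIV. H x $ i $ k * H x $ j $ l * T $ i $ j * T $ k $ l)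
    = trace (transpose T ** H x ** T ** H x)"
proof -
  have sym: "H x $ i $ j = H x $ j $ i" for i j
    using arg_cong[OF sym_H[OF x], of "\<lambda>A. A $ j $ i"] by (simp only: transpose_nth)
  have "trace (transpose T ** H x ** T ** H x)
    = (\<Sum>j\<in>UNIV. \<Sum>l\<in>UNIV. \<Sum>k\<in>UNIV. \<Sum>i\<in>UNIV. T $ i $ j * H x $ i $ k * T $ k $ l * H x $ l $ j)"
    by (simp only: trace_def matrix_mult_nth transpose_nth sum_distrib_right)
  also have "\<dots>
    = (\<Sum>j\<in>UNIV. \<Sum>l\<in>UNIV. \<Sum>k\<in>UNIV. \<Sum>i\<in>UNIV. H x $ i $ k * H x $ j $ l * T $ i $ j * T $ k $ l)"
  proof (intro sum.cong refl)
    fix j l k i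
    show "T $ i $ j * H x $ i $ k * T $ k $ l * H x $ l $ j = H x $ i $ k * H x $ j $ l * T $ i $ j * T $ k $ l"
      by (subst sym[of l j]) (simp only: mult_ac)
  qed
  also have "\<dots> = (\<Sum>j\<in>UNIV. \<Sum>l\<in>UNIV. \<Sum>i\<in>UNIV. \<Sum>k\<in>UNIV. H x $ i $ k * H x $ j $ l * T $ i $ j * T $ k $ l)"
    by (rule sum.cong[OF refl], rule sum.cong[OF refl], rule sum.swap)
  also have "\<dots> = (\<Sum>j\<in>UNIV. \<Sum>i\<in>UNIV. \<Sum>l\<in>UNIV. \<Sum>k\<in>UNIV. H x $ i $ k * H x $ j $ l * T $ i $ j * T $ k $ l)"
    by (rule sum.cong[OF refl], rule sum.swap)
  also have "\<dots> = (\<Sum>i\<in>UNIV. \<Sum>j\<in>UNIV. \<Sum>l\<in>UNIV. \<Sum>k\<in>UNIV. H x $ i $ k * H x $ j $ l * T $ i $ j * T $ k $ l)"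
    by (rule sum.swap)
  also have "\<dots> = (\<Sum>i\<in>UNIV. \<Sum>j\<in>UNIV. \<Sum>k\<in>UNIV. \<Sum>l\<in>UNIV. H x $ i $ k * H x $ j $ l * T $ i $ j * T $ k $ l)"
    by (rule sum.cong[OF refl], rule sum.cong[OF refl], rule sum.swap)
  finally show ?thesis by simp
qed

text \<open>With \<open>F\<close> for E as an endomorphism and \<open>Y\<close> for \<open>F\<close>
  applied to \<open>X\<close>, the Leibniz rule splits the divergence into the divergence of
  \<open>F\<close> paired with \<open>X\<close>, treated in \<open>first\<close>, and the trace of
  \<open>F ** ?N\<close>, treated in \<open>second\<close>.\<close>

lemma divergence_of_soliton_field:
  assumes x: "x \<in> U" and X: "smooth_on U X"
    and soliton: "\<And>y. y \<in> U \<Longrightarrow> ricci_matrix G y + (1/2) *\<^sub>R lie_matrix G X y = \<mu> y *\<^sub>R G y"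
  shows "(\<Sum>a\<in>UNIV. pd a (\<lambda>y. sqrt (det (G y)) * ((H y ** tfric y) *v X y) $ a) x)
    = sqrt (det (G x)) * ((1/2 - 1 / real CARD('n)) * frechet_derivative scal (at x) (X x)
       - trace (transpose (tfric x) ** H x ** tfric x ** H x))"
proof -
  let ?n = "real CARD('n)"
  let ?Ric = "ricci_matrix G"
  let ?N = "nabla G X x"
  have CX: "Ck_on k U X" for k using X by (simp add: smooth_on_def)
  have dX: "X differentiable (at y)" if "y \<in> U" for y by (rule Ck_on_differentiable[OF CX that])
  have n: "?n > 0" by simp
  \<comment> \<open>The metric and its Lie derivative are symmetric, so the soliton equation forces
    the Ricci matrix to be symmetric.\<close>
  have ric_sym: "transpose (?Ric y) = ?Ric y" if y: "y \<in> U" for y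
  proof -
    have "?Ric y = \<mu> y *\<^sub>R G y - (1/2) *\<^sub>R lie_matrix G X y"
      using soliton[OF y] by (simp add: eq_diff_eq)
    then show ?thesis
      by (simp add: lie_matrix_eq[OF y dX[OF y]] transpose_algebra sym_G y scaleR_add_right)
  qed
  \<comment> \<open>\<open>contracted_bianchi\<close> concerns this transpose; by
    \<open>ric_sym\<close> it is the Ricci matrix with its first index raised.\<close>
  define Q where "Q y = transpose (ricH y)" for y
  have Q_eq: "Q y = H y ** ?Ric y" if "y \<in> U" for y
    using that by (simp add: Q_def ricH_def transpose_algebra sym_H ric_sym)
  have Q_eq': "Q y = transpose (ricH y)" for y by (simp add: Q_def)
  have CQ: "Ck_on k U Q" for k
    unfolding Q_def[abs_def] by (rule Ck_on_bounded_linear[OF open_U bounded_linear_transpose Ck_ricH])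
  define F where "F y = Q y - (scal y / ?n) *\<^sub>R mat 1" for y
  have F_eq: "H y ** tfric y = F y" if "y \<in> U" for y
    using that by (simp add: tfric_def F_def Q_eq matrix_algebra H_G)
  have dQ: "Q differentiable (at x)" by (rule Ck_on_differentiable[OF CQ x])
  have ds: "scal differentiable (at x)" by (rule Ck_on_differentiable[OF Ck_scal x])
  have bl: "bounded_linear (\<lambda>r. (r / ?n) *\<^sub>R (mat 1 :: real^'n^'n))"
    unfolding divide_inverse
    by (intro bounded_linear_scaleR_left[THEN bounded_linear_compose] bounded_linear_mult_left)
  have dF: "F differentiable (at x)"
    unfolding F_def[abs_def] by (intro differentiable_diff dQ differentiable_bounded_linear[OF bl] ds)
  have pdF: "pd a F x = pd a Q x - (pd a scal x / ?n) *\<^sub>R mat 1" for a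
    unfolding F_def[abs_def]
    by (subst frechet_derivative_diff[OF dQ differentiable_bounded_linear[OF bl ds]])
       (simp only: frechet_derivative_bounded_linear[OF bl ds])
  define Y where "Y y = F y *v X y" for y
  have dY: "Y differentiable (at x)"
    unfolding Y_def[abs_def] by (rule differentiable_bilinear[OF bounded_bilinear_matrix_vector dF dX[OF x]])
  have pdY: "pd a Y x = F x *v pd a X x + pd a F x *v X x" for a
    unfolding Y_def[abs_def] by (rule frechet_derivative_bilinear[OF bounded_bilinear_matrix_vector dF dX[OF x]])
  \<comment> \<open>The identity matrix commutes with \<open>conn G a x\<close>, so the covariant
    derivative of its multiple is only the derivative of the factor.\<close>
  have cQ: "pd a F x + conn G a x ** F x - F x ** conn G a x
     = (pd a Q x + conn G a x ** Q x - Q x ** conn G a x) - (pd a scal x / ?n) *\<^sub>R mat 1" for a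
    by (simp add: pdF F_def matrix_algebra algebra_simps)
  have nab: "pd a X x + conn G a x *v X x = ?N *v axis a 1" for a
    by (simp add: vec_eq_iff matrix_vector_mult_axis_nth) (simp add: nabla_def)
  have covY: "pd a Y x + conn G a x *v Y x
     = (pd a F x + conn G a x ** F x - F x ** conn G a x) *v X x + (F x ** ?N) *v axis a 1" for a
    unfolding matrix_vector_mul_assoc[symmetric] nab[symmetric] pdY Y_def
    by (simp add: matrix_vector_mult_add_rdistrib matrix_vector_mult_diff_rdistrib
        matrix_vector_right_distrib matrix_vector_mul_assoc)
  have first: "(\<Sum>a\<in>UNIV. ((pd a F x + conn G a x ** F x - F x ** conn G a x) *v X x) $ a)
     = (1/2 - 1 / ?n) * frechet_derivative scal (at x) (X x)"
  proof -
    let ?C = "\<lambda>a. pd a Q x + conn G a x ** Q x - Q x ** conn G a x"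
    have cb: "pd e scal x = 2 * (\<Sum>a\<in>UNIV. ?C a $ a $ e)" for e
      using contracted_bianchi[OF x, of e] unfolding Q_def .
    have "(\<Sum>a\<in>UNIV. ((pd a F x + conn G a x ** F x - F x ** conn G a x) *v X x) $ a)
      = (\<Sum>a\<in>UNIV. (?C a *v X x) $ a - pd a scal x / ?n * X x $ a)"
      unfolding cQ by (simp add: matrix_vector_mult_diff_rdistrib scaleR_matrix_vector_assoc[symmetric])
    also have "\<dots> = (\<Sum>a\<in>UNIV. \<Sum>e\<in>UNIV. ?C a $ a $ e * X x $ e) - (\<Sum>a\<in>UNIV. pd a scal x / ?n * X x $ a)"
      by (simp only: sum_subtractf matrix_vector_nth)
    also have "(\<Sum>a\<in>UNIV. \<Sum>e\<in>UNIV. ?C a $ a $ e * X x $ e) = (\<Sum>e\<in>UNIV. \<Sum>a\<in>UNIV. ?C a $ a $ e * X x $ e)"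
      by (rule sum.swap)
    also have "\<dots> = (\<Sum>e\<in>UNIV. pd e scal x / 2 * X x $ e)"
      unfolding sum_distrib_right[symmetric] cb by simp
    also have "(\<Sum>e\<in>UNIV. pd e scal x / 2 * X x $ e) - (\<Sum>a\<in>UNIV. pd a scal x / ?n * X x $ a)
      = (1/2 - 1 / ?n) * (\<Sum>a\<in>UNIV. X x $ a * pd a scal x)"
      by (simp add: sum_distrib_left sum_subtractf[symmetric] left_diff_distrib mult.commute)
    also have "(\<Sum>a\<in>UNIV. X x $ a * pd a scal x) = frechet_derivative scal (at x) (X x)"
      using frechet_derivative_pd[OF ds, of "X x"] by simp
    finally show ?thesis .
  qed
  \<comment> \<open>\<open>F x ** H x\<close> is E with both indices raised and is symmetric, so it
    sees only the symmetric part of the lowered \<open>?N\<close>, which is half the Lie derivative.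
    The soliton equation makes this \<open>-E\<close> plus a multiple of the metric, and the
    multiple drops out because \<open>F x\<close> has trace zero.\<close>
  have second: "trace (F x ** ?N) = - trace (F x ** F x)"
  proof -
    let ?M = "G x ** ?N"
    have L: "lie_matrix G X x = ?M + transpose ?M" by (rule lie_matrix_eq[OF x dX[OF x]])
    have "lie_matrix G X x = 2 *\<^sub>R (\<mu> x *\<^sub>R G x - ?Ric x)"
    proof -
      have "(1/2) *\<^sub>R lie_matrix G X x = \<mu> x *\<^sub>R G x - ?Ric x"
        using soliton[OF x] by (simp add: eq_diff_eq add.commute)
      then have "2 *\<^sub>R ((1/2) *\<^sub>R lie_matrix G X x) = 2 *\<^sub>R (\<mu> x *\<^sub>R G x - ?Ric x)" by simp
      then show ?thesis by simp
    qed
    then have M2: "?M + transpose ?M = 2 *\<^sub>R ((\<mu> x - scal x / ?n) *\<^sub>R G x - tfric x)"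
      unfolding L tfric_def by (simp add: scaleR_diff_left)
    have FHM: "trace (F x ** H x ** ?M) = trace (F x ** ?N)"
      by (simp add: matrix_mul_assoc[symmetric] H_G_assoc x)
    have tF: "transpose (F x ** H x) = F x ** H x"
      by (simp add: F_eq[OF x, symmetric] tfric_def transpose_algebra sym_G sym_H ric_sym x matrix_mul_assoc)
    have "trace (F x ** H x ** transpose ?M) = trace (transpose (?M ** transpose (F x ** H x)))"
      by (simp add: transpose_algebra matrix_mul_assoc)
    also have "\<dots> = trace (F x ** H x ** ?M)"
      by (simp only: trace_transpose tF) (rule trace_mul_sym)
    finally have FHMt: "trace (F x ** H x ** transpose ?M) = trace (F x ** ?N)"
      using FHM by simp
    have trF: "trace (F x) = 0"
      using n scal_eq_trace[OF x] by (simp add: F_def Q_eq' trace_sub trace_scaleR trace_transpose trace_I)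
    have "2 * trace (F x ** ?N) = trace (F x ** H x ** (?M + transpose ?M))"
      using FHM FHMt by (simp add: matrix_add_ldistrib trace_add)
    also have "\<dots> = - (2 * trace (F x ** F x))"
      unfolding M2 by (simp add: matrix_algebra trace_sub trace_scaleR matrix_mul_assoc[symmetric] H_G F_eq x trF)
    finally show ?thesis by simp
  qed
  have normF: "trace (transpose (tfric x) ** H x ** tfric x ** H x) = trace (F x ** F x)"
  proof -
    have "transpose (tfric x) = tfric x" by (simp add: tfric_def transpose_algebra sym_G ric_sym x)
    then have "trace (transpose (tfric x) ** H x ** tfric x ** H x) = trace (H x ** (tfric x ** (H x ** tfric x)))"
      by (subst trace_mul_sym) (simp add: matrix_mul_assoc)
    then show ?thesis using F_eq[OF x] by (simp add: matrix_mul_assoc)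
  qed
  let ?s = "\<lambda>y. sqrt (det (G y))"
  have "(\<Sum>a\<in>UNIV. pd a (\<lambda>y. ?s y * ((H y ** tfric y) *v X y) $ a) x) = (\<Sum>a\<in>UNIV. pd a (\<lambda>y. ?s y * Y y $ a) x)"
    by (intro sum.cong refl pd_congI[OF x]) (simp add: Y_def F_eq)
  also have "\<dots> = (\<Sum>a\<in>UNIV. ?s x * pd a Y x $ a + ?s x * trace (conn G a x) * Y x $ a)"
    by (intro sum.cong refl)
       (simp add: frechet_derivative_bilinear[OF bounded_bilinear_mult pd_sqrt_det(2)[OF x] differentiable_nth[OF dY]]
         frechet_derivative_nth[OF dY] pd_sqrt_det(1)[OF x])
  \<comment> \<open>The trace of \<open>conn G a x\<close> left by the density is, after exchange of
    lower indices, the connection term of the divergence.\<close>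
  also have "\<dots> = ?s x * (\<Sum>a\<in>UNIV. (pd a Y x + conn G a x *v Y x) $ a)"
  proof -
    have "(\<Sum>a\<in>UNIV. trace (conn G a x) * Y x $ a) = (\<Sum>a\<in>UNIV. \<Sum>k\<in>UNIV. conn G k x $ k $ a * Y x $ a)"
      by (simp add: trace_def sum_distrib_right conn_sym[OF x])
    also have "\<dots> = (\<Sum>k\<in>UNIV. \<Sum>a\<in>UNIV. conn G k x $ k $ a * Y x $ a)" by (rule sum.swap)
    finally have "(\<Sum>a\<in>UNIV. trace (conn G a x) * Y x $ a) = (\<Sum>a\<in>UNIV. (conn G a x *v Y x) $ a)"
      by (simp only: matrix_vector_nth)
    then show ?thesis
      by (simp add: sum.distrib mult.assoc sum_distrib_left[symmetric] distrib_left[symmetric])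
  qed
  also have "(\<Sum>a\<in>UNIV. (pd a Y x + conn G a x *v Y x) $ a)
     = (1/2 - 1 / ?n) * frechet_derivative scal (at x) (X x) + trace (F x ** ?N)"
    unfolding covY by (simp add: sum.distrib first trace_def matrix_vector_mult_axis_nth)
  finally show ?thesis by (simp only: second normF) simp
qed

text \<open>The difference of two such connections, with its upper index lowered, is symmetric in
  one pair of its three indices and antisymmetric in an overlapping pair. Alternating the two
  symmetries returns the entry with a minus sign, so it vanishes.\<close>

lemma conn_unique:
  assumes x: "x \<in> U"
    and compat: "\<And>a. pd a G x = transpose (B a) ** G x + G x ** B a"
    and sym: "\<And>a b k. B a $ k $ b = B b $ k $ a"
  shows "B a = conn G a x"
proof -
  define D where "D a = G x ** (B a - conn G a x)" for a
  have "transpose (D a) = - D a" for a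
  proof -
    have "transpose (B a) ** G x + G x ** B a = transpose (conn G a x) ** G x + G x ** conn G a x"
      using compat metric_compat[OF x] by metis
    then show ?thesis
      by (simp add: D_def transpose_algebra sym_G x matrix_algebra algebra_simps)
  qed
  then have anti: "D a $ b $ c = - D a $ c $ b" for a b c
    by (rule transpose_eq_minus_nth)
  have sy: "D a $ b $ c = D c $ b $ a" for a b c
    by (simp add: D_def matrix_mult_nth sym[of a _ c] conn_sym[OF x, of a _ c])
  have "D a $ b $ c = 0" for a b c
    using anti[of a b c] sy[of a c b] anti[of b c a] sy[of b a c] anti[of c a b] sy[of c b a] by linarith
  then have "D a = 0" by (simp add: vec_eq_iff)
  then have "H x ** D a = 0" by simp
  then show ?thesis by (simp add: D_def H_G_assoc x)
qed

end

section \<open>Change of coordinates\<close>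

text \<open>\<open>\<phi>\<close> maps into \<open>V\<close>, not onto it, because the overlap of
  two charts is sent into the whole image of the second. Invertibility of the Jacobian matrix
  follows from \<open>pull\<close>, since \<open>det (G x)\<close> is nonzero.\<close>

locale patch_change =
  S: metric_patch U G + T: metric_patch V G'
  for U :: "(real^'n::finite) set" and G and V :: "(real^'n) set" and G' +
  fixes \<phi> :: "real^'n \<Rightarrow> real^'n"
  assumes \<phi>_in: "\<And>x. x \<in> U \<Longrightarrow> \<phi> x \<in> V" and smooth_\<phi>: "smooth_on U \<phi>"
    and pull: "\<And>x. x \<in> U \<Longrightarrow> G x = transpose (matrix (frechet_derivative \<phi> (at x))) ** G' (\<phi> x) ** matrix (frechet_derivative \<phi> (at x))"
begin

definition P :: "real^'n \<Rightarrow> real^'n^'n" where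
  "P x = matrix (frechet_derivative \<phi> (at x))"

lemma Ck_\<phi>: "Ck_on k U \<phi>"
  using smooth_\<phi> by (simp add: smooth_on_def)

lemma P_nth: "P x $ c $ a = pd a \<phi> x $ c"
  by (simp add: P_def matrix_def)

lemma Ck_P: "Ck_on k U P"
proof (intro Ck_on_vec S.open_U)
  fix c a
  show "Ck_on k U (\<lambda>x. P x $ c $ a)"
    unfolding P_nth by (rule Ck_on_nth[OF S.open_U Ck_on_deriv[OF Ck_\<phi>]])
qed

lemma diff_P: "x \<in> U \<Longrightarrow> P differentiable (at x)"
  by (rule Ck_on_differentiable[OF Ck_P])

lemma diff_\<phi>: "x \<in> U \<Longrightarrow> \<phi> differentiable (at x)"
  by (rule Ck_on_differentiable[OF Ck_\<phi>])

lemma pd_P_sym: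
  assumes x: "x \<in> U"
  shows "pd a P x $ c $ b = pd b P x $ c $ a"
proof -
  have *: "pd a P x $ c $ b = pd a (pd b \<phi>) x $ c" for a b
  proof -
    have "pd a P x $ c $ b = pd a (\<lambda>y. P y $ c $ b) x"
      using diff_P[OF x] by (simp only: pd_nth2)
    also have "\<dots> = pd a (\<lambda>y. pd b \<phi> y $ c) x" by (simp only: P_nth)
    also have "\<dots> = pd a (pd b \<phi>) x $ c"
      by (rule frechet_derivative_nth[OF Ck_on_differentiable[OF Ck_on_deriv[OF Ck_\<phi>] x]])
    finally show ?thesis .
  qed
  show ?thesis unfolding * S.second_commute[OF Ck_\<phi> x, of a b] ..
qed

lemma det_P: "x \<in> U \<Longrightarrow> det (P x) \<noteq> 0"
proof
  assume x: "x \<in> U" and "det (P x) = 0"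
  then have "det (G x) = 0" using pull[OF x] by (simp add: P_def det_mul)
  then show False using S.det_nz[OF x] by simp
qed

lemma P_inv: "x \<in> U \<Longrightarrow> P x ** matrix_inv (P x) = mat 1" "x \<in> U \<Longrightarrow> matrix_inv (P x) ** P x = mat 1"
  using matrix_inv_mult det_P by blast+

lemma P_cancel:
  assumes x: "x \<in> U" and eq: "P x ** A = P x ** B" shows "A = B"
proof -
  have "matrix_inv (P x) ** (P x ** A) = matrix_inv (P x) ** (P x ** B)" using eq by simp
  then show ?thesis by (simp add: matrix_mul_assoc P_inv x)
qed

lemma pd_compose_\<phi>:
  assumes x: "x \<in> U" and f: "f differentiable (at (\<phi> x))"
  shows "pd a (\<lambda>y. f (\<phi> y)) x = (\<Sum>c\<in>UNIV. P x $ c $ a *\<^sub>R pd c f (\<phi> x))"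
  using frechet_derivative_pd[OF f, of "pd a \<phi> x"]
  by (simp add: frechet_derivative_compose[OF diff_\<phi>[OF x] f] P_nth)

text \<open>Only the direction index is pulled back; the matrix still acts on components in the
  target coordinates. This is \<open>A'\<close> in the gauge law of the overview.\<close>

definition pull_conn :: "'n \<Rightarrow> real^'n \<Rightarrow> real^'n^'n" where
  "pull_conn a x = (\<Sum>c\<in>UNIV. P x $ c $ a *\<^sub>R conn G' c (\<phi> x))"

lemma pull_conn_P_sym: "x \<in> U \<Longrightarrow> (pull_conn a x ** P x) $ k $ b = (pull_conn b x ** P x) $ k $ a"
proof -
  assume x: "x \<in> U"
  have e: "(pull_conn a x ** P x) $ k $ b = (\<Sum>c\<in>UNIV. \<Sum>d\<in>UNIV. P x $ c $ a * (conn G' c (\<phi> x) $ k $ d * P x $ d $ b))" for a b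
    by (simp add: pull_conn_def matrix_mult_sum_left matrix_scaleR_left matrix_mult_nth sum_distrib_left)
  have "(pull_conn a x ** P x) $ k $ b = (\<Sum>d\<in>UNIV. \<Sum>c\<in>UNIV. P x $ c $ a * (conn G' c (\<phi> x) $ k $ d * P x $ d $ b))"
    unfolding e by (rule sum.swap)
  also have "\<dots> = (pull_conn b x ** P x) $ k $ a"
    unfolding e
  proof (intro sum.cong refl)
    fix d c
    show "P x $ c $ a * (conn G' c (\<phi> x) $ k $ d * P x $ d $ b) = P x $ d $ b * (conn G' d (\<phi> x) $ k $ c * P x $ c $ a)"
      by (subst T.conn_sym[OF \<phi>_in[OF x], of c k d]) simp
  qed
  finally show ?thesis .
qed

text \<open>Solving the gauge law for the connection gives a candidate \<open>B\<close>.
  Differentiating \<open>pull\<close> shows that it is metric; symmetry of the second derivatives of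
  \<open>\<phi>\<close> and of \<open>conn G'\<close> shows that it is torsion-free. So
  \<open>conn_unique\<close> identifies it.\<close>

lemma conn_change:
  assumes x: "x \<in> U"
  shows "P x ** conn G a x = pd a P x + pull_conn a x ** P x"
proof -
  define B where "B a = matrix_inv (P x) ** (pd a P x + pull_conn a x ** P x)" for a
  have PB: "P x ** B a = pd a P x + pull_conn a x ** P x" for a
    by (simp add: B_def matrix_mul_assoc P_inv x)
  have "B a = conn G a x" for a
  proof (rule S.conn_unique[OF x])
    fix a
    have dG': "G' differentiable (at (\<phi> x))"
      by (rule Ck_on_differentiable[OF T.Ck_G \<phi>_in[OF x]])
    have dc: "(\<lambda>y. G' (\<phi> y)) differentiable (at x)"
      by (rule differentiable_compose_at[OF diff_\<phi>[OF x] dG'])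
    have dt: "(\<lambda>y. transpose (P y)) differentiable (at x)"
      by (rule differentiable_bounded_linear[OF bounded_linear_transpose diff_P[OF x]])
    have pdG': "pd a (\<lambda>y. G' (\<phi> y)) x = transpose (pull_conn a x) ** G' (\<phi> x) + G' (\<phi> x) ** pull_conn a x"
      unfolding pd_compose_\<phi>[OF x dG'] pull_conn_def transpose_sum matrix_mult_sum_left matrix_mult_sum_right sum.distrib[symmetric]
      by (intro sum.cong refl) (simp add: T.metric_compat[OF \<phi>_in[OF x]] transpose_scaleR matrix_algebra scaleR_add_right)
    have "pd a G x = pd a (\<lambda>y. transpose (P y) ** G' (\<phi> y) ** P y) x"
      by (rule S.pd_congI[OF x]) (simp add: P_def pull)
    also have "\<dots> = transpose (P x) ** G' (\<phi> x) ** pd a P x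
       + (transpose (P x) ** pd a (\<lambda>y. G' (\<phi> y)) x + transpose (pd a P x) ** G' (\<phi> x)) ** P x"
      by (simp only: frechet_derivative_matrix_mult[OF differentiable_matrix_mult[OF dt dc] diff_P[OF x]]
          frechet_derivative_matrix_mult[OF dt dc] frechet_derivative_bounded_linear[OF bounded_linear_transpose diff_P[OF x]])
    also have "\<dots> = transpose (P x ** B a) ** G' (\<phi> x) ** P x + transpose (P x) ** G' (\<phi> x) ** (P x ** B a)"
      unfolding PB pdG' by (simp add: transpose_algebra matrix_algebra matrix_mul_assoc algebra_simps)
    also have "\<dots> = transpose (B a) ** G x + G x ** B a"
      unfolding pull[OF x, folded P_def] by (simp add: transpose_algebra matrix_mul_assoc)
    finally show "pd a G x = transpose (B a) ** G x + G x ** B a" .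
  next
    fix a b k
    have "(pd a P x + pull_conn a x ** P x) $ k $ b = (pd b P x + pull_conn b x ** P x) $ k $ a" for k
      by (simp add: pull_conn_P_sym[OF x] pd_P_sym[OF x, of a _ b])
    then show "B a $ k $ b = B b $ k $ a" by (simp add: B_def matrix_mult_nth[of "matrix_inv (P x)"])
  qed
  then show ?thesis using PB by metis
qed

definition pull_curv :: "'n \<Rightarrow> 'n \<Rightarrow> real^'n \<Rightarrow> real^'n^'n" where
  "pull_curv a b x = (\<Sum>c\<in>UNIV. P x $ c $ a *\<^sub>R (\<Sum>d\<in>UNIV. P x $ d $ b *\<^sub>R curv G' c d (\<phi> x)))"

lemma diff_conn_\<phi>: "x \<in> U \<Longrightarrow> (\<lambda>y. conn G' c (\<phi> y)) differentiable (at x)"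
  by (rule differentiable_compose_at[OF diff_\<phi> T.conn_differentiable[OF \<phi>_in]])

lemma diff_pull_conn: "x \<in> U \<Longrightarrow> pull_conn b differentiable (at x)"
  unfolding pull_conn_def[abs_def]
  by (intro differentiable_sum ballI differentiable_bilinear[OF bounded_bilinear_scaleR] differentiable_nth diff_P diff_conn_\<phi>) simp_all

text \<open>Pulling back commutes with taking curvature: the terms with derivatives of
  \<open>P\<close> cancel by \<open>pd_P_sym\<close>, and the remaining double sums match after
  exchanging summation indices.\<close>

lemma pull_conn_curv:
  assumes x: "x \<in> U"
  shows "pd a (pull_conn b) x - pd b (pull_conn a) x + pull_conn a x ** pull_conn b x - pull_conn b x ** pull_conn a x
    = pull_curv a b x"
proof -
  let ?C = "\<lambda>c. conn G' c (\<phi> x)" and ?D = "\<lambda>d c. pd d (conn G' c) (\<phi> x)"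
  have pdp: "pd a (pull_conn b) x = (\<Sum>c\<in>UNIV. \<Sum>d\<in>UNIV. (P x $ c $ b * P x $ d $ a) *\<^sub>R ?D d c)
       + (\<Sum>c\<in>UNIV. pd a P x $ c $ b *\<^sub>R ?C c)" for a b
  proof -
    have dn: "(\<lambda>y. P y $ c $ b) differentiable (at x)" for c
      using diff_P[OF x] by (intro differentiable_nth)
    have "pd a (pull_conn b) x = (\<Sum>c\<in>UNIV. pd a (\<lambda>y. P y $ c $ b *\<^sub>R conn G' c (\<phi> y)) x)"
      unfolding pull_conn_def[abs_def]
      by (intro frechet_derivative_sum differentiable_bilinear[OF bounded_bilinear_scaleR] dn diff_conn_\<phi> x)
    also have "\<dots> = (\<Sum>c\<in>UNIV. P x $ c $ b *\<^sub>R (\<Sum>d\<in>UNIV. P x $ d $ a *\<^sub>R ?D d c) + pd a P x $ c $ b *\<^sub>R ?C c)"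
      by (simp only: frechet_derivative_bilinear[OF bounded_bilinear_scaleR dn diff_conn_\<phi>[OF x]]
          pd_compose_\<phi>[OF x T.conn_differentiable[OF \<phi>_in[OF x]]] pd_nth2[OF diff_P[OF x]])
    finally show ?thesis by (simp add: sum.distrib scaleR_sum_right)
  qed
  have pp: "pull_conn a x ** pull_conn b x = (\<Sum>c\<in>UNIV. \<Sum>d\<in>UNIV. (P x $ c $ a * P x $ d $ b) *\<^sub>R (?C c ** ?C d))" for a b
    by (simp only: pull_conn_def matrix_mult_sum_left)
       (simp only: matrix_mult_sum_right matrix_scaleR_left matrix_scaleR_right scaleR_scaleR mult.commute[of "P x $ _ $ b"])
  have 1: "(\<Sum>c\<in>UNIV. \<Sum>d\<in>UNIV. (P x $ c $ b * P x $ d $ a) *\<^sub>R ?D d c) = (\<Sum>c\<in>UNIV. \<Sum>d\<in>UNIV. (P x $ c $ a * P x $ d $ b) *\<^sub>R ?D c d)"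
    by (subst sum.swap) (simp only: mult.commute)
  have 2: "pull_conn b x ** pull_conn a x = (\<Sum>c\<in>UNIV. \<Sum>d\<in>UNIV. (P x $ c $ a * P x $ d $ b) *\<^sub>R (?C d ** ?C c))"
    unfolding pp by (subst sum.swap) (simp only: mult.commute)
  have 3: "(\<Sum>c\<in>UNIV. pd a P x $ c $ b *\<^sub>R ?C c) = (\<Sum>c\<in>UNIV. pd b P x $ c $ a *\<^sub>R ?C c)"
    by (simp only: pd_P_sym[OF x, of a _ b])
  have "pull_curv a b x = (\<Sum>c\<in>UNIV. \<Sum>d\<in>UNIV. (P x $ c $ a * P x $ d $ b) *\<^sub>R ?D c d)
     - (\<Sum>c\<in>UNIV. \<Sum>d\<in>UNIV. (P x $ c $ a * P x $ d $ b) *\<^sub>R ?D d c)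
     + (\<Sum>c\<in>UNIV. \<Sum>d\<in>UNIV. (P x $ c $ a * P x $ d $ b) *\<^sub>R (?C c ** ?C d))
     - (\<Sum>c\<in>UNIV. \<Sum>d\<in>UNIV. (P x $ c $ a * P x $ d $ b) *\<^sub>R (?C d ** ?C c))"
    by (simp add: pull_curv_def curv_def scaleR_sum_right sum.distrib[symmetric] sum_subtractf[symmetric] scaleR_add_right scaleR_diff_right)
  then show ?thesis
    unfolding pdp[of a b] pdp[of b a] 1 3 pp[of a b] 2 by (simp add: algebra_simps)
qed

text \<open>Differentiating the gauge law and antisymmetrizing cancels the second derivatives of
  \<open>P\<close>, and then also all terms with a first derivative of \<open>P\<close>.\<close>

lemma curv_change:
  assumes x: "x \<in> U"
  shows "P x ** curv G a b x = pull_curv a b x ** P x"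
proof -
  have d: "P x ** pd a (conn G b) x + pd a P x ** conn G b x
     = pd a (pd b P) x + (pull_conn b x ** pd a P x + pd a (pull_conn b) x ** P x)" for a b
  proof -
    have "pd a (\<lambda>y. P y ** conn G b y) x = pd a (\<lambda>y. pd b P y + pull_conn b y ** P y) x"
      by (rule S.pd_congI[OF x]) (rule conn_change)
    then show ?thesis
      by (simp only: frechet_derivative_matrix_mult[OF diff_P[OF x] S.conn_differentiable[OF x]]
        frechet_derivative_add[OF Ck_on_differentiable[OF Ck_on_deriv[OF Ck_P] x] differentiable_matrix_mult[OF diff_pull_conn[OF x] diff_P[OF x]]]
        frechet_derivative_matrix_mult[OF diff_pull_conn[OF x] diff_P[OF x]])
  qed
  have e: "P x ** pd a (conn G b) x
     = pd a (pd b P) x + (pull_conn b x ** pd a P x + pd a (pull_conn b) x ** P x) - pd a P x ** conn G b x" for a b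
    using d[of b a] by (simp only: eq_diff_eq)
  have f: "P x ** (conn G a x ** conn G b x) = pd a P x ** conn G b x + pull_conn a x ** (pd b P x + pull_conn b x ** P x)" for a b
    by (simp only: matrix_mul_assoc conn_change[OF x] matrix_add_rdistrib)
       (simp only: matrix_mul_assoc[symmetric] conn_change[OF x])
  have c: "pd a (pd b P) x = pd b (pd a P) x" by (rule S.second_commute[OF Ck_P x])
  have "P x ** curv G a b x
    = (pd a (pull_conn b) x - pd b (pull_conn a) x + pull_conn a x ** pull_conn b x - pull_conn b x ** pull_conn a x) ** P x"
    unfolding curv_def matrix_add_ldistrib matrix_diff_ldistrib e f c
    by (simp add: matrix_algebra matrix_mul_assoc algebra_simps)
  then show ?thesis by (simp only: pull_conn_curv[OF x])
qed

text \<open>In the trace, the factor \<open>P\<close> that pulls back the traced direction meets the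
  inverse from the conjugation and cancels. Two factors \<open>P\<close> remain, one for each index
  of the Ricci matrix.\<close>

lemma ricci_change:
  assumes x: "x \<in> U"
  shows "ricci_matrix G x = transpose (P x) ** ricci_matrix G' (\<phi> x) ** P x"
proof (subst vec_eq_iff, intro allI, subst vec_eq_iff, intro allI)
  fix b f
  let ?I = "matrix_inv (P x)"
  \<comment> \<open>Only the second direction index is pulled back here; the first is kept apart
    because it is the one being traced.\<close>
  define W where "W c = (\<Sum>d\<in>UNIV. P x $ d $ b *\<^sub>R curv G' c d (\<phi> x))" for c
  have curv: "curv G a b x = (\<Sum>c\<in>UNIV. P x $ c $ a *\<^sub>R (?I ** (W c ** P x)))" for a
  proof (rule P_cancel[OF x])
    show "P x ** curv G a b x = P x ** (\<Sum>c\<in>UNIV. P x $ c $ a *\<^sub>R (?I ** (W c ** P x)))"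
      by (simp add: curv_change[OF x] pull_curv_def W_def[symmetric] matrix_mult_sum_left matrix_mult_sum_right
          matrix_algebra matrix_mul_assoc P_inv x)
  qed
  have "ricci_matrix G x $ b $ f = (\<Sum>a\<in>UNIV. \<Sum>c\<in>UNIV. P x $ c $ a * (?I ** (W c ** P x)) $ a $ f)"
    by (simp add: S.ricci_nth[OF x] curv)
  also have "\<dots> = (\<Sum>c\<in>UNIV. \<Sum>a\<in>UNIV. P x $ c $ a * (?I ** (W c ** P x)) $ a $ f)"
    by (rule sum.swap)
  also have "\<dots> = (\<Sum>c\<in>UNIV. (P x ** (?I ** (W c ** P x))) $ c $ f)"
    by (simp only: matrix_mult_nth[of "P x"])
  also have "\<dots> = (\<Sum>c\<in>UNIV. (W c ** P x) $ c $ f)"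
    by (simp add: matrix_mul_assoc P_inv x)
  also have "\<dots> = (\<Sum>c\<in>UNIV. \<Sum>k\<in>UNIV. \<Sum>d\<in>UNIV. P x $ d $ b * curv G' c d (\<phi> x) $ c $ k * P x $ k $ f)"
    by (simp add: matrix_mult_nth W_def sum_distrib_right)
  also have "\<dots> = (\<Sum>k\<in>UNIV. \<Sum>c\<in>UNIV. \<Sum>d\<in>UNIV. P x $ d $ b * curv G' c d (\<phi> x) $ c $ k * P x $ k $ f)"
    by (rule sum.swap)
  also have "\<dots> = (\<Sum>k\<in>UNIV. \<Sum>d\<in>UNIV. \<Sum>c\<in>UNIV. P x $ d $ b * curv G' c d (\<phi> x) $ c $ k * P x $ k $ f)"
    by (rule sum.cong[OF refl]) (rule sum.swap)
  also have "\<dots> = (transpose (P x) ** ricci_matrix G' (\<phi> x) ** P x) $ b $ f"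
    by (simp add: matrix_mult_nth transpose_nth T.ricci_nth[OF \<phi>_in[OF x]] sum_distrib_right sum_distrib_left)
  finally show "ricci_matrix G x $ b $ f = (transpose (P x) ** ricci_matrix G' (\<phi> x) ** P x) $ b $ f" .
qed

text \<open>By the gauge law the covariant derivative of the field is conjugated by
  \<open>P\<close>. Lowering an index and symmetrizing turns this into the congruence.\<close>

lemma lie_change:
  assumes x: "x \<in> U" and X: "X differentiable (at x)" and X': "X' differentiable (at (\<phi> x))"
    and rel: "\<And>y. y \<in> U \<Longrightarrow> X' (\<phi> y) = P y *v X y"
  shows "lie_matrix G X x = transpose (P x) ** lie_matrix G' X' (\<phi> x) ** P x"
proof -
  have N: "P x ** nabla G X x = nabla G' X' (\<phi> x) ** P x"
  proof (subst vec_eq_iff, intro allI, subst vec_eq_iff, intro allI)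
    fix k a
    have "(P x ** nabla G X x) $ k $ a = (P x *v (pd a X x + conn G a x *v X x)) $ k"
      by (simp add: matrix_mult_nth matrix_vector_nth nabla_def)
    also have "P x *v (pd a X x + conn G a x *v X x) = P x *v pd a X x + pd a P x *v X x + pull_conn a x *v (P x *v X x)"
      by (simp add: matrix_vector_right_distrib matrix_vector_mul_assoc conn_change[OF x] matrix_vector_mult_add_rdistrib)
    also have "P x *v pd a X x + pd a P x *v X x = pd a (\<lambda>y. P y *v X y) x"
      by (rule frechet_derivative_bilinear[OF bounded_bilinear_matrix_vector diff_P[OF x] X, symmetric])
    also have "\<dots> = pd a (\<lambda>y. X' (\<phi> y)) x"
      by (rule S.pd_congI[OF x]) (simp add: rel)
    also have "\<dots> = (\<Sum>c\<in>UNIV. P x $ c $ a *\<^sub>R pd c X' (\<phi> x))"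
      by (rule pd_compose_\<phi>[OF x X'])
    also have "pull_conn a x *v (P x *v X x) = (\<Sum>c\<in>UNIV. P x $ c $ a *\<^sub>R (conn G' c (\<phi> x) *v X' (\<phi> x)))"
      unfolding pull_conn_def rel[OF x]
      by (simp add: bounded_bilinear.sum_left[OF bounded_bilinear_matrix_vector] scaleR_matrix_vector_assoc)
    finally show "(P x ** nabla G X x) $ k $ a = (nabla G' X' (\<phi> x) ** P x) $ k $ a"
      by (simp add: matrix_mult_nth nabla_def sum.distrib[symmetric] distrib_left mult.commute)
  qed
  have "G x ** nabla G X x = transpose (P x) ** (G' (\<phi> x) ** nabla G' X' (\<phi> x)) ** P x"
    unfolding pull[OF x, folded P_def] using N by (simp add: matrix_mul_assoc[symmetric])
  then show ?thesis
    unfolding S.lie_matrix_eq[OF x X] T.lie_matrix_eq[OF \<phi>_in[OF x] X']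
    by (simp add: transpose_algebra matrix_algebra matrix_mul_assoc)
qed

end

section \<open>Integration in Euclidean space\<close>

text \<open>The library proves change of variables only for vectors whose index type is well-ordered;
  this copy of a finite type carries such an order.\<close>

typedef 'n wo = "UNIV :: 'n set" ..

instance wo :: (finite) finite
proof
  have "inj (Rep_wo :: 'a wo \<Rightarrow> 'a)" by (simp add: inj_on_def Rep_wo_inject)
  show "finite (UNIV :: 'a wo set)" by (rule finite_imageD[OF _ \<open>inj Rep_wo\<close>]) simp
qed

definition wo_index :: "'n::finite wo \<Rightarrow> nat" where
  "wo_index = (SOME f. inj f)"

lemma inj_wo_index: "inj (wo_index :: 'n::finite wo \<Rightarrow> nat)"
  unfolding wo_index_def
proof (rule someI_ex[where P=inj])
  obtain f :: "'n wo \<Rightarrow> nat" where "inj f"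
    using finite_imp_inj_to_nat_seg[OF finite[of "UNIV :: 'n wo set"]] by blast
  then show "\<exists>f :: 'n wo \<Rightarrow> nat. inj f" by blast
qed

instantiation wo :: (finite) wellorder
begin

definition less_eq_wo :: "'a wo \<Rightarrow> 'a wo \<Rightarrow> bool" where
  "less_eq_wo a b \<longleftrightarrow> wo_index a \<le> wo_index b"

definition less_wo :: "'a wo \<Rightarrow> 'a wo \<Rightarrow> bool" where
  "less_wo a b \<longleftrightarrow> wo_index a < wo_index b"

instance
proof
  fix x y z :: "'a wo" and P
  show "(x < y) = (x \<le> y \<and> \<not> y \<le> x)" "x \<le> x" "x \<le> y \<or> y \<le> x"
    by (auto simp: less_eq_wo_def less_wo_def)
  show "x \<le> y \<Longrightarrow> y \<le> z \<Longrightarrow> x \<le> z" by (auto simp: less_eq_wo_def)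
  show "x \<le> y \<Longrightarrow> y \<le> x \<Longrightarrow> x = y"
    by (rule injD[OF inj_wo_index]) (simp add: less_eq_wo_def)
  show "P x" if "\<And>x. (\<And>y. y < x \<Longrightarrow> P y) \<Longrightarrow> P x"
  proof (induction x rule: measure_induct_rule[of wo_index])
    case (less x)
    show ?case by (rule that) (simp add: less less_wo_def)
  qed
qed

end

lemma bij_Rep_wo: "bij (Rep_wo :: 'n wo \<Rightarrow> 'n)"
  by (metis Abs_wo_inverse Rep_wo_inverse UNIV_I bij_iff)

text \<open>Conjugation with \<open>f\<close> is a bijection between the two groups of permutations
  that preserves signs, so the Leibniz sums agree term by term.\<close>

lemma det_reindex:
  fixes A :: "real^'n::finite^'n" and f :: "'m::finite \<Rightarrow> 'n"
  assumes f: "bij f"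
  shows "det (\<chi> i j. A $ f i $ f j) = det A"
proof -
  let ?h = "map_permutation UNIV f"
  have h: "?h p = (\<lambda>x. f (p (inv f x)))" for p
    using bij_is_surj[OF f] by (simp add: map_permutation_def restrict_id_def fun_eq_iff)
  have bij: "bij_betw ?h {p. p permutes UNIV} {p. p permutes UNIV}"
    using bij_betw_permutations[OF f] unfolding h[abs_def] by simp
  have s: "sign (?h p) = sign p" if "p permutes UNIV" for p
    using sign_map_permutation[OF bij_is_inj[OF f] that] by simp
  have "det A = (\<Sum>p\<in>{p. p permutes UNIV}. of_int (sign (?h p)) * (\<Prod>x\<in>UNIV. A $ x $ ?h p x))"
    unfolding det_def by (rule sum.reindex_bij_betw[OF bij, symmetric])
  also have "\<dots> = (\<Sum>p\<in>{p. p permutes UNIV}. of_int (sign p) * (\<Prod>i\<in>UNIV. A $ f i $ f (p i)))"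
  proof (rule sum.cong[OF refl])
    fix p :: "'m \<Rightarrow> 'm" assume p: "p \<in> {p. p permutes UNIV}"
    have "(\<Prod>x\<in>UNIV. A $ x $ ?h p x) = (\<Prod>i\<in>UNIV. A $ f i $ ?h p (f i))"
      by (rule prod.reindex_bij_betw[OF f, symmetric])
    then show "of_int (sign (?h p)) * (\<Prod>x\<in>UNIV. A $ x $ ?h p x) = of_int (sign p) * (\<Prod>i\<in>UNIV. A $ f i $ f (p i))"
      using s p by (simp add: h inv_f_f[OF bij_is_inj[OF f]])
  qed
  finally show ?thesis by (simp add: det_def)
qed

text \<open>The formula for images of finite measure settles one case. If the image has infinite
  measure, a finite integral would make the Jacobian integrable on \<open>S\<close> and hence the
  image \<open>lmeasurable\<close>, a contradiction.\<close>

lemma emeasure_differentiable_image_wo: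
  fixes f :: "real^'n::{finite,wellorder} \<Rightarrow> real^'n::_"
  assumes S: "S \<in> sets borel" "f ` S \<in> sets borel" and inj: "inj_on f S"
    and der: "\<And>x. x \<in> S \<Longrightarrow> (f has_derivative f' x) (at x)"
    and meas: "(\<lambda>x. indicator S x * \<bar>det (matrix (f' x))\<bar>) \<in> borel_measurable borel"
  shows "emeasure lborel (f ` S) = (\<integral>\<^sup>+x. ennreal (indicator S x * \<bar>det (matrix (f' x))\<bar>) \<partial>lborel)"
proof -
  have S': "S \<in> sets lebesgue" "f ` S \<in> sets lebesgue" using S by auto
  have der': "\<And>x. x \<in> S \<Longrightarrow> (f has_derivative f' x) (at x within S)"
    using der has_derivative_at_withinI by blast
  have em: "emeasure lebesgue (f ` S) = emeasure lborel (f ` S)" using S by simp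
  show ?thesis
  proof (cases "emeasure lborel (f ` S) = \<infinity>")
    case False
    then have lm: "f ` S \<in> lmeasurable"
      using S' em by (intro fmeasurableI) (auto simp: less_top[symmetric])
    then have "((\<lambda>x. \<bar>det (matrix (f' x))\<bar>) has_integral measure lebesgue (f ` S)) S"
      using has_measure_differentiable_image[OF S'(1) der' inj] by blast
    then have "(\<integral>\<^sup>+x. ennreal (indicator S x * \<bar>det (matrix (f' x))\<bar>) \<partial>lborel) = ennreal (measure lebesgue (f ` S))"
      by (intro nn_integral_has_integral_lebesgue) auto
    then show ?thesis
      using emeasure_eq_ennreal_measure[of lebesgue "f ` S"] False em by simp
  next
    case True
    have "(\<integral>\<^sup>+x. ennreal (indicator S x * \<bar>det (matrix (f' x))\<bar>) \<partial>lborel) = \<infinity>"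
    proof (rule ccontr)
      assume "\<not> ?thesis"
      then have "(\<lambda>x. indicator S x * \<bar>det (matrix (f' x))\<bar>) integrable_on UNIV"
        by (intro nn_integral_integrable_on meas) (auto simp: less_top[symmetric])
      moreover have "(\<lambda>x. indicator S x * \<bar>det (matrix (f' x))\<bar>) = (\<lambda>x. if x \<in> S then \<bar>det (matrix (f' x))\<bar> else 0)"
        by (auto simp: fun_eq_iff)
      ultimately have "(\<lambda>x. \<bar>det (matrix (f' x))\<bar>) integrable_on S"
        by (simp add: integrable_restrict_UNIV)
      then have "f ` S \<in> lmeasurable"
        using measurable_differentiable_image_eq[OF S'(1) der' inj] by blast
      then show False using True em by (simp add: fmeasurable_def)
    qed
    then show ?thesis using True by simp
  qed
qed

definition to_wo :: "real^'n::finite \<Rightarrow> real^'n wo" where "to_wo v = (\<chi> i. v $ Rep_wo i)"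
definition of_wo :: "real^'n::finite wo \<Rightarrow> real^'n" where "of_wo w = (\<chi> j. w $ Abs_wo j)"

lemma of_to_wo [simp]: "of_wo (to_wo v) = v"
  by (simp add: of_wo_def to_wo_def vec_eq_iff Abs_wo_inverse)

lemma to_of_wo [simp]: "to_wo (of_wo v) = v"
  by (simp add: of_wo_def to_wo_def vec_eq_iff Rep_wo_inverse)

lemma bounded_linear_to_wo: "bounded_linear to_wo"
  by (rule linear_conv_bounded_linear[THEN iffD1], rule linearI) (auto simp: to_wo_def vec_eq_iff)

lemma bounded_linear_of_wo: "bounded_linear of_wo"
  by (rule linear_conv_bounded_linear[THEN iffD1], rule linearI) (auto simp: of_wo_def vec_eq_iff)

lemma measurable_to_wo [measurable]: "to_wo \<in> borel_measurable borel"
  and measurable_of_wo [measurable]: "of_wo \<in> borel_measurable borel"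
  by (rule borel_measurable_continuous_onI linear_continuous_on bounded_linear_to_wo bounded_linear_of_wo)+

lemma image_to_wo: "to_wo ` S = of_wo -` S"
  by (auto simp: image_iff) (metis to_of_wo)

lemma Basis_vec_real: "(Basis :: (real^'n) set) = range (\<lambda>i. axis i 1)"
  by (auto simp: Basis_vec_def)

lemma prod_Basis_vec: "(\<Prod>b\<in>(Basis :: (real^'n) set). f b) = (\<Prod>i\<in>UNIV. f (axis i 1))"
  unfolding Basis_vec_real
  by (subst prod.reindex) (auto simp: inj_on_def axis_eq_axis)

text \<open>Renaming coordinates permutes the sides of a box, and Lebesgue measure is determined by
  its values on boxes.\<close>

lemma lborel_to_wo: "distr lborel borel (to_wo :: real^'n::finite \<Rightarrow> _) = lborel"
proof (rule lborel_eqI[symmetric])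
  fix l u :: "real^'n wo"
  assume le: "\<And>b. b \<in> Basis \<Longrightarrow> l \<bullet> b \<le> u \<bullet> b"
  have le': "l $ i \<le> u $ i" for i
    using le[of "axis i 1"] by (simp add: Basis_vec_real inner_axis)
  have "to_wo -` box l u = box (of_wo l) (of_wo u)"
  proof (rule set_eqI)
    fix v
    have "v \<in> to_wo -` box l u \<longleftrightarrow> (\<forall>i. l $ i < v $ Rep_wo i \<and> v $ Rep_wo i < u $ i)"
      by (simp add: mem_box_cart to_wo_def)
    also have "\<dots> \<longleftrightarrow> (\<forall>j. l $ Abs_wo j < v $ j \<and> v $ j < u $ Abs_wo j)"
      by (metis Abs_wo_inverse Rep_wo_inverse UNIV_I)
    finally show "v \<in> to_wo -` box l u \<longleftrightarrow> v \<in> box (of_wo l) (of_wo u)"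
      by (simp add: mem_box_cart of_wo_def)
  qed
  then have "emeasure (distr lborel borel to_wo) (box l u) = emeasure lborel (box (of_wo l) (of_wo u))"
    by (simp add: emeasure_distr)
  also have "\<dots> = (\<Prod>b\<in>Basis. (of_wo u - of_wo l) \<bullet> b)"
    by (rule emeasure_lborel_box) (auto simp: Basis_vec_real inner_axis of_wo_def le')
  also have "(\<Prod>b\<in>Basis. (of_wo u - of_wo l) \<bullet> b) = (\<Prod>j\<in>UNIV. u $ Abs_wo j - l $ Abs_wo j)"
    unfolding prod_Basis_vec by (simp add: inner_axis of_wo_def)
  also have "\<dots> = (\<Prod>i\<in>UNIV. u $ Abs_wo (Rep_wo i) - l $ Abs_wo (Rep_wo i))"
    by (rule prod.reindex_bij_betw[OF bij_Rep_wo, symmetric])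
  also have "\<dots> = (\<Prod>b\<in>Basis. (u - l) \<bullet> b)"
    unfolding prod_Basis_vec by (simp add: inner_axis Rep_wo_inverse)
  finally show "emeasure (distr lborel borel to_wo) (box l u) = (\<Prod>b\<in>Basis. (u - l) \<bullet> b)" .
qed simp

text \<open>Conjugating with \<open>to_wo\<close> preserves Lebesgue measure and, by
  \<open>det_reindex\<close>, the Jacobian determinant.\<close>

lemma emeasure_differentiable_image:
  fixes f :: "real^'n::finite \<Rightarrow> real^'n"
  assumes S: "S \<in> sets borel" "f ` S \<in> sets borel" and inj: "inj_on f S"
    and der: "\<And>x. x \<in> S \<Longrightarrow> (f has_derivative f' x) (at x)"
    and meas: "(\<lambda>x. indicator S x * \<bar>det (matrix (f' x))\<bar>) \<in> borel_measurable borel"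
  shows "emeasure lborel (f ` S) = (\<integral>\<^sup>+x. ennreal (indicator S x * \<bar>det (matrix (f' x))\<bar>) \<partial>lborel)"
proof -
  let ?g = "\<lambda>w. to_wo (f (of_wo w))" and ?g' = "\<lambda>w v. to_wo (f' (of_wo w) (of_wo v))"
  have img: "to_wo ` A \<in> sets borel" if "A \<in> sets borel" for A :: "(real^'n) set"
    unfolding image_to_wo using measurable_sets[OF measurable_of_wo that] by simp
  have gi: "?g ` to_wo ` S = to_wo ` f ` S" by (simp add: image_image)
  have e: "emeasure lborel (to_wo ` A) = emeasure lborel A" if "A \<in> sets borel" for A :: "(real^'n) set"
  proof -
    have "emeasure lborel (to_wo ` A) = emeasure (distr lborel borel to_wo) (to_wo ` A)" by (simp add: lborel_to_wo)
    also have "\<dots> = emeasure lborel (to_wo -` to_wo ` A)" using img[OF that] by (simp add: emeasure_distr)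
    also have "to_wo -` to_wo ` A = A" by (auto simp: image_iff) (metis of_to_wo)
    finally show ?thesis .
  qed
  have det: "det (matrix (?g' w)) = det (matrix (f' (of_wo w)))" for w
  proof -
    have "of_wo (axis j 1) = axis (Rep_wo j) 1" for j :: "'n wo"
      by (auto simp: of_wo_def axis_def vec_eq_iff Abs_wo_inverse Rep_wo_inverse)
    then have "matrix (?g' w) = (\<chi> i j. matrix (f' (of_wo w)) $ Rep_wo i $ Rep_wo j)"
      by (simp add: matrix_def to_wo_def)
    then show ?thesis using det_reindex[OF bij_Rep_wo] by simp
  qed
  have ind: "indicator (to_wo ` S) w = (indicator S (of_wo w) :: real)" for w
    by (simp add: image_to_wo indicator_def)
  have "emeasure lborel (f ` S) = emeasure lborel (?g ` to_wo ` S)"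
    unfolding gi by (rule e[OF S(2), symmetric])
  also have "\<dots> = (\<integral>\<^sup>+w. ennreal (indicator (to_wo ` S) w * \<bar>det (matrix (?g' w))\<bar>) \<partial>lborel)"
  proof (rule emeasure_differentiable_image_wo)
    show "to_wo ` S \<in> sets borel" "?g ` to_wo ` S \<in> sets borel"
      unfolding gi using img S by blast+
    show "inj_on ?g (to_wo ` S)"
      using inj by (auto simp: inj_on_def) (metis of_to_wo)
    show "(?g has_derivative ?g' w) (at w)" if "w \<in> to_wo ` S" for w
    proof -
      have "of_wo w \<in> S" using that by auto
      then have "(f has_derivative f' (of_wo w)) (at (of_wo w))" by (rule der)
      from bounded_linear.has_derivative[OF bounded_linear_to_wo diff_chain_at[OF bounded_linear_imp_has_derivative[OF bounded_linear_of_wo] this]]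
      show ?thesis by (simp add: o_def)
    qed
    have "(\<lambda>w. indicator S (of_wo w) * \<bar>det (matrix (f' (of_wo w)))\<bar>) \<in> borel_measurable borel"
      using measurable_compose[OF measurable_of_wo meas] by simp
    then show "(\<lambda>w. indicator (to_wo ` S) w * \<bar>det (matrix (?g' w))\<bar>) \<in> borel_measurable borel"
      by (simp only: ind det)
  qed
  also have "\<dots> = (\<integral>\<^sup>+w. ennreal (indicator S (of_wo w) * \<bar>det (matrix (f' (of_wo w)))\<bar>) \<partial>distr lborel borel to_wo)"
    by (simp only: ind det lborel_to_wo)
  also have "\<dots> = (\<integral>\<^sup>+x. ennreal (indicator S x * \<bar>det (matrix (f' x))\<bar>) \<partial>lborel)"
    using measurable_compose[OF measurable_of_wo meas]
    by (subst nn_integral_distr) simp_all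
  finally show ?thesis .
qed

text \<open>An equality of measures, so that substitution in integrals follows from the rules for
  \<open>distr\<close> and \<open>density\<close>. On a Borel set \<open>B\<close> it is the volume
  formula for the image of its preimage \<open>S\<close>.\<close>

lemma restrict_lborel_change_of_variables:
  fixes f :: "real^'n::finite \<Rightarrow> real^'n"
  assumes U: "open U" and V: "open V" and im: "f ` U = V" and inj: "inj_on f U"
    and der: "\<And>x. x \<in> U \<Longrightarrow> f differentiable (at x)"
    and cont: "continuous_on U (\<lambda>x. det (matrix (frechet_derivative f (at x))))"
  shows "restrict_space lborel V =
     distr (density (restrict_space lborel U) (\<lambda>x. ennreal \<bar>det (matrix (frechet_derivative f (at x)))\<bar>)) (restrict_space lborel V) f"
    (is "_ = distr ?D _ _")
proof (rule measure_eqI)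
  let ?d = "\<lambda>x. \<bar>det (matrix (frechet_derivative f (at x)))\<bar>"
  have Ub: "U \<in> sets borel" and Vb: "V \<in> sets borel" using U V by auto
  have cf: "continuous_on U f" by (rule differentiable_imp_continuous_on_at[OF der])
  have dm: "?d \<in> borel_measurable (restrict_space borel U)"
    by (intro borel_measurable_continuous_on_restrict continuous_intros cont)
  have dm': "(\<lambda>x. ennreal (?d x)) \<in> borel_measurable (restrict_space lborel U)"
    using dm by (simp add: measurable_def space_restrict_space sets_restrict_space) (use dm measurable_compose[OF dm measurable_ennreal] in \<open>simp add: measurable_def space_restrict_space sets_restrict_space\<close>)
  have fm: "f \<in> measurable ?D (restrict_space lborel V)"
  proof -
    have "f \<in> measurable (restrict_space borel U) (restrict_space borel V)"
      by (intro measurable_restrict_space2 borel_measurable_continuous_on_restrict cf)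
         (use im in \<open>auto simp: space_restrict_space\<close>)
    then show ?thesis by (simp add: measurable_def space_restrict_space sets_restrict_space)
  qed
  show "sets (restrict_space lborel V) = sets (distr ?D (restrict_space lborel V) f)" by simp
  fix B assume B: "B \<in> sets (restrict_space lborel V)"
  then have B': "B \<subseteq> V" "B \<in> sets borel"
    using Vb by (auto simp: sets_restrict_space)
  define S where "S = f -` B \<inter> U"
  have "S \<in> sets (restrict_space borel U)"
    using measurable_sets[OF borel_measurable_continuous_on_restrict[OF cf] B'(2)]
    by (simp add: S_def space_restrict_space)
  then have S: "S \<in> sets borel" "S \<subseteq> U"
    using Ub by (auto simp: sets_restrict_space S_def)
  have fS: "f ` S = B" using B' im by (auto simp: S_def)
  have ind: "indicator S x * ?d x = indicator S x *\<^sub>R (indicator U x *\<^sub>R ?d x)" for x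
    using S(2) by (auto simp: indicator_def)
  have dU: "(\<lambda>x. indicator U x *\<^sub>R ?d x) \<in> borel_measurable borel"
    using dm Ub by (simp add: borel_measurable_restrict_space_iff)
  have "emeasure (restrict_space lborel V) B = emeasure lborel (f ` S)"
    using B' Vb by (simp add: emeasure_restrict_space fS)
  also have "\<dots> = (\<integral>\<^sup>+x. ennreal (indicator S x * ?d x) \<partial>lborel)"
  proof (rule emeasure_differentiable_image)
    show "S \<in> sets borel" "f ` S \<in> sets borel" using S B' fS by auto
    show "inj_on f S" using inj S by (auto intro: inj_on_subset)
    show "\<And>x. x \<in> S \<Longrightarrow> (f has_derivative frechet_derivative f (at x)) (at x)"
      using der S by (auto intro: frechet_derivativeD)
    show "(\<lambda>x. indicator S x * ?d x) \<in> borel_measurable borel"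
      unfolding ind using S dU by measurable
  qed
  also have "\<dots> = (\<integral>\<^sup>+x. ennreal (?d x) * indicator S x * indicator U x \<partial>lborel)"
    using S by (intro nn_integral_cong) (auto simp: indicator_def)
  also have "\<dots> = (\<integral>\<^sup>+x. ennreal (?d x) * indicator S x \<partial>restrict_space lborel U)"
    using Ub by (simp add: nn_integral_restrict_space)
  also have "\<dots> = emeasure ?D S"
    using S dm' Ub by (subst emeasure_density) (auto simp: sets_restrict_space_iff)
  also have "\<dots> = emeasure (distr ?D (restrict_space lborel V) f) B"
    using emeasure_distr[OF fm, of B] B S_def by (simp add: space_restrict_space)
  finally show "emeasure (restrict_space lborel V) B = emeasure (distr ?D (restrict_space lborel V) f) B" .
qed

text \<open>The integral of \<open>x \<mapsto> F(x + te)\<close> does not depend on \<open>t\<close>; differentiate under the integral sign.\<close>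

lemma integral_partial_compact_support:
  fixes F :: "real^'n::finite \<Rightarrow> real"
  assumes dF: "\<And>x. F differentiable (at x)" and cont: "continuous_on UNIV (pd a F)"
    and K: "compact K" and supp: "\<And>x. x \<notin> K \<Longrightarrow> F x = 0"
  shows "integrable lborel (pd a F)" "(\<integral>x. pd a F x \<partial>lborel) = 0"
proof -
  let ?e = "axis a 1 :: real^'n"
  have cF: "continuous_on UNIV F" by (rule differentiable_imp_continuous_on_at) (rule dF)
  have zero: "pd a F x = 0" if "x \<notin> K" for x
  proof -
    have "pd a F x = frechet_derivative (\<lambda>x. 0::real) (at x) ?e"
      by (rule arg_cong[where f="\<lambda>G. G ?e"], rule frechet_derivative_cong_open[of "- K"])
         (use compact_imp_closed[OF K] that supp in auto)
    then show ?thesis by (simp add: frechet_derivative_const_zero)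
  qed
  obtain B where B: "\<And>x. x \<in> K \<Longrightarrow> norm (pd a F x) \<le> B"
    using compact_imp_bounded[OF compact_continuous_image[OF continuous_on_subset[OF cont] K]]
    by (auto simp: bounded_iff)
  have B': "\<bar>pd a F x\<bar> \<le> \<bar>B\<bar>" for x
    using B[of x] zero[of x] by (cases "x \<in> K") auto
  obtain r where r: "\<And>x. x \<in> K \<Longrightarrow> norm x \<le> r"
    using compact_imp_bounded[OF K] by (auto simp: bounded_iff)
  \<comment> \<open>The dominating function. The radius \<open>r + 1\<close> leaves room for the
    shift by at most 1 in the difference quotients.\<close>
  let ?w = "\<lambda>x. indicator (cball 0 (r + 1)) x *\<^sub>R \<bar>B\<bar>"
  have w: "integrable lborel ?w"
    by (intro integrable_real_indicator integrable_scaleR_left)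
       (use emeasure_bounded_finite[of "cball 0 (r + 1)"] in auto)
  let ?f = "\<lambda>k x. (F (x + (1 / real (Suc k)) *\<^sub>R ?e) - F x) * real (Suc k)"
  have Fint: "integrable lborel F"
  proof -
    have "integrable lborel (\<lambda>x. indicator K x *\<^sub>R F x)"
      by (intro borel_integrable_compact continuous_on_subset[OF cF] K) auto
    moreover have "(\<lambda>x. indicator K x *\<^sub>R F x) = F" using supp by (auto simp: fun_eq_iff indicator_def)
    ultimately show ?thesis by simp
  qed
  have Fm [measurable]: "F \<in> borel_measurable borel" using cF by (rule borel_measurable_continuous_onI)
  have dm: "pd a F \<in> borel_measurable lborel" using borel_measurable_continuous_onI[OF cont] by simp
  have tr: "integrable lborel (\<lambda>x. F (x + v))" "(\<integral>x. F (x + v) \<partial>lborel) = (\<integral>x. F x \<partial>lborel)" for v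
  proof -
    have "(\<lambda>x. x + v) = (+) v" by (simp add: fun_eq_iff add.commute)
    then have d: "distr lborel borel (\<lambda>x. x + v) = lborel" using lborel_distr_plus[of v] by simp
    have m: "(\<lambda>x. x + v) \<in> measurable lborel borel" by simp
    show "integrable lborel (\<lambda>x. F (x + v))"
      using integrable_distr_eq[OF m Fm] Fint d by simp
    show "(\<integral>x. F (x + v) \<partial>lborel) = (\<integral>x. F x \<partial>lborel)"
      using integral_distr[OF m Fm] d by simp
  qed
  have lim: "(\<lambda>k. ?f k x) \<longlonglongrightarrow> pd a F x" for x
  proof -
    have "((\<lambda>s. F (x + s *\<^sub>R ?e)) has_real_derivative pd a F x) (at 0)"
      using has_real_derivative_along_line[of F x 0 ?e] dF by simp
    then have "((\<lambda>h. (F (x + h *\<^sub>R ?e) - F x) / h) \<longlongrightarrow> pd a F x) (at 0)"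
      by (simp add: DERIV_def)
    moreover have "filterlim (\<lambda>k. 1 / real (Suc k)) (at 0) sequentially"
    proof (rule filterlim_atI)
      show "(\<lambda>k. 1 / real (Suc k)) \<longlonglongrightarrow> 0"
        using LIMSEQ_inverse_real_of_nat by (simp only: inverse_eq_divide)
    qed simp
    ultimately have "((\<lambda>k. (F (x + (1 / real (Suc k)) *\<^sub>R ?e) - F x) / (1 / real (Suc k))) \<longlongrightarrow> pd a F x) sequentially"
      by (rule filterlim_compose)
    then show ?thesis by simp
  qed
  have bound: "norm (?f k x) \<le> ?w x" for k x
  proof -
    let ?t = "1 / real (Suc k)"
    have t: "0 < ?t" "?t \<le> 1" by auto
    \<comment> \<open>The difference quotient is a value of the partial derivative at an
      intermediate point, hence bounded uniformly in \<open>k\<close>.\<close>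
    have "\<exists>z>0. z < ?t \<and> F (x + ?t *\<^sub>R ?e) - F (x + 0 *\<^sub>R ?e) = (?t - 0) * pd a F (x + z *\<^sub>R ?e)"
      by (rule MVT2[OF t(1)]) (rule has_real_derivative_along_line[OF dF])
    then obtain z where z: "0 < z" "z < ?t" "F (x + ?t *\<^sub>R ?e) - F x = ?t * pd a F (x + z *\<^sub>R ?e)"
      by auto
    have eq: "?f k x = pd a F (x + z *\<^sub>R ?e)" unfolding z(3) by simp
    show ?thesis
    proof (cases "x \<in> cball 0 (r + 1)")
      case True
      then show ?thesis using B'[of "x + z *\<^sub>R ?e"] unfolding eq by simp
    next
      case False
      have "norm x \<le> norm (x + z *\<^sub>R ?e) + norm (z *\<^sub>R ?e)"
        using norm_triangle_ineq4[of "x + z *\<^sub>R ?e" "z *\<^sub>R ?e"] by simp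
      also have "norm (z *\<^sub>R ?e) \<le> 1" using z(1) less_le_trans[OF z(2) t(2)] by simp
      finally have "x + z *\<^sub>R ?e \<notin> K" using False r[of "x + z *\<^sub>R ?e"] by auto
      then show ?thesis using zero unfolding eq by simp
    qed
  qed
  have sm: "?f k \<in> borel_measurable lborel" for k by measurable
  show "integrable lborel (pd a F)"
    by (rule integrable_dominated_convergence[where s="?f" and w="?w", OF dm sm w]) (use lim bound in auto)
  have "(\<lambda>k. \<integral>x. ?f k x \<partial>lborel) \<longlonglongrightarrow> (\<integral>x. pd a F x \<partial>lborel)"
    by (rule integral_dominated_convergence[where s="?f" and w="?w", OF dm sm w]) (use lim bound in auto)
  moreover have "(\<integral>x. ?f k x \<partial>lborel) = 0" for k
    using tr Fint by simp
  ultimately have "(\<lambda>k::nat. 0::real) \<longlonglongrightarrow> (\<integral>x. pd a F x \<partial>lborel)"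
    by (simp only:)
  then show "(\<integral>x. pd a F x \<partial>lborel) = 0"
    by (simp only: LIMSEQ_const_iff)
qed

section \<open>Invariance of traces, norm and field under coordinate changes\<close>

text \<open>A bilinear form transforms by congruence; once an index is raised, the transposed
  factors cancel and the endomorphism transforms by conjugation, which leaves traces
  unchanged.\<close>

lemma inverse_metric_conjugate:
  fixes P H B Hc :: "real^'n^'n"
  assumes H: "Hc = matrix_inv P ** H ** transpose (matrix_inv P)" and P: "det P \<noteq> 0"
  shows "Hc ** (transpose P ** B ** P) = matrix_inv P ** (H ** B) ** P"
proof -
  have "transpose (matrix_inv P) ** transpose P = mat 1"
    using matrix_inv_mult(1)[OF P] by (metis matrix_transpose_mul transpose_mat)
  then have "transpose (matrix_inv P) ** (transpose P ** C) = C" for C :: "real^'n^'n"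
    by (simp add: matrix_mul_assoc)
  then show ?thesis by (simp add: H matrix_mul_assoc[symmetric])
qed

lemma trace_conjugate:
  fixes P B :: "real^'n^'n"
  assumes P: "det P \<noteq> 0"
  shows "trace (matrix_inv P ** B ** P) = trace B"
proof -
  have "trace (matrix_inv P ** B ** P) = trace (P ** (matrix_inv P ** B))" by (rule trace_mul_sym)
  then show ?thesis by (simp add: matrix_mul_assoc matrix_inv_mult(1)[OF P])
qed

context patch_change
begin

lemma H_change:
  assumes x: "x \<in> U"
  shows "S.H x = matrix_inv (P x) ** T.H (\<phi> x) ** transpose (matrix_inv (P x))"
proof (rule matrix_inv_unique)
  have t: "transpose (P x) ** transpose (matrix_inv (P x)) = mat 1"
    using P_inv(2)[OF x] by (metis matrix_transpose_mul transpose_mat)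
  have "G x ** (matrix_inv (P x) ** T.H (\<phi> x) ** transpose (matrix_inv (P x)))
    = transpose (P x) ** (G' (\<phi> x) ** ((P x ** matrix_inv (P x)) ** (T.H (\<phi> x) ** transpose (matrix_inv (P x)))))"
    unfolding pull[OF x, folded P_def] by (simp only: matrix_mul_assoc)
  also have "\<dots> = mat 1"
    by (simp add: P_inv x T.G_H_assoc[OF \<phi>_in[OF x]] t)
  finally show "G x ** (matrix_inv (P x) ** T.H (\<phi> x) ** transpose (matrix_inv (P x))) = mat 1" .
qed

lemma H_pull:
  assumes "x \<in> U"
  shows "S.H x ** (transpose (P x) ** B ** P x) = matrix_inv (P x) ** (T.H (\<phi> x) ** B) ** P x"
  by (rule inverse_metric_conjugate[OF H_change[OF assms] det_P[OF assms]])

lemma scal_change: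
  assumes x: "x \<in> U"
  shows "S.scal x = T.scal (\<phi> x)"
proof -
  have "S.scal x = trace (S.H x ** ricci_matrix G x)"
    by (simp add: S.scal_eq_trace[OF x] S.ricH_def trace_mul_sym[of "ricci_matrix G x"])
  also have "\<dots> = trace (T.H (\<phi> x) ** ricci_matrix G' (\<phi> x))"
    by (simp add: ricci_change[OF x] H_pull[OF x] trace_conjugate[OF det_P[OF x]])
  also have "\<dots> = T.scal (\<phi> x)"
    by (simp add: T.scal_eq_trace[OF \<phi>_in[OF x]] T.ricH_def trace_mul_sym[of "ricci_matrix G' (\<phi> x)"])
  finally show ?thesis .
qed

lemma tfric_change:
  assumes x: "x \<in> U"
  shows "S.tfric x = transpose (P x) ** T.tfric (\<phi> x) ** P x"
  unfolding S.tfric_def T.tfric_def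
  by (simp add: scal_change[OF x] ricci_change[OF x] pull[OF x, folded P_def] matrix_algebra)

lemma norm_change:
  assumes x: "x \<in> U"
  shows "trace (transpose (S.tfric x) ** S.H x ** S.tfric x ** S.H x)
    = trace (transpose (T.tfric (\<phi> x)) ** T.H (\<phi> x) ** T.tfric (\<phi> x) ** T.H (\<phi> x))"
proof -
  let ?E = "T.tfric (\<phi> x)" and ?H = "T.H (\<phi> x)" and ?I = "matrix_inv (P x)"
  have tr: "transpose (S.tfric x) = transpose (P x) ** transpose ?E ** P x"
    by (simp add: tfric_change[OF x] matrix_transpose_mul matrix_mul_assoc)
  have "trace (transpose (S.tfric x) ** S.H x ** S.tfric x ** S.H x)
     = trace ((S.H x ** transpose (S.tfric x)) ** (S.H x ** S.tfric x))"
    by (subst trace_mul_sym) (simp only: matrix_mul_assoc)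
  also have "(S.H x ** transpose (S.tfric x)) ** (S.H x ** S.tfric x)
     = ?I ** ((?H ** transpose ?E) ** (P x ** ?I) ** (?H ** ?E)) ** P x"
    unfolding tr unfolding tfric_change[OF x] H_pull[OF x] by (simp only: matrix_mul_assoc)
  also have "trace \<dots> = trace ((?H ** transpose ?E) ** (?H ** ?E))"
    by (simp add: trace_conjugate[OF det_P[OF x]] P_inv x)
  also have "\<dots> = trace (transpose ?E ** ?H ** ?E ** ?H)"
    by (subst (2) trace_mul_sym) (simp only: matrix_mul_assoc)
  finally show ?thesis .
qed

text \<open>This is what makes the coordinate expressions of the field Y of the overview fit
  together to one vector field.\<close>

lemma field_change:
  assumes x: "x \<in> U"
  shows "(T.H (\<phi> x) ** T.tfric (\<phi> x)) *v (P x *v w) = P x *v ((S.H x ** S.tfric x) *v w)"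
proof -
  have "P x ** (S.H x ** S.tfric x) = T.H (\<phi> x) ** T.tfric (\<phi> x) ** P x"
    unfolding tfric_change[OF x] H_pull[OF x] by (simp add: matrix_mul_assoc P_inv x)
  then show ?thesis by (simp only: matrix_vector_mul_assoc)
qed

text \<open>The factor is exactly the one produced by the change of variables, so the volume does
  not depend on the chart.\<close>

lemma sqrt_det_change:
  assumes x: "x \<in> U"
  shows "sqrt (det (G x)) = \<bar>det (P x)\<bar> * sqrt (det (G' (\<phi> x)))"
proof -
  have "det (G x) = (det (P x))\<^sup>2 * det (G' (\<phi> x))"
    by (simp add: pull[OF x, folded P_def] det_mul power2_eq_square)
  then show ?thesis by (simp add: real_sqrt_mult)
qed

end

lemma metric_patch_subset: "metric_patch U G \<Longrightarrow> open W \<Longrightarrow> W \<subseteq> U \<Longrightarrow> metric_patch W G"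
  unfolding metric_patch_def by (auto intro: smooth_on_subset)

section \<open>Tensors on a Riemannian manifold\<close>

text \<open>Indexed by the point instead of its coordinates, so that the cocycle law
  \<open>jac_comp\<close> mentions a single point.\<close>

definition jac :: "('a, 'n::finite) chart \<Rightarrow> ('a, 'n) chart \<Rightarrow> 'a \<Rightarrow> real^'n^'n" where
  "jac c d p = matrix (frechet_derivative (transition c d) (at (coords c p)))"

locale riem_manifold =
  fixes M :: "'a topology" and A :: "('a, 'n::finite) chart set" and g :: "('a, 'n) tensor2"
  assumes mfd: "smooth_manifold M A" and met: "riemannian_metric M A g"
begin

lemma atlas: "smooth_atlas M A" and Hausdorff: "Hausdorff_space M"
  using mfd by (simp_all add: smooth_manifold_def)

lemma dom_open: "c \<in> A \<Longrightarrow> openin M (chart_dom c)"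
  and image_open: "c \<in> A \<Longrightarrow> open (chart_image c)"
  and homeo: "c \<in> A \<Longrightarrow> homeomorphic_map (subtopology M (chart_dom c)) (top_of_set (chart_image c)) (coords c)"
  and cover: "(\<Union>c\<in>A. chart_dom c) = topspace M"
  and smooth_transition: "c \<in> A \<Longrightarrow> d \<in> A \<Longrightarrow> smooth_on (coords c ` (chart_dom c \<inter> chart_dom d)) (transition c d)"
  using atlas unfolding smooth_atlas_def by blast+

lemma dom_sub: "c \<in> A \<Longrightarrow> chart_dom c \<subseteq> topspace M"
  using dom_open openin_subset by blast

lemma topspace_dom: "c \<in> A \<Longrightarrow> topspace (subtopology M (chart_dom c)) = chart_dom c"
  by (rule topspace_subtopology_subset[OF dom_sub])

lemma inj_coords: "c \<in> A \<Longrightarrow> inj_on (coords c) (chart_dom c)"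
  using homeomorphic_imp_injective_map[OF homeo] topspace_dom by metis

lemma inv_coords: "c \<in> A \<Longrightarrow> p \<in> chart_dom c \<Longrightarrow> chart_inv c (coords c p) = p"
  unfolding chart_inv_def by (rule inv_into_f_f[OF inj_coords])

lemma coords_inv: "x \<in> chart_image c \<Longrightarrow> coords c (chart_inv c x) = x"
  unfolding chart_inv_def chart_image_def by (rule f_inv_into_f)

lemma inv_in_dom: "x \<in> chart_image c \<Longrightarrow> chart_inv c x \<in> chart_dom c"
  unfolding chart_inv_def chart_image_def by (rule inv_into_into)

lemma coords_in: "p \<in> chart_dom c \<Longrightarrow> coords c p \<in> chart_image c"
  by (simp add: chart_image_def)

lemma open_coords_image:
  assumes c: "c \<in> A" and W: "openin M W" "W \<subseteq> chart_dom c"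
  shows "open (coords c ` W)"
proof -
  have "openin (subtopology M (chart_dom c)) W"
    using W by (auto simp: openin_subtopology)
  then have "openin (top_of_set (chart_image c)) (coords c ` W)"
    using homeomorphic_imp_open_map[OF homeo[OF c]] by (simp add: open_map_def)
  then show ?thesis using image_open[OF c] openin_open_trans by blast
qed

lemma inv_image_eq:
  assumes c: "c \<in> A" and V: "V \<subseteq> chart_image c"
  shows "chart_inv c ` V = {p \<in> chart_dom c. coords c p \<in> V}"
proof -
  have "p \<in> chart_inv c ` V" if "p \<in> chart_dom c" "coords c p \<in> V" for p
    using inv_coords[OF c that(1)] that(2) by (metis imageI)
  then show ?thesis using V coords_inv[of _ c] inv_in_dom[of _ c] by auto
qed

lemma open_inv_image:
  assumes c: "c \<in> A" and V: "open V" "V \<subseteq> chart_image c"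
  shows "openin M (chart_inv c ` V)"
proof -
  have "openin (top_of_set (chart_image c)) V" using V by (auto simp: openin_open)
  then have "openin (subtopology M (chart_dom c)) {p \<in> chart_dom c. coords c p \<in> V}"
    using openin_continuous_map_preimage[OF homeomorphic_imp_continuous_map[OF homeo[OF c]]] topspace_dom[OF c]
    by metis
  then show ?thesis
    unfolding inv_image_eq[OF c V(2)] using dom_open[OF c] openin_trans_full by blast
qed

lemma coords_preimage:
  assumes c: "c \<in> A"
  shows "{x \<in> chart_image c. chart_inv c x \<in> W} = coords c ` (W \<inter> chart_dom c)"
proof -
  have "x \<in> coords c ` (W \<inter> chart_dom c)" if "x \<in> chart_image c" "chart_inv c x \<in> W" for x
    using that inv_in_dom[OF that(1)] coords_inv[OF that(1)] by (metis IntI imageI)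
  then show ?thesis using inv_coords[OF c] coords_in[of _ c] by auto
qed

lemma continuous_chart_inv: "c \<in> A \<Longrightarrow> continuous_map (top_of_set (chart_image c)) M (chart_inv c)"
proof -
  assume c: "c \<in> A"
  have "openin (top_of_set (chart_image c)) {x \<in> chart_image c. chart_inv c x \<in> W}" if "openin M W" for W
  proof -
    have "open (coords c ` (W \<inter> chart_dom c))"
      using that dom_open[OF c] by (intro open_coords_image[OF c]) auto
    then show ?thesis
      unfolding coords_preimage[OF c] using coords_in[of _ c] by (intro open_subset) auto
  qed
  then show ?thesis
    using dom_sub[OF c] inv_in_dom[of _ c] by (auto simp: continuous_map_def)
qed

lemma compact_inv_image: "c \<in> A \<Longrightarrow> compact K \<Longrightarrow> K \<subseteq> chart_image c \<Longrightarrow> compactin M (chart_inv c ` K)"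
  by (rule image_compactin[OF _ continuous_chart_inv]) (auto simp: compactin_subtopology)

lemma charts_at_iff: "c \<in> charts_at A p \<longleftrightarrow> c \<in> A \<and> p \<in> chart_dom c"
  by (simp add: charts_at_def)

lemma chart_at: "p \<in> topspace M \<Longrightarrow> chart_at A p \<in> charts_at A p"
  unfolding chart_at_def by (rule someI_ex) (use cover charts_at_iff in blast)

abbreviation overlap :: "('a, 'n) chart \<Rightarrow> ('a, 'n) chart \<Rightarrow> (real^'n) set" where
  "overlap c d \<equiv> coords c ` (chart_dom c \<inter> chart_dom d)"

lemma open_overlap: "c \<in> A \<Longrightarrow> d \<in> A \<Longrightarrow> open (overlap c d)"
  by (rule open_coords_image) (auto intro: dom_open)

lemma transition_coords: "c \<in> A \<Longrightarrow> p \<in> chart_dom c \<Longrightarrow> transition c d (coords c p) = coords d p"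
  by (simp add: transition_def inv_coords)

lemma transition_differentiable:
  assumes "c \<in> A" "d \<in> A" "p \<in> chart_dom c" "p \<in> chart_dom d"
  shows "transition c d differentiable (at (coords c p))"
  using smooth_transition[OF assms(1,2)] assms(3,4)
  by (intro Ck_on_differentiable[where k=0 and U="overlap c d"]) (auto simp: smooth_on_def simp del: Ck_on.simps)

lemma frechet_transition:
  assumes "c \<in> A" "d \<in> A" "p \<in> chart_dom c" "p \<in> chart_dom d"
  shows "frechet_derivative (transition c d) (at (coords c p)) v = jac c d p *v v"
  unfolding jac_def using linear_frechet_derivative[OF transition_differentiable[OF assms]]
  by (simp add: matrix_works)

text \<open>Chain rule on the triple overlap. This cocycle condition makes the coordinate vectors
  tangent vectors.\<close>

lemma jac_comp:
  assumes A: "c \<in> A" "d \<in> A" "e \<in> A" and p: "p \<in> chart_dom c" "p \<in> chart_dom d" "p \<in> chart_dom e"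
  shows "jac d e p ** jac c d p = jac c e p"
proof (rule matrix_eq[THEN iffD2], rule allI)
  fix v
  let ?W = "coords c ` (chart_dom c \<inter> chart_dom d \<inter> chart_dom e)"
  have "frechet_derivative (transition c e) (at (coords c p))
      = frechet_derivative (\<lambda>x. transition d e (transition c d x)) (at (coords c p))"
  proof (rule frechet_derivative_cong_open)
    show "open ?W" by (intro open_coords_image A) (auto intro: dom_open A)
    show "coords c p \<in> ?W" using p by auto
    show "transition c e y = transition d e (transition c d y)" if "y \<in> ?W" for y
      using that by (auto simp: transition_coords A)
  qed
  then have "jac c e p *v v = jac d e p *v (jac c d p *v v)"
    using A p frechet_derivative_compose[of "transition c d" "coords c p" "transition d e" v]
    by (simp add: frechet_transition[symmetric] transition_coords transition_differentiable)
  then show "(jac d e p ** jac c d p) *v v = jac c e p *v v"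
    by (simp add: matrix_vector_mul_assoc)
qed

lemma jac_self:
  assumes c: "c \<in> A" and p: "p \<in> chart_dom c"
  shows "jac c c p = mat 1"
proof (rule matrix_eq[THEN iffD2], rule allI)
  fix v
  have "frechet_derivative (transition c c) (at (coords c p)) = frechet_derivative (\<lambda>x. x) (at (coords c p))"
    by (rule frechet_derivative_cong_open[OF image_open[OF c] coords_in[OF p]])
       (simp add: transition_def coords_inv)
  also have "\<dots> = (\<lambda>x. x)"
    by (rule frechet_derivative_at'[OF has_derivative_ident])
  finally have "frechet_derivative (transition c c) (at (coords c p)) v = v" by simp
  then show "jac c c p *v v = mat 1 *v v"
    using frechet_transition[OF c c p p] by simp
qed

lemma tangent_space_iff:
  "v \<in> tangent_space A p \<longleftrightarrow>
    (\<forall>c\<in>charts_at A p. \<forall>d\<in>charts_at A p. v d = jac c d p *v v c) \<and> (\<forall>c. c \<notin> charts_at A p \<longrightarrow> v c = 0)"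
proof -
  have "frechet_derivative (transition c d) (at (coords c p)) (v c) = jac c d p *v v c"
    if "c \<in> charts_at A p" "d \<in> charts_at A p" for c d
    using that frechet_transition by (simp add: charts_at_iff)
  then show ?thesis unfolding tangent_space_def by auto
qed

lemma tangent_change:
  "v \<in> tangent_space A p \<Longrightarrow> c \<in> charts_at A p \<Longrightarrow> d \<in> charts_at A p \<Longrightarrow> v d = jac c d p *v v c"
  unfolding tangent_space_iff by blast

lemma tangent_outside: "v \<in> tangent_space A p \<Longrightarrow> c \<notin> charts_at A p \<Longrightarrow> v c = 0"
  unfolding tangent_space_iff by blast

lemma coord_vec_eq:
  assumes "c \<in> charts_at A p" "d \<in> charts_at A p"
  shows "coord_vec A c p i d = jac c d p *v axis i 1"
  using assms frechet_transition by (simp add: coord_vec_def charts_at_iff)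

lemma coord_vec_outside: "d \<notin> charts_at A p \<Longrightarrow> coord_vec A c p i d = 0"
  by (simp add: coord_vec_def)

lemma coord_vec_self: "c \<in> charts_at A p \<Longrightarrow> coord_vec A c p i c = axis i 1"
  using jac_self by (simp add: coord_vec_eq charts_at_iff)

lemma coord_vec_tangent:
  assumes c: "c \<in> charts_at A p"
  shows "coord_vec A c p i \<in> tangent_space A p"
  unfolding tangent_space_iff
proof (intro conjI ballI allI impI)
  fix d e assume "d \<in> charts_at A p" "e \<in> charts_at A p"
  then show "coord_vec A c p i e = jac d e p *v coord_vec A c p i d"
    using c jac_comp[of c d e p] by (simp add: coord_vec_eq matrix_vector_mul_assoc charts_at_iff)
qed (simp add: coord_vec_outside)

lemma tangent_space_sum:
  assumes "\<And>i. i \<in> I \<Longrightarrow> f i \<in> tangent_space A p"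
  shows "(\<lambda>d. \<Sum>i\<in>I. r i *\<^sub>R f i d) \<in> tangent_space A p"
  unfolding tangent_space_iff
proof (intro conjI ballI allI impI)
  fix c d assume cd: "c \<in> charts_at A p" "d \<in> charts_at A p"
  have "f i d = jac c d p *v f i c" if "i \<in> I" for i
    using tangent_change[OF assms[OF that]] cd .
  then show "(\<Sum>i\<in>I. r i *\<^sub>R f i d) = jac c d p *v (\<Sum>i\<in>I. r i *\<^sub>R f i c)"
    by (simp add: bounded_bilinear.sum_right[OF bounded_bilinear_matrix_vector]
      bounded_bilinear.scaleR_right[OF bounded_bilinear_matrix_vector])
next
  fix c assume "c \<notin> charts_at A p"
  then show "(\<Sum>i\<in>I. r i *\<^sub>R f i c) = 0"
    using tangent_outside[OF assms] by (intro sum.neutral ballI) simp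
qed

lemma tangent_expand:
  assumes v: "v \<in> tangent_space A p" and c: "c \<in> charts_at A p"
  shows "v = (\<lambda>d. \<Sum>i\<in>UNIV. v c $ i *\<^sub>R coord_vec A c p i d)"
proof (rule ext)
  fix d
  show "v d = (\<Sum>i\<in>UNIV. v c $ i *\<^sub>R coord_vec A c p i d)"
  proof (cases "d \<in> charts_at A p")
    case True
    have "v d = jac c d p *v v c" using tangent_change[OF v c True] .
    also have "\<dots> = jac c d p *v (\<Sum>i\<in>UNIV. v c $ i *\<^sub>R axis i 1)" using vec_eq_sum_axis[of "v c"] by simp
    also have "\<dots> = (\<Sum>i\<in>UNIV. v c $ i *\<^sub>R (jac c d p *v axis i 1))"
      by (simp only: bounded_bilinear.sum_right[OF bounded_bilinear_matrix_vector]
          bounded_bilinear.scaleR_right[OF bounded_bilinear_matrix_vector])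
    finally show ?thesis by (simp add: coord_vec_eq c True)
  next
    case False
    then show ?thesis using tangent_outside[OF v] by (simp add: coord_vec_outside)
  qed
qed

lemma inner_add_left:
  assumes "inner_product_on_tangent A p B" "u \<in> tangent_space A p" "v \<in> tangent_space A p" "w \<in> tangent_space A p"
  shows "B (\<lambda>c. u c + v c) w = B u w + B v w"
  using assms unfolding inner_product_on_tangent_def by blast

lemma inner_scale_left:
  assumes "inner_product_on_tangent A p B" "u \<in> tangent_space A p" "w \<in> tangent_space A p"
  shows "B (\<lambda>c. r *\<^sub>R u c) w = r * B u w"
  using assms unfolding inner_product_on_tangent_def by blast

text \<open>Additivity and homogeneity are given for tangent vectors only, so the induction has to
  carry membership in the tangent space.\<close>

lemma inner_sum_left:
  assumes B: "inner_product_on_tangent A p B" and I: "finite I"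
    and f: "\<And>i. i \<in> I \<Longrightarrow> f i \<in> tangent_space A p" and w: "w \<in> tangent_space A p"
  shows "B (\<lambda>d. \<Sum>i\<in>I. r i *\<^sub>R f i d) w = (\<Sum>i\<in>I. r i * B (f i) w)"
  using I f
proof (induction I rule: finite_induct)
  case empty
  have z: "(\<lambda>c. 0) \<in> tangent_space A p" by (simp add: tangent_space_iff)
  show ?case using inner_scale_left[OF B z w, of 0] by simp
next
  case (insert j I)
  let ?u = "\<lambda>c. r j *\<^sub>R f j c" and ?v = "\<lambda>d. \<Sum>i\<in>I. r i *\<^sub>R f i d"
  have u: "?u \<in> tangent_space A p"
    using tangent_space_sum[of "{j}" f p r] insert.prems by simp
  have v: "?v \<in> tangent_space A p" by (rule tangent_space_sum) (use insert.prems in simp)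
  have "B (\<lambda>d. \<Sum>i\<in>insert j I. r i *\<^sub>R f i d) w = B (\<lambda>c. ?u c + ?v c) w"
    using insert.hyps by simp
  also have "\<dots> = B ?u w + B ?v w"
    by (rule inner_add_left[OF B u v w])
  also have "B ?u w = r j * B (f j) w"
    by (rule inner_scale_left[OF B _ w]) (use insert.prems in simp)
  finally show ?case using insert by simp
qed

lemma g_inner: "p \<in> topspace M \<Longrightarrow> inner_product_on_tangent A p (g p)"
  using met by (simp add: riemannian_metric_def)

lemma g_sym: "p \<in> topspace M \<Longrightarrow> u \<in> tangent_space A p \<Longrightarrow> v \<in> tangent_space A p \<Longrightarrow> g p u v = g p v u"
  using g_inner unfolding inner_product_on_tangent_def by blast

lemma charts_at_topspace: "c \<in> charts_at A p \<Longrightarrow> p \<in> topspace M"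
  using dom_sub charts_at_iff by blast

lemma g_coords:
  assumes c: "c \<in> charts_at A p" and u: "u \<in> tangent_space A p" and v: "v \<in> tangent_space A p"
  shows "g p u v = u c \<bullet> (tensor_comp A c g p *v v c)"
proof -
  have p: "p \<in> topspace M" by (rule charts_at_topspace[OF c])
  let ?e = "coord_vec A c p"
  have e: "?e i \<in> tangent_space A p" for i by (rule coord_vec_tangent[OF c])
  have "g p u v = g p (\<lambda>d. \<Sum>i\<in>UNIV. u c $ i *\<^sub>R ?e i d) v" using tangent_expand[OF u c] by simp
  also have "\<dots> = (\<Sum>i\<in>UNIV. u c $ i * g p (?e i) v)"
    by (rule inner_sum_left[OF g_inner[OF p] _ _ v]) (auto intro: e)
  also have "\<dots> = (\<Sum>i\<in>UNIV. u c $ i * (\<Sum>j\<in>UNIV. v c $ j * g p (?e i) (?e j)))"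
  proof (intro sum.cong refl arg_cong2[where f="(*)"])
    fix i
    have "g p (?e i) v = g p (\<lambda>d. \<Sum>j\<in>UNIV. v c $ j *\<^sub>R ?e j d) (?e i)"
      using tangent_expand[OF v c] g_sym[OF p e v] by simp
    also have "\<dots> = (\<Sum>j\<in>UNIV. v c $ j * g p (?e j) (?e i))"
      by (rule inner_sum_left[OF g_inner[OF p] _ _ e]) (auto intro: e)
    finally show "g p (?e i) v = (\<Sum>j\<in>UNIV. v c $ j * g p (?e i) (?e j))"
      by (simp add: g_sym[OF p e e, of i])
  qed
  finally show ?thesis
    by (simp add: inner_vec_def matrix_vector_nth tensor_comp_def mult.commute)
qed

abbreviation "L c \<equiv> local_metric A g c"

lemma L_coords: "c \<in> charts_at A p \<Longrightarrow> L c (coords c p) = tensor_comp A c g p"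
  by (simp add: local_metric_def inv_coords charts_at_iff)

lemma inv_charts_at: "c \<in> A \<Longrightarrow> x \<in> chart_image c \<Longrightarrow> c \<in> charts_at A (chart_inv c x)"
  using inv_in_dom by (simp add: charts_at_iff)

lemma patch: "c \<in> A \<Longrightarrow> metric_patch (chart_image c) (L c)"
proof
  assume c: "c \<in> A"
  show "open (chart_image c)" by (rule image_open[OF c])
  show "smooth_on (chart_image c) (L c)"
    using met c unfolding riemannian_metric_def local_metric_def[abs_def] by blast
  fix x assume x: "x \<in> chart_image c"
  let ?p = "chart_inv c x"
  have cp: "c \<in> charts_at A ?p" by (rule inv_charts_at[OF c x])
  have p: "?p \<in> topspace M" by (rule charts_at_topspace[OF cp])
  show "transpose (L c x) = L c x"
    using g_sym[OF p coord_vec_tangent[OF cp] coord_vec_tangent[OF cp]]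
    by (simp add: local_metric_def tensor_comp_def transpose_def vec_eq_iff)
  fix v :: "real^'n" assume v: "v \<noteq> 0"
  \<comment> \<open>The tangent vector whose components in \<open>c\<close> are \<open>v\<close>;
    positivity on the tangent space then yields positivity of the matrix.\<close>
  let ?u = "\<lambda>d. \<Sum>i\<in>UNIV. v $ i *\<^sub>R coord_vec A c ?p i d"
  have u: "?u \<in> tangent_space A ?p"
    by (rule tangent_space_sum) (rule coord_vec_tangent[OF cp])
  have uc: "?u c = v" using vec_eq_sum_axis[of v] by (simp add: coord_vec_self[OF cp])
  then have "?u \<noteq> (\<lambda>c. 0)" using v by (metis (no_types))
  then have "0 < g ?p ?u ?u"
    using g_inner[OF p] u unfolding inner_product_on_tangent_def by blast
  then show "0 < v \<bullet> (L c x *v v)"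
    using g_coords[OF cp u u] uc by (simp add: local_metric_def)
qed

lemma tensor_comp_change:
  assumes c: "c \<in> charts_at A p" and d: "d \<in> charts_at A p"
  shows "tensor_comp A c g p = transpose (jac c d p) ** tensor_comp A d g p ** jac c d p"
proof (subst vec_eq_iff, intro allI, subst vec_eq_iff, intro allI)
  fix i j
  have "tensor_comp A c g p $ i $ j = (jac c d p *v axis i 1) \<bullet> (tensor_comp A d g p *v (jac c d p *v axis j 1))"
    using g_coords[OF d coord_vec_tangent[OF c] coord_vec_tangent[OF c]]
    by (simp add: tensor_comp_def[of A c] coord_vec_eq[OF c d])
  also have "\<dots> = axis i 1 \<bullet> ((transpose (jac c d p) ** tensor_comp A d g p ** jac c d p) *v axis j 1)"
    by (simp add: matrix_vector_mul_assoc[symmetric] dot_lmul_matrix[symmetric] transpose_matrix_vector dot_matrix_vector_mul)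
       (metis dot_lmul_matrix inner_commute vector_transpose_matrix)
  finally show "tensor_comp A c g p $ i $ j = (transpose (jac c d p) ** tensor_comp A d g p ** jac c d p) $ i $ j"
    by (simp add: inner_axis' matrix_vector_mult_axis_nth)
qed

text \<open>The bridge from charts to coordinates: every transformation law of the locale becomes
  available for any pair of charts.\<close>

lemma patch_change:
  assumes c: "c \<in> A" and d: "d \<in> A"
  shows "patch_change (overlap c d) (L c) (chart_image d) (L d) (transition c d)"
proof -
  have sub: "overlap c d \<subseteq> chart_image c" using coords_in[of _ c] by auto
  interpret S: metric_patch "overlap c d" "L c"
    by (rule metric_patch_subset[OF patch[OF c] open_overlap[OF c d] sub])
  interpret T: metric_patch "chart_image d" "L d" by (rule patch[OF d])
  show ?thesis
  proof
    show "smooth_on (overlap c d) (transition c d)" by (rule smooth_transition[OF c d])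
    fix x assume "x \<in> overlap c d"
    then obtain p where p: "x = coords c p" "p \<in> chart_dom c" "p \<in> chart_dom d" by auto
    show "transition c d x \<in> chart_image d"
      using p coords_in by (simp add: transition_coords c)
    show "L c x = transpose (matrix (frechet_derivative (transition c d) (at x))) ** L d (transition c d x) **
        matrix (frechet_derivative (transition c d) (at x))"
      using tensor_comp_change[of c p d] p c d
      by (simp add: jac_def[symmetric] L_coords charts_at_iff transition_coords)
  qed
qed

lemma jac_eq_P: "c \<in> A \<Longrightarrow> d \<in> A \<Longrightarrow> patch_change.P (transition c d) (coords c p) = jac c d p"
  by (simp add: patch_change.P_def[OF patch_change] jac_def)

end

lemma inner_conjugate:
  fixes P N :: "real^'n^'n"
  shows "(P *v a) \<bullet> (N *v (P *v b)) = a \<bullet> ((transpose P ** N ** P) *v b)"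
proof -
  have "(P *v a) \<bullet> w = a \<bullet> (transpose P *v w)" for w
    by (metis dot_lmul_matrix inner_commute matrix_vector_mul_assoc vector_transpose_matrix transpose_transpose)
  then show ?thesis by (simp only: matrix_vector_mul_assoc matrix_mul_assoc)
qed

lemma axis_inner_matrix: "axis i 1 \<bullet> ((N::real^'n^'n) *v axis j 1) = N $ i $ j"
  by (simp add: inner_axis' matrix_vector_mult_axis_nth)

text \<open>Induction by symmetric Gaussian elimination: the Schur complement of a positive semidefinite
  form is positive semidefinite.\<close>

lemma sum_psd_product_nonneg:
  fixes q h :: "'i \<Rightarrow> 'i \<Rightarrow> real"
  assumes S: "finite S" and sym: "\<And>i j. q i j = q j i"
    and q: "\<And>v. 0 \<le> (\<Sum>i\<in>S. \<Sum>j\<in>S. v i * v j * q i j)"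
    and h: "\<And>v. 0 \<le> (\<Sum>i\<in>S. \<Sum>j\<in>S. v i * v j * h i j)"
  shows "0 \<le> (\<Sum>i\<in>S. \<Sum>j\<in>S. q i j * h i j)"
  using S sym q h
proof (induction S arbitrary: q rule: finite_induct)
  case (insert k S)
  have split: "(\<Sum>i\<in>insert k S. \<Sum>j\<in>insert k S. F i j)
      = F k k + (\<Sum>j\<in>S. F k j) + (\<Sum>i\<in>S. F i k) + (\<Sum>i\<in>S. \<Sum>j\<in>S. F i j)" for F :: "'i \<Rightarrow> 'i \<Rightarrow> real"
    using insert.hyps by (simp add: sum.distrib)
  have restrict: "(\<Sum>i\<in>insert k S. \<Sum>j\<in>insert k S. (v(k := r)) i * (v(k := r)) j * F i j)
      = r * r * F k k + r * (\<Sum>j\<in>S. v j * F k j) + r * (\<Sum>i\<in>S. v i * F i k)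
        + (\<Sum>i\<in>S. \<Sum>j\<in>S. v i * v j * F i j)" for v r and F :: "'i \<Rightarrow> 'i \<Rightarrow> real"
  proof -
    have *: "(\<Sum>j\<in>S. (v(k := r)) j * z j) = (\<Sum>j\<in>S. v j * z j)" for z :: "'i \<Rightarrow> real"
      using insert.hyps by (intro sum.cong) auto
    have "(\<Sum>i\<in>S. \<Sum>j\<in>S. (v(k := r)) i * (v(k := r)) j * F i j) = (\<Sum>i\<in>S. \<Sum>j\<in>S. v i * v j * F i j)"
      using insert.hyps by (intro sum.cong refl) auto
    moreover have "(\<Sum>j\<in>S. (v(k := r)) k * (v(k := r)) j * F k j) = r * (\<Sum>j\<in>S. v j * F k j)"
      using *[of "F k"] by (simp add: sum_distrib_left[symmetric] mult.assoc)
    moreover have "(\<Sum>i\<in>S. (v(k := r)) i * (v(k := r)) k * F i k) = r * (\<Sum>i\<in>S. v i * F i k)"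
      using *[of "\<lambda>i. F i k"] by (simp add: sum_distrib_left[symmetric] mult.assoc mult.left_commute[of _ r])
    ultimately show ?thesis unfolding split by simp
  qed
  let ?a = "q k k"
  \<comment> \<open>The Schur complement of the entry at \<open>k\<close>. For \<open>?a = 0\<close>
    the quotient is \<open>0\<close> and \<open>q'\<close> is \<open>q\<close>, whose row and column
    at \<open>k\<close> vanish by \<open>zero\<close>.\<close>
  define q' where "q' i j = q i j - q i k * q j k / ?a" for i j
  have a: "0 \<le> ?a"
  proof -
    have "0 \<le> (\<Sum>i\<in>insert k S. \<Sum>j\<in>insert k S. ((\<lambda>_. 0)(k := 1)) i * ((\<lambda>_. 0)(k := 1)) j * q i j)"
      by (rule insert.prems(2))
    then show ?thesis unfolding restrict by simp
  qed
  have zero: "q k j = 0" if a0: "?a = 0" and j: "j \<in> S" for j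
  proof (rule ccontr)
    assume nz: "q k j \<noteq> 0"
    \<comment> \<open>On the vector with entry 1 at \<open>j\<close> and \<open>r\<close> at
      \<open>k\<close> the form takes the value \<open>-1\<close>.\<close>
    define r where "r = - (q j j + 1) / (2 * q k j)"
    let ?v = "(\<lambda>i. if i = j then 1 else 0)(k := r)"
    have "0 \<le> (\<Sum>i\<in>insert k S. \<Sum>l\<in>insert k S. ?v i * ?v l * q i l)"
      by (rule insert.prems(2))
    moreover have "(\<Sum>i\<in>S. (if i = j then 1 else 0) * z i) = z j" for z :: "'i \<Rightarrow> real"
      using j insert.hyps by (simp add: if_distrib[of "\<lambda>x. x * _"] cong: if_cong)
    ultimately have "0 \<le> r * q k j + r * q j k + q j j"
      using a0 unfolding restrict by (simp add: mult.assoc sum_distrib_left[symmetric])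
    also have "\<dots> = -1" using nz insert.prems(1)[of j k] by (simp add: r_def field_simps)
    finally show False by simp
  qed
  have k0: "q' k j = 0" "q' j k = 0" if "j \<in> insert k S" for j
    using that zero insert.prems(1)[of j k] by (cases "?a = 0"; auto simp: q'_def)+
  have psd: "0 \<le> (\<Sum>i\<in>S. \<Sum>j\<in>S. v i * v j * q' i j)" for v
  proof -
    let ?b = "\<Sum>i\<in>S. v i * q i k"
    have bk: "(\<Sum>j\<in>S. v j * q k j) = ?b" by (simp add: insert.prems(1)[of k])
    have "?b * ?b / ?a = (\<Sum>i\<in>S. \<Sum>j\<in>S. v i * v j * (q i k * q j k / ?a))"
      by (simp add: sum_product sum_divide_distrib mult_ac)
    then have "(\<Sum>i\<in>S. \<Sum>j\<in>S. v i * v j * q' i j) = (\<Sum>i\<in>S. \<Sum>j\<in>S. v i * v j * q i j) - ?b * ?b / ?a"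
      by (simp add: q'_def right_diff_distrib sum_subtractf)
    \<comment> \<open>Completing the square: for positive \<open>?a\<close> the entry
      \<open>- ?b / ?a\<close> at \<open>k\<close> minimizes the form on \<open>insert k S\<close>.
      For \<open>?a = 0\<close> it is \<open>0\<close>.\<close>
    also have "\<dots> = (\<Sum>i\<in>insert k S. \<Sum>j\<in>insert k S. (v(k := - ?b / ?a)) i * (v(k := - ?b / ?a)) j * q i j)"
      unfolding restrict bk by (cases "?a = 0") (simp_all add: field_simps)
    also have "0 \<le> \<dots>" by (rule insert.prems(2))
    finally show ?thesis .
  qed
  have hS: "0 \<le> (\<Sum>i\<in>S. \<Sum>j\<in>S. v i * v j * h i j)" for v
  proof -
    have "0 \<le> (\<Sum>i\<in>insert k S. \<Sum>j\<in>insert k S. (v(k := 0)) i * (v(k := 0)) j * h i j)"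
      by (rule insert.prems(3))
    then show ?thesis unfolding restrict by simp
  qed
  have "0 \<le> (\<Sum>i\<in>S. \<Sum>j\<in>S. q' i j * h i j)"
    by (rule insert.IH[OF _ psd hS]) (use insert.prems(1) in \<open>simp add: q'_def mult.commute\<close>)
  also have "\<dots> = (\<Sum>i\<in>insert k S. \<Sum>j\<in>insert k S. q' i j * h i j)"
    unfolding split using k0 by simp
  finally have "0 \<le> (\<Sum>i\<in>insert k S. \<Sum>j\<in>insert k S. q' i j * h i j)" .
  moreover have "0 \<le> (\<Sum>i\<in>insert k S. \<Sum>j\<in>insert k S. q i k * q j k * h i j) / ?a"
    using a insert.prems(3)[of "\<lambda>i. q i k"] by (intro divide_nonneg_nonneg)
  \<comment> \<open>\<open>q\<close> is its Schur complement plus a form of rank at most one, and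
    the latter pairs with \<open>h\<close> to a value of the form \<open>h\<close>.\<close>
  moreover have "(\<Sum>i\<in>insert k S. \<Sum>j\<in>insert k S. q i j * h i j)
     = (\<Sum>i\<in>insert k S. \<Sum>j\<in>insert k S. q' i j * h i j) + (\<Sum>i\<in>insert k S. \<Sum>j\<in>insert k S. q i k * q j k * h i j) / ?a"
    by (simp only: sum_divide_distrib sum.distrib[symmetric]) (simp add: q'_def left_diff_distrib)
  ultimately show ?case by linarith
qed simp

context metric_patch
begin

text \<open>\<open>tensor_norm\<close> takes the square root of this trace and the theorem squares
  it, so the sign matters. The trace pairs two positive semidefinite matrices, \<open>?Q\<close> and
  \<open>H x\<close>.\<close>

lemma norm_nonneg:
  assumes x: "x \<in> U"
  shows "0 \<le> trace (transpose T ** H x ** T ** H x)"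
proof -
  have Hpsd: "0 \<le> w \<bullet> (H x *v w)" for w
  proof (cases "H x *v w = 0")
    case False
    have "0 < (H x *v w) \<bullet> (G x *v (H x *v w))" by (rule pos_G[OF x False])
    then show ?thesis by (simp add: matrix_vector_mul_assoc G_H x inner_commute)
  qed simp
  have e: "v \<bullet> (N *v v) = (\<Sum>i\<in>UNIV. \<Sum>j\<in>UNIV. v $ i * v $ j * N $ i $ j)" for v and N :: "real^'n^'n"
    by (simp add: inner_vec_def matrix_vector_nth sum_distrib_left mult_ac)
  let ?Q = "transpose T ** H x ** T"
  have "0 \<le> (\<Sum>i\<in>UNIV. \<Sum>j\<in>UNIV. ?Q $ i $ j * H x $ i $ j)"
  proof (rule sum_psd_product_nonneg)
    have "transpose ?Q = ?Q" by (simp add: matrix_transpose_mul sym_H x matrix_mul_assoc)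
    then show "?Q $ i $ j = ?Q $ j $ i" for i j by (metis transpose_nth)
    show "0 \<le> (\<Sum>i\<in>UNIV. \<Sum>j\<in>UNIV. v i * v j * ?Q $ i $ j)" for v
      using Hpsd[of "T *v vec_lambda v"] e[of "vec_lambda v" ?Q] inner_conjugate[of T "vec_lambda v" "H x" "vec_lambda v"]
      by simp
    show "0 \<le> (\<Sum>i\<in>UNIV. \<Sum>j\<in>UNIV. v i * v j * H x $ i $ j)" for v
      using Hpsd[of "vec_lambda v"] e[of "vec_lambda v" "H x"] by simp
  qed simp
  also have "\<dots> = trace (?Q ** transpose (H x))"
    by (simp only: trace_def matrix_mult_nth transpose_nth)
  finally show ?thesis by (simp add: sym_H x)
qed

end

section \<open>Coordinate expressions in an arbitrary chart\<close>

context riem_manifold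
begin

lemma overlap_charts:
  assumes "c \<in> charts_at A p" "d \<in> charts_at A p"
  shows "c \<in> A" "d \<in> A" "coords c p \<in> overlap c d" "transition c d (coords c p) = coords d p"
  using assms by (auto simp: charts_at_iff transition_coords)

text \<open>\<open>ricci\<close> evaluates in the chart selected by \<open>chart_at\<close>;
  \<open>ricci_change\<close> and the change of tangent components move the value to any chart
  around the point.\<close>

lemma ricci_coords:
  assumes c: "c \<in> charts_at A p" and u: "u \<in> tangent_space A p" and v: "v \<in> tangent_space A p"
  shows "ricci A g p u v = u c \<bullet> (ricci_matrix (L c) (coords c p) *v v c)"
proof -
  define d where "d = chart_at A p"
  have d: "d \<in> charts_at A p" unfolding d_def by (rule chart_at[OF charts_at_topspace[OF c]])
  note o = overlap_charts[OF c d]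
  interpret patch_change "overlap c d" "L c" "chart_image d" "L d" "transition c d"
    by (rule patch_change[OF o(1,2)])
  have "ricci A g p u v = u d \<bullet> (ricci_matrix (L d) (coords d p) *v v d)"
    by (simp add: ricci_def d_def Let_def)
  also have "\<dots> = u c \<bullet> (ricci_matrix (L c) (coords c p) *v v c)"
    unfolding ricci_change[OF o(3)] jac_eq_P[OF o(1,2)] o(4) tangent_change[OF u c d] tangent_change[OF v c d]
    by (rule inner_conjugate)
  finally show ?thesis .
qed

lemma comp_ricci: "c \<in> charts_at A p \<Longrightarrow> tensor_comp A c (ricci A g) p = ricci_matrix (L c) (coords c p)"
  by (simp add: tensor_comp_def vec_eq_iff ricci_coords coord_vec_tangent coord_vec_self axis_inner_matrix)

lemma vector_field_smooth:
  assumes "smooth_vector_field M A X" "c \<in> A"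
  shows "smooth_on (chart_image c) (\<lambda>x. X (chart_inv c x) c)"
  using assms by (simp add: smooth_vector_field_def)

lemma vector_field_tangent:
  assumes "smooth_vector_field M A X" "p \<in> topspace M"
  shows "X p \<in> tangent_space A p"
  using assms by (simp add: smooth_vector_field_def)

lemma lie_coords:
  assumes X: "smooth_vector_field M A X"
    and c: "c \<in> charts_at A p" and u: "u \<in> tangent_space A p" and v: "v \<in> tangent_space A p"
  shows "lie_derivative A X g p u v = u c \<bullet> (lie_matrix (L c) (\<lambda>x. X (chart_inv c x) c) (coords c p) *v v c)"
proof -
  define d where "d = chart_at A p"
  have d: "d \<in> charts_at A p" unfolding d_def by (rule chart_at[OF charts_at_topspace[OF c]])
  note o = overlap_charts[OF c d]
  interpret patch_change "overlap c d" "L c" "chart_image d" "L d" "transition c d"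
    by (rule patch_change[OF o(1,2)])
  have diff: "(\<lambda>x. X (chart_inv c x) c) differentiable (at (coords c p))" if "c \<in> charts_at A p" for c
    using vector_field_smooth[OF X, of c] that coords_in[of p c]
    by (intro Ck_on_differentiable[where k=0 and U="chart_image c"]) (auto simp: smooth_on_def charts_at_iff simp del: Ck_on.simps)
  have rel: "X (chart_inv d (transition c d y)) d = P y *v X (chart_inv c y) c" if "y \<in> overlap c d" for y
  proof -
    obtain q where q: "y = coords c q" "q \<in> chart_dom c" "q \<in> chart_dom d" using \<open>y \<in> overlap c d\<close> by auto
    then have cq: "c \<in> charts_at A q" and dq: "d \<in> charts_at A q" using o by (simp_all add: charts_at_iff)
    show ?thesis
      using tangent_change[OF vector_field_tangent[OF X charts_at_topspace[OF cq]] cq dq] q o(1,2)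
      by (simp add: transition_coords inv_coords jac_eq_P)
  qed
  have "lie_matrix (L c) (\<lambda>x. X (chart_inv c x) c) (coords c p)
     = transpose (P (coords c p)) ** lie_matrix (L d) (\<lambda>x. X (chart_inv d x) d) (transition c d (coords c p)) ** P (coords c p)"
    by (rule lie_change[OF o(3) diff[OF c] _ rel]) (simp only: o(4) diff[OF d])
  then have ch: "lie_matrix (L c) (\<lambda>x. X (chart_inv c x) c) (coords c p)
     = transpose (jac c d p) ** lie_matrix (L d) (\<lambda>x. X (chart_inv d x) d) (coords d p) ** jac c d p"
    by (simp only: jac_eq_P[OF o(1,2)] o(4))
  have "lie_derivative A X g p u v = u d \<bullet> (lie_matrix (L d) (\<lambda>x. X (chart_inv d x) d) (coords d p) *v v d)"
    by (simp add: lie_derivative_def d_def Let_def)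
  also have "\<dots> = u c \<bullet> (lie_matrix (L c) (\<lambda>x. X (chart_inv c x) c) (coords c p) *v v c)"
    unfolding ch tangent_change[OF u c d] tangent_change[OF v c d]
    by (rule inner_conjugate)
  finally show ?thesis .
qed

lemma scalar_coords:
  assumes c: "c \<in> charts_at A p"
  shows "scalar_curvature A g p = metric_patch.scal (L c) (coords c p)"
proof -
  define d where "d = chart_at A p"
  have d: "d \<in> charts_at A p" unfolding d_def by (rule chart_at[OF charts_at_topspace[OF c]])
  note o = overlap_charts[OF c d]
  interpret patch_change "overlap c d" "L c" "chart_image d" "L d" "transition c d"
    by (rule patch_change[OF o(1,2)])
  have "scalar_curvature A g p = T.scal (coords d p)"
    unfolding scalar_curvature_def T.scal_def Let_def d_def[symmetric] comp_ricci[OF d] L_coords[OF d] ..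
  then show ?thesis by (simp add: scal_change[OF o(3)] o(4))
qed

definition traceless :: "('a, 'n) tensor2" where
  "traceless q u v = ricci A g q u v - scalar_curvature A g q / real CARD('n) * g q u v"

lemma comp_traceless:
  assumes c: "c \<in> charts_at A p"
  shows "tensor_comp A c traceless p = metric_patch.tfric (L c) (coords c p)"
proof -
  interpret metric_patch "chart_image c" "L c" using patch c by (simp add: charts_at_iff)
  have "tensor_comp A c traceless p = tensor_comp A c (ricci A g) p - (scalar_curvature A g p / real CARD('n)) *\<^sub>R tensor_comp A c g p"
    by (simp add: tensor_comp_def traceless_def vec_eq_iff)
  then show ?thesis by (simp add: tfric_def comp_ricci[OF c] scalar_coords[OF c] L_coords[OF c])
qed

text \<open>The squared norm of E in the trace form of \<open>norm_eq_trace\<close>, which is what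
  \<open>divergence_of_soliton_field\<close> produces.\<close>

definition norm_chart :: "('a, 'n) chart \<Rightarrow> real^'n \<Rightarrow> real" where
  "norm_chart c x = trace (transpose (metric_patch.tfric (L c) x) ** matrix_inv (L c x) ** metric_patch.tfric (L c) x ** matrix_inv (L c x))"

lemma norm_coords:
  assumes c: "c \<in> charts_at A p"
  shows "(tensor_norm A g traceless p)\<^sup>2 = norm_chart c (coords c p)"
proof -
  define d where "d = chart_at A p"
  have d: "d \<in> charts_at A p" unfolding d_def by (rule chart_at[OF charts_at_topspace[OF c]])
  note o = overlap_charts[OF c d]
  interpret patch_change "overlap c d" "L c" "chart_image d" "L d" "transition c d"
    by (rule patch_change[OF o(1,2)])
  have x: "coords d p \<in> chart_image d" using \<phi>_in[OF o(3)] by (simp add: o(4))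
  have "tensor_norm A g traceless p = sqrt (norm_chart d (coords d p))"
    unfolding tensor_norm_def Let_def d_def[symmetric] comp_traceless[OF d] L_coords[OF d, symmetric] T.norm_eq_trace[OF x]
      norm_chart_def ..
  moreover have "0 \<le> norm_chart d (coords d p)"
    unfolding norm_chart_def by (rule T.norm_nonneg[OF x])
  ultimately have "(tensor_norm A g traceless p)\<^sup>2 = norm_chart d (coords d p)" by simp
  then show ?thesis using norm_change[OF o(3)] by (simp add: norm_chart_def o(4))
qed

lemma differential_coords:
  assumes c: "c \<in> charts_at A p" and v: "v \<in> tangent_space A p"
    and f: "\<And>d. d \<in> charts_at A p \<Longrightarrow> (f \<circ> chart_inv d) differentiable (at (coords d p))"
  shows "differential A f p v = frechet_derivative (f \<circ> chart_inv c) (at (coords c p)) (v c)"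
proof -
  define d where "d = chart_at A p"
  have d: "d \<in> charts_at A p" unfolding d_def by (rule chart_at[OF charts_at_topspace[OF c]])
  note o = overlap_charts[OF c d]
  have p: "p \<in> chart_dom c" "p \<in> chart_dom d" using c d by (simp_all add: charts_at_iff)
  have "frechet_derivative (f \<circ> chart_inv c) (at (coords c p))
     = frechet_derivative (\<lambda>x. (f \<circ> chart_inv d) (transition c d x)) (at (coords c p))"
    by (rule frechet_derivative_cong_open[OF open_overlap[OF o(1,2)] o(3)])
       (auto simp: inv_coords transition_coords o(1,2))
  then have "frechet_derivative (f \<circ> chart_inv c) (at (coords c p)) (v c)
     = frechet_derivative (f \<circ> chart_inv d) (at (coords d p)) (jac c d p *v v c)"
    using frechet_derivative_compose[OF transition_differentiable[OF o(1,2) p], of "f \<circ> chart_inv d" "v c"] f[OF d]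
    by (simp only: o(4) frechet_transition[OF o(1,2) p])
  then show ?thesis
    by (simp add: differential_def Let_def d_def[symmetric] tangent_change[OF v c d])
qed

text \<open>The definite description \<open>grad\<close> is resolved here: raising the index of the
  differential gives a candidate, and testing against coordinate vectors shows that it is
  unique.\<close>

lemma g_grad:
  assumes p: "p \<in> topspace M" and w: "w \<in> tangent_space A p"
    and f: "\<And>d. d \<in> charts_at A p \<Longrightarrow> (f \<circ> chart_inv d) differentiable (at (coords d p))"
  shows "g p (grad A g f p) w = differential A f p w"
proof -
  obtain c where c: "c \<in> charts_at A p" using chart_at[OF p] by blast
  interpret metric_patch "chart_image c" "L c" using patch c by (simp add: charts_at_iff)
  have x: "coords c p \<in> chart_image c" using c coords_in[of p c] by (simp add: charts_at_iff)
  let ?x = "coords c p"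
  let ?d = "\<chi> i. pd i (f \<circ> chart_inv c) ?x"
  have df: "differential A f p w = ?d \<bullet> w c" if w: "w \<in> tangent_space A p" for w
  proof -
    have "differential A f p w = frechet_derivative (f \<circ> chart_inv c) (at ?x) (w c)"
      by (rule differential_coords[OF c w f])
    also have "\<dots> = (\<Sum>a\<in>UNIV. w c $ a *\<^sub>R pd a (f \<circ> chart_inv c) ?x)"
      by (rule frechet_derivative_pd[OF f[OF c]])
    finally show ?thesis by (simp add: inner_vec_def mult.commute)
  qed
  define v0 where "v0 = H ?x *v ?d"
  define v where "v = (\<lambda>d. \<Sum>i\<in>UNIV. v0 $ i *\<^sub>R coord_vec A c p i d)"
  have vt: "v \<in> tangent_space A p"
    unfolding v_def by (rule tangent_space_sum) (rule coord_vec_tangent[OF c])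
  have vc: "v c = v0"
    using vec_eq_sum_axis[of v0] by (simp add: v_def coord_vec_self[OF c])
  have Lx: "L c ?x = tensor_comp A c g p" by (rule L_coords[OF c])
  have sw: "a \<bullet> (L c ?x *v b) = (L c ?x *v a) \<bullet> b" for a b
    by (metis dot_lmul_matrix sym_G[OF x] transpose_matrix_vector)
  have v: "g p v w = differential A f p w" if w: "w \<in> tangent_space A p" for w
    unfolding g_coords[OF c vt w] df[OF w] vc Lx[symmetric] sw
    by (simp add: v0_def matrix_vector_mul_assoc G_H[OF x])
  have "grad A g f p = v"
    unfolding grad_def
  proof (rule the_equality)
    show "v \<in> tangent_space A p \<and> (\<forall>w\<in>tangent_space A p. g p v w = differential A f p w)"
      using vt v by blast
    fix u assume u: "u \<in> tangent_space A p \<and> (\<forall>w\<in>tangent_space A p. g p u w = differential A f p w)"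
    then have ut: "u \<in> tangent_space A p" by blast
    have eq: "g p u w = g p v w" if "w \<in> tangent_space A p" for w using u v that by simp
    have "(L c ?x *v u c) $ i = (L c ?x *v v c) $ i" for i
      using eq[OF coord_vec_tangent[OF c, of i]] g_coords[OF c ut coord_vec_tangent[OF c]] g_coords[OF c vt coord_vec_tangent[OF c]]
      by (simp add: Lx[symmetric] sw coord_vec_self[OF c] inner_axis)
    then have "L c ?x *v u c = L c ?x *v v c" by (simp add: vec_eq_iff)
    then have "H ?x *v (L c ?x *v u c) = H ?x *v (L c ?x *v v c)" by simp
    then have "u c = v c" by (simp add: matrix_vector_mul_assoc H_G[OF x])
    then show "u = v" using tangent_expand[OF ut c] tangent_expand[OF vt c] by simp
  qed
  then show ?thesis using v w by simp
qed

section \<open>The Riemannian volume\<close>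

abbreviation "borelM \<equiv> sigma (topspace M) {W. openin M W}"

lemma sets_borelM: "sets borelM = borel_sets_of M"
  unfolding borel_sets_of_def by (rule sets_measure_of) (auto dest: openin_subset)

lemma space_borelM: "space borelM = topspace M"
  by (rule space_measure_of) (auto dest: openin_subset)

lemma open_in_borelM: "openin M W \<Longrightarrow> W \<in> sets borelM"
  unfolding sets_borelM borel_sets_of_def by (rule sigma_sets.Basic) simp

lemma dom_in_borelM: "c \<in> A \<Longrightarrow> chart_dom c \<in> sets borelM"
  by (rule open_in_borelM[OF dom_open])

lemma measurable_chart_inv:
  assumes c: "c \<in> A"
  shows "chart_inv c \<in> measurable (restrict_space borel (chart_image c)) borelM"
proof (rule measurable_measure_of)
  show "{W. openin M W} \<subseteq> Pow (topspace M)" by (auto dest: openin_subset)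
  show "chart_inv c \<in> space (restrict_space borel (chart_image c)) \<rightarrow> topspace M"
    using inv_in_dom[of _ c] dom_sub[OF c] by (auto simp: space_restrict_space)
  fix W assume "W \<in> {W. openin M W}"
  then have o: "open (coords c ` (W \<inter> chart_dom c))"
    by (intro open_coords_image[OF c]) (auto intro: dom_open[OF c])
  have "chart_inv c -` W \<inter> space (restrict_space borel (chart_image c)) = coords c ` (W \<inter> chart_dom c)"
    using coords_preimage[OF c, of W] by (auto simp: space_restrict_space)
  moreover have "coords c ` (W \<inter> chart_dom c) \<subseteq> chart_image c" using coords_in[of _ c] by auto
  ultimately show "chart_inv c -` W \<inter> space (restrict_space borel (chart_image c)) \<in> sets (restrict_space borel (chart_image c))"
    using o image_open[OF c] by (simp add: sets_restrict_space_iff)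
qed

lemma coords_image_borel:
  assumes c: "c \<in> A" and B: "B \<in> sets borelM"
  shows "coords c ` (B \<inter> chart_dom c) \<in> sets borel"
proof -
  have "chart_inv c -` B \<inter> space (restrict_space borel (chart_image c)) \<in> sets (restrict_space borel (chart_image c))"
    by (rule measurable_sets[OF measurable_chart_inv[OF c] B])
  moreover have "chart_inv c -` B \<inter> space (restrict_space borel (chart_image c)) = coords c ` (B \<inter> chart_dom c)"
    using coords_preimage[OF c, of B] by (auto simp: space_restrict_space)
  ultimately show ?thesis using image_open[OF c] by (simp add: sets_restrict_space_iff)
qed

abbreviation "vdens c x \<equiv> sqrt (det (L c x))"

lemma continuous_vdens: "c \<in> A \<Longrightarrow> continuous_on (chart_image c) (vdens c)"
  using Ck_on_continuous[OF metric_patch.Ck_sqrt_det[OF patch]] .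

lemma vdens_measurable: "c \<in> A \<Longrightarrow> vdens c \<in> borel_measurable (restrict_space lborel (chart_image c))"
  using borel_measurable_continuous_on_restrict[OF continuous_vdens, of c]
  by (simp add: measurable_def space_restrict_space sets_restrict_space)

text \<open>The measure with which the volume has to agree on the domain of \<open>c\<close>, as a
  measure on all of \<open>M\<close> that vanishes off this domain.\<close>

definition vol :: "('a, 'n) chart \<Rightarrow> 'a measure" where
  "vol c = distr (density (restrict_space lborel (chart_image c)) (\<lambda>x. ennreal (vdens c x))) borelM (chart_inv c)"

lemma measurable_chart_inv': "c \<in> A \<Longrightarrow> chart_inv c \<in> measurable (density (restrict_space lborel (chart_image c)) h) borelM"
  using measurable_chart_inv[of c] by (simp add: measurable_def space_restrict_space sets_restrict_space)

lemma emeasure_vol: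
  assumes c: "c \<in> A" and B: "B \<in> sets borelM"
  shows "emeasure (vol c) B = (\<integral>\<^sup>+x. indicator (coords c ` (B \<inter> chart_dom c)) x * ennreal (vdens c x) \<partial>lborel)"
proof -
  let ?R = "restrict_space lborel (chart_image c)"
  let ?S = "coords c ` (B \<inter> chart_dom c)"
  have Ib: "chart_image c \<in> sets borel" using image_open[OF c] by simp
  have S: "?S \<in> sets ?R"
    using coords_image_borel[OF c B] coords_in[of _ c] Ib by (auto simp: sets_restrict_space_iff)
  have "emeasure (vol c) B = emeasure (density ?R (\<lambda>x. ennreal (vdens c x))) (chart_inv c -` B \<inter> space ?R)"
    unfolding vol_def using emeasure_distr[OF measurable_chart_inv'[OF c] B] by simp
  also have "chart_inv c -` B \<inter> space ?R = ?S"
    using coords_preimage[OF c, of B] by (auto simp: space_restrict_space)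
  also have "emeasure (density ?R (\<lambda>x. ennreal (vdens c x))) ?S = (\<integral>\<^sup>+x. ennreal (vdens c x) * indicator ?S x \<partial>?R)"
    by (rule emeasure_density[OF _ S]) (use vdens_measurable[OF c] in measurable)
  also have "\<dots> = (\<integral>\<^sup>+x. ennreal (vdens c x) * indicator ?S x * indicator (chart_image c) x \<partial>lborel)"
    using Ib by (simp add: nn_integral_restrict_space)
  also have "\<dots> = (\<integral>\<^sup>+x. indicator ?S x * ennreal (vdens c x) \<partial>lborel)"
    using coords_in[of _ c] by (intro nn_integral_cong) (auto simp: indicator_def)
  finally show ?thesis .
qed

text \<open>Substituting by the transition map produces the absolute Jacobian determinant, which
  \<open>sqrt_det_change\<close> absorbs into the density of the other chart.\<close>

lemma vol_compatible:
  assumes c: "c \<in> A" and d: "d \<in> A" and B: "B \<in> sets borelM" "B \<subseteq> chart_dom c" "B \<subseteq> chart_dom d"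
  shows "emeasure (vol c) B = emeasure (vol d) B"
proof -
  interpret patch_change "overlap c d" "L c" "chart_image d" "L d" "transition c d"
    by (rule patch_change[OF c d])
  let ?O = "overlap c d" and ?O' = "overlap d c" and ?\<phi> = "transition c d"
  let ?D = "\<lambda>x. \<bar>det (matrix (frechet_derivative ?\<phi> (at x)))\<bar>"
  have oO: "open ?O" "open ?O'" using open_overlap c d by auto
  have im: "?\<phi> ` ?O = ?O'"
  proof -
    have "?\<phi> ` ?O = (\<lambda>p. ?\<phi> (coords c p)) ` (chart_dom c \<inter> chart_dom d)" by (simp add: image_image)
    also have "\<dots> = coords d ` (chart_dom c \<inter> chart_dom d)"
      by (rule image_cong) (auto simp: transition_coords c)
    finally show ?thesis by (simp add: Int_commute)
  qed
  have inj: "inj_on ?\<phi> ?O"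
  proof (rule inj_onI)
    fix x y assume "x \<in> ?O" "y \<in> ?O" and eq: "?\<phi> x = ?\<phi> y"
    then obtain p q where p: "x = coords c p" "p \<in> chart_dom c" "p \<in> chart_dom d"
      and q: "y = coords c q" "q \<in> chart_dom c" "q \<in> chart_dom d" by auto
    then have "coords d p = coords d q" using eq c by (simp add: transition_coords)
    then have "p = q" using inj_coords[OF d] p q by (simp add: inj_on_def)
    then show "x = y" using p q by simp
  qed
  have cont: "continuous_on ?O (\<lambda>x. det (matrix (frechet_derivative ?\<phi> (at x))))"
    using Ck_on_continuous[OF Ck_on_det[OF oO(1) Ck_P]] by (simp add: P_def)
  note cov = restrict_lborel_change_of_variables[OF oO im inj diff_\<phi> cont]
  have \<phi>m: "?\<phi> \<in> measurable (density (restrict_space lborel ?O) (\<lambda>x. ennreal (?D x))) (restrict_space lborel ?O')"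
  proof -
    have "?\<phi> \<in> measurable (restrict_space borel ?O) (restrict_space borel ?O')"
      by (intro measurable_restrict_space2 borel_measurable_continuous_on_restrict Ck_on_continuous[OF Ck_\<phi>])
         (use im in \<open>auto simp: space_restrict_space\<close>)
    then show ?thesis by (simp add: measurable_def space_restrict_space sets_restrict_space)
  qed
  have Dm: "(\<lambda>x. ennreal (?D x)) \<in> borel_measurable (restrict_space lborel ?O)"
  proof -
    have "?D \<in> borel_measurable (restrict_space borel ?O)"
      by (intro borel_measurable_continuous_on_restrict continuous_intros cont)
    then have "?D \<in> borel_measurable (restrict_space lborel ?O)"
      by (simp add: measurable_def space_restrict_space sets_restrict_space)
    then show ?thesis by measurable
  qed
  have Bcd: "B \<inter> chart_dom c = B" "B \<inter> chart_dom d = B" using B by auto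
  let ?h = "\<lambda>y. indicator (coords d ` B) y * ennreal (vdens d y)"
  have sub: "coords d ` B \<subseteq> ?O'" "coords c ` B \<subseteq> ?O" using B by auto
  have hm: "?h \<in> borel_measurable (restrict_space lborel ?O')"
  proof -
    have "vdens d \<in> borel_measurable (restrict_space borel ?O')"
      by (rule borel_measurable_continuous_on_restrict[OF continuous_on_subset[OF continuous_vdens[OF d]]])
         (use coords_in[of _ d] in auto)
    then have [measurable]: "vdens d \<in> borel_measurable (restrict_space lborel ?O')"
      by (simp add: measurable_def space_restrict_space sets_restrict_space)
    have "coords d ` B \<in> sets borel" using coords_image_borel[OF d B(1)] by (simp add: Bcd)
    then have [measurable]: "coords d ` B \<in> sets (restrict_space lborel ?O')"
      using sub oO by (auto simp: sets_restrict_space_iff)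
    show ?thesis by measurable
  qed
  have "emeasure (vol d) B = (\<integral>\<^sup>+y. ?h y \<partial>lborel)"
    using emeasure_vol[OF d B(1)] by (simp add: Bcd)
  also have "\<dots> = (\<integral>\<^sup>+y. ?h y * indicator ?O' y \<partial>lborel)"
    using sub by (intro nn_integral_cong) (auto simp: indicator_def)
  also have "\<dots> = (\<integral>\<^sup>+y. ?h y \<partial>restrict_space lborel ?O')"
    using oO by (simp add: nn_integral_restrict_space)
  also have "\<dots> = (\<integral>\<^sup>+x. ?h (?\<phi> x) \<partial>density (restrict_space lborel ?O) (\<lambda>x. ennreal (?D x)))"
    using arg_cong[OF cov, of "\<lambda>N. nn_integral N ?h"] nn_integral_distr[OF \<phi>m, of ?h] hm by simp
  also have "\<dots> = (\<integral>\<^sup>+x. ennreal (?D x) * ?h (?\<phi> x) \<partial>restrict_space lborel ?O)"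
    by (rule nn_integral_density[OF Dm])
       (use measurable_compose[OF \<phi>m hm] in \<open>simp add: measurable_density_eq1\<close>)
  also have "\<dots> = (\<integral>\<^sup>+x. ennreal (?D x) * ?h (?\<phi> x) * indicator ?O x \<partial>lborel)"
    using oO by (simp add: nn_integral_restrict_space)
  also have "\<dots> = (\<integral>\<^sup>+x. indicator (coords c ` B) x * ennreal (vdens c x) \<partial>lborel)"
  proof (rule nn_integral_cong)
    fix x
    show "ennreal (?D x) * ?h (?\<phi> x) * indicator ?O x = indicator (coords c ` B) x * ennreal (vdens c x)"
    proof (cases "x \<in> ?O")
      case True
      then obtain p where p: "x = coords c p" "p \<in> chart_dom c" "p \<in> chart_dom d" by auto
      have "?\<phi> x \<in> coords d ` B \<longleftrightarrow> p \<in> B"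
        using p inj_coords[OF d] B by (auto simp: transition_coords c inj_on_image_mem_iff)
      moreover have "x \<in> coords c ` B \<longleftrightarrow> p \<in> B"
        using p inj_coords[OF c] B by (auto simp: inj_on_image_mem_iff)
      moreover have "ennreal (?D x) * ennreal (vdens d (?\<phi> x)) = ennreal (vdens c x)"
        using sqrt_det_change[OF True] by (simp add: P_def ennreal_mult'[symmetric])
      ultimately show ?thesis using True by (simp add: indicator_def)
    next
      case False
      then show ?thesis using sub by (auto simp: indicator_def)
    qed
  qed
  also have "\<dots> = emeasure (vol c) B" using emeasure_vol[OF c B(1)] by (simp add: Bcd)
  finally show ?thesis by simp
qed

lemma riemannian_volume_iff:
  "is_riemannian_volume M A g \<mu> \<longleftrightarrow> space \<mu> = topspace M \<and> sets \<mu> = sets borelM \<and>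
    (\<forall>c\<in>A. \<forall>B\<in>sets borelM. B \<subseteq> chart_dom c \<longrightarrow> emeasure \<mu> B = emeasure (vol c) B)"
proof -
  have "emeasure (vol c) B = (\<integral>\<^sup>+x. indicator (coords c ` B) x * ennreal (vdens c x) \<partial>lborel)"
    if "c \<in> A" "B \<in> sets borelM" "B \<subseteq> chart_dom c" for c B
    using emeasure_vol[OF that(1,2)] that(3) by (simp add: Int_absorb2)
  then show ?thesis unfolding is_riemannian_volume_def sets_borelM by auto
qed

end

section \<open>Existence and uniqueness of the volume on a compact manifold\<close>

locale compact_riem_manifold = riem_manifold M A g
  for M :: "'a topology" and A :: "('a, 'n::finite) chart set" and g :: "('a, 'n) tensor2" +
  assumes compact: "compact_space M"
begin

text \<open>The charts are numbered so that each domain can be diminished by those of its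
  predecessors.\<close>

lemma finite_atlas: "\<exists>f m. (\<forall>i<m::nat. f i \<in> A) \<and> (\<Union>i<m. chart_dom (f i)) = topspace M"
proof -
  have "\<forall>W\<in>chart_dom ` A. openin M W" "topspace M \<subseteq> \<Union>(chart_dom ` A)"
    using dom_open cover by auto
  then obtain F where F: "finite F" "F \<subseteq> chart_dom ` A" "topspace M \<subseteq> \<Union>F"
    using compact unfolding compact_space_alt by meson
  then obtain C where C: "C \<subseteq> A" "finite C" "F = chart_dom ` C"
    using finite_subset_image by metis
  obtain f and m :: nat where f: "C = f ` {i. i < m}"
    using C(2) finite_imp_nat_seg_image_inj_on by metis
  have "f i \<in> A" if "i < m" for i using f C that by auto
  moreover have "(\<Union>i<m. chart_dom (f i)) = topspace M"
  proof
    show "(\<Union>i<m. chart_dom (f i)) \<subseteq> topspace M" using calculation dom_sub by blast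
    show "topspace M \<subseteq> (\<Union>i<m. chart_dom (f i))" using F(3) C(3) f by auto
  qed
  ultimately show ?thesis by blast
qed

text \<open>\<open>M\<close> is cut into disjoint Borel pieces \<open>Q i\<close>, each inside one
  chart. On a piece the measure is forced, which gives uniqueness; summing the chart measures over
  the pieces gives existence, and \<open>vol_compatible\<close> makes the sum agree with every
  chart.\<close>

lemma ex1_riemannian_volume: "\<exists>!\<mu>. is_riemannian_volume M A g \<mu>"
proof -
  obtain f and m :: nat where f: "\<And>i. i < m \<Longrightarrow> f i \<in> A" and cov: "(\<Union>i<m. chart_dom (f i)) = topspace M"
    using finite_atlas by blast
  define Q where "Q i = chart_dom (f i) - (\<Union>j<i. chart_dom (f j))" for i
  have Qs: "Q i \<in> sets borelM" if "i < m" for i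
    unfolding Q_def using that f by (intro sets.Diff sets.finite_UN dom_in_borelM) auto
  have Qsub: "Q i \<subseteq> chart_dom (f i)" for i by (auto simp: Q_def)
  have Qdisj: "Q i \<inter> Q j = {}" if "i < j" for i j
    using that by (auto simp: Q_def)
  have disj: "disjoint_family_on (\<lambda>i. B \<inter> Q i) {..<m}" for B
    unfolding disjoint_family_on_def
  proof (intro ballI impI)
    fix i j :: nat assume "i \<noteq> j"
    then show "(B \<inter> Q i) \<inter> (B \<inter> Q j) = {}" using Qdisj[of i j] Qdisj[of j i] by (cases "i < j") auto
  qed
  have Qcov: "(\<Union>i<m. Q i) = topspace M"
  proof
    show "(\<Union>i<m. Q i) \<subseteq> topspace M" using Qsub cov by blast
    show "topspace M \<subseteq> (\<Union>i<m. Q i)"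
    proof
      fix p assume "p \<in> topspace M"
      then have ex: "\<exists>i. i < m \<and> p \<in> chart_dom (f i)" using cov by auto
      define i where "i = (LEAST i. i < m \<and> p \<in> chart_dom (f i))"
      have i: "i < m" "p \<in> chart_dom (f i)" using LeastI_ex[OF ex] by (auto simp: i_def)
      have "p \<notin> chart_dom (f j)" if "j < i" for j
        using not_less_Least[of j "\<lambda>i. i < m \<and> p \<in> chart_dom (f i)"] that i(1) by (auto simp: i_def)
      then show "p \<in> (\<Union>i<m. Q i)" using i by (auto simp: Q_def)
    qed
  qed
  have split: "B = (\<Union>i<m. B \<inter> Q i)" if "B \<in> sets borelM" for B
    using sets.sets_into_space[OF that] Qcov unfolding space_borelM by auto
  have additive: "emeasure \<nu> B = (\<Sum>i<m. emeasure \<nu> (B \<inter> Q i))" if B: "B \<in> sets borelM" and \<nu>: "sets \<nu> = sets borelM" for \<nu> B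
  proof -
    have "(\<Sum>i<m. emeasure \<nu> (B \<inter> Q i)) = emeasure \<nu> (\<Union>i<m. B \<inter> Q i)"
      using B Qs by (intro sum_emeasure disj) (auto simp: \<nu>)
    then show ?thesis using split[OF B] by simp
  qed
  let ?e = "\<lambda>B. \<Sum>i<m. emeasure (vol (f i)) (B \<inter> Q i)"
  define \<mu> where "\<mu> = measure_of (topspace M) (sets borelM) ?e"
  have sets_vol: "sets (vol c) = sets borelM" for c by (simp add: vol_def)
  have sets_\<mu>: "sets \<mu> = sets borelM" and space_\<mu>: "space \<mu> = topspace M"
    unfolding \<mu>_def using sets.sigma_sets_eq[of borelM] sets.space_closed[of borelM] space_borelM
    by (simp_all add: sets_measure_of space_measure_of)
  have em: "emeasure \<mu> B = ?e B" if B: "B \<in> sets borelM" for B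
  proof (rule emeasure_measure_of[OF \<mu>_def])
    show "sets borelM \<subseteq> Pow (topspace M)" using sets.space_closed[of borelM] space_borelM by simp
    show "B \<in> sets \<mu>" using B sets_\<mu> by simp
    show "positive (sets \<mu>) ?e" by (simp add: positive_def)
    show "countably_additive (sets \<mu>) ?e"
    proof (rule countably_additiveI)
      fix B :: "nat \<Rightarrow> 'a set" assume B: "range B \<subseteq> sets \<mu>" "disjoint_family B"
      have "(\<Sum>n. emeasure (vol (f i)) (B n \<inter> Q i)) = emeasure (vol (f i)) ((\<Union>n. B n) \<inter> Q i)" if "i < m" for i
      proof -
        have "(\<Sum>n. emeasure (vol (f i)) (B n \<inter> Q i)) = emeasure (vol (f i)) (\<Union>n. B n \<inter> Q i)"
          using B Qs[OF that] sets_\<mu> by (intro suminf_emeasure) (auto simp: sets_vol disjoint_family_on_def)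
        then show ?thesis by simp
      qed
      then show "(\<Sum>n. ?e (B n)) = ?e (\<Union>n. B n)"
        by (subst suminf_sum) auto
    qed
  qed
  have "is_riemannian_volume M A g \<mu>"
    unfolding riemannian_volume_iff
  proof (intro conjI ballI impI)
    fix c B assume c: "c \<in> A" and B: "B \<in> sets borelM" "B \<subseteq> chart_dom c"
    have "emeasure (vol (f i)) (B \<inter> Q i) = emeasure (vol c) (B \<inter> Q i)" if "i < m" for i
      using vol_compatible[OF f[OF that] c, of "B \<inter> Q i"] B Qs[OF that] Qsub[of i] by auto
    then show "emeasure \<mu> B = emeasure (vol c) B"
      using em[OF B(1)] additive[OF B(1) sets_vol] by simp
  qed (use sets_\<mu> space_\<mu> in auto)
  moreover have "\<nu> = \<mu>" if \<nu>: "is_riemannian_volume M A g \<nu>" for \<nu>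
  proof (rule measure_eqI)
    show s: "sets \<nu> = sets \<mu>" using \<nu> sets_\<mu> unfolding riemannian_volume_iff by simp
    fix B assume "B \<in> sets \<nu>"
    then have B: "B \<in> sets borelM" using s sets_\<mu> by simp
    have "emeasure \<nu> (B \<inter> Q i) = emeasure (vol (f i)) (B \<inter> Q i)" if "i < m" for i
    proof -
      have "B \<inter> Q i \<in> sets borelM" "B \<inter> Q i \<subseteq> chart_dom (f i)" using B Qs[OF that] Qsub[of i] by auto
      then show ?thesis using \<nu> f[OF that] unfolding riemannian_volume_iff by blast
    qed
    then show "emeasure \<nu> B = emeasure \<mu> B"
      using em[OF B] additive[OF B, of \<nu>] s sets_\<mu> by simp
  qed
  ultimately show ?thesis by blast
qed

abbreviation "V \<equiv> riemannian_volume M A g"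

lemma V: "sets V = sets borelM" "space V = topspace M"
    "c \<in> A \<Longrightarrow> B \<in> sets borelM \<Longrightarrow> B \<subseteq> chart_dom c \<Longrightarrow> emeasure V B = emeasure (vol c) B"
proof -
  have "is_riemannian_volume M A g V"
    unfolding riemannian_volume_def by (rule theI'[OF ex1_riemannian_volume])
  then show "sets V = sets borelM" "space V = topspace M"
    "c \<in> A \<Longrightarrow> B \<in> sets borelM \<Longrightarrow> B \<subseteq> chart_dom c \<Longrightarrow> emeasure V B = emeasure (vol c) B"
    unfolding riemannian_volume_iff by blast+
qed

text \<open>The density \<open>?ind\<close> cuts the volume down to \<open>vol c\<close>, and the
  rules for push-forward, density and restriction lead from there to coordinate space.\<close>

lemma integral_in_chart:
  fixes f :: "'a \<Rightarrow> real"
  assumes c: "c \<in> A" and f: "f \<in> borel_measurable borelM"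
    and supp: "\<And>p. p \<in> topspace M \<Longrightarrow> p \<notin> chart_dom c \<Longrightarrow> f p = 0"
  shows "integrable V f \<longleftrightarrow> integrable lborel (\<lambda>x. indicator (chart_image c) x *\<^sub>R (vdens c x * f (chart_inv c x)))" (is ?A)
    and "(\<integral>p. f p \<partial>V) = (\<integral>x. indicator (chart_image c) x *\<^sub>R (vdens c x * f (chart_inv c x)) \<partial>lborel)" (is ?B)
proof -
  let ?ind = "indicator (chart_dom c) :: 'a \<Rightarrow> real"
  let ?R = "restrict_space lborel (chart_image c)"
  have Ib: "chart_image c \<inter> space lborel \<in> sets lborel" using image_open[OF c] by simp
  have dV: "chart_dom c \<in> sets V" using dom_in_borelM[OF c] V by simp
  have fV: "f \<in> borel_measurable V" using f V(1) by (simp cong: measurable_cong_sets)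
  have vol_eq: "density V (\<lambda>p. ennreal (?ind p)) = vol c"
  proof (rule measure_eqI)
    show "sets (density V (\<lambda>p. ennreal (?ind p))) = sets (vol c)" by (simp add: vol_def V)
    fix B assume "B \<in> sets (density V (\<lambda>p. ennreal (?ind p)))"
    then have B: "B \<in> sets borelM" "B \<in> sets V" by (simp_all add: V)
    have "emeasure (density V (\<lambda>p. ennreal (?ind p))) B = (\<integral>\<^sup>+p. ennreal (?ind p) * indicator B p \<partial>V)"
      using dV B by (intro emeasure_density) auto
    also have "\<dots> = (\<integral>\<^sup>+p. indicator (B \<inter> chart_dom c) p \<partial>V)"
      by (intro nn_integral_cong) (auto simp: indicator_def)
    also have "\<dots> = emeasure V (B \<inter> chart_dom c)" using dV B by simp
    also have "\<dots> = emeasure (vol c) (B \<inter> chart_dom c)"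
      using B dom_in_borelM[OF c] by (intro V(3)[OF c]) auto
    also have "\<dots> = emeasure (vol c) B"
      using B dom_in_borelM[OF c] by (simp add: emeasure_vol[OF c] Int_assoc)
    finally show "emeasure (density V (\<lambda>p. ennreal (?ind p))) B = emeasure (vol c) B" .
  qed
  have fc: "f p = ?ind p *\<^sub>R f p" if "p \<in> space V" for p
    using supp that V(2) by (auto simp: indicator_def)
  have vm: "(\<lambda>x. f (chart_inv c x)) \<in> borel_measurable ?R"
    using measurable_compose[OF measurable_chart_inv[OF c] f]
    by (simp add: measurable_def space_restrict_space sets_restrict_space)
  have nonneg: "AE x in ?R. 0 \<le> vdens c x"
    using metric_patch.det_pos[OF patch[OF c]] by (intro AE_I2) (auto simp: space_restrict_space less_imp_le)
  have "integrable V f \<longleftrightarrow> integrable V (\<lambda>p. ?ind p *\<^sub>R f p)"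
    by (rule Bochner_Integration.integrable_cong) (use fc in auto)
  also have "\<dots> \<longleftrightarrow> integrable (density V (\<lambda>p. ennreal (?ind p))) f"
    using fV dV by (intro integrable_density[symmetric]) auto
  also have "\<dots> \<longleftrightarrow> integrable (density ?R (\<lambda>x. ennreal (vdens c x))) (\<lambda>x. f (chart_inv c x))"
    unfolding vol_eq vol_def by (rule integrable_distr_eq[OF measurable_chart_inv'[OF c] f])
  also have "\<dots> \<longleftrightarrow> integrable ?R (\<lambda>x. vdens c x *\<^sub>R f (chart_inv c x))"
    by (rule integrable_density[OF vm vdens_measurable[OF c] nonneg])
  also have "\<dots> \<longleftrightarrow> integrable lborel (\<lambda>x. indicator (chart_image c) x *\<^sub>R (vdens c x *\<^sub>R f (chart_inv c x)))"
    by (rule integrable_restrict_space[OF Ib])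
  finally show ?A by simp
  have "(\<integral>p. f p \<partial>V) = (\<integral>p. ?ind p *\<^sub>R f p \<partial>V)"
    by (rule Bochner_Integration.integral_cong) (use fc in auto)
  also have "\<dots> = (\<integral>p. f p \<partial>density V (\<lambda>p. ennreal (?ind p)))"
    using fV dV by (intro integral_density[symmetric]) auto
  also have "\<dots> = (\<integral>x. f (chart_inv c x) \<partial>density ?R (\<lambda>x. ennreal (vdens c x)))"
    unfolding vol_eq vol_def by (rule integral_distr[OF measurable_chart_inv'[OF c] f])
  also have "\<dots> = (\<integral>x. vdens c x *\<^sub>R f (chart_inv c x) \<partial>?R)"
    by (rule integral_density[OF vm vdens_measurable[OF c] nonneg])
  also have "\<dots> = (\<integral>x. indicator (chart_image c) x *\<^sub>R (vdens c x *\<^sub>R f (chart_inv c x)) \<partial>lborel)"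
    by (rule integral_restrict_space[OF Ib])
  finally show ?B by simp
qed

end

section \<open>Partitions of unity\<close>

lemma Ck_on_Un:
  assumes "open U" "open V"
  shows "Ck_on k U f \<Longrightarrow> Ck_on k V f \<Longrightarrow> Ck_on k (U \<union> V) f"
proof (induction k arbitrary: f)
  case 0
  then show ?case using assms by (simp add: continuous_on_open_Un)
qed auto

lemma has_real_derivative_max_square:
  "((\<lambda>t::real. (max 0 t)\<^sup>2) has_real_derivative 2 * max 0 t) (at t)"
proof -
  consider "t > 0" | "t < 0" | "t = 0" by linarith
  then show ?thesis
  proof cases
    case 1
    have "((\<lambda>t::real. t\<^sup>2) has_real_derivative 2 * max 0 t) (at t)"
      using 1 by (auto intro!: derivative_eq_intros)
    then show ?thesis
      by (rule has_field_derivative_transform_within_open[of _ _ _ "{0<..}"]) (use 1 in auto)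
  next
    case 2
    have "((\<lambda>t::real. 0) has_real_derivative 2 * max 0 t) (at t)"
      using 2 by (auto intro!: derivative_eq_intros)
    then show ?thesis
      by (rule has_field_derivative_transform_within_open[of _ _ _ "{..<0}"]) (use 2 in auto)
  next
    case 3
    have "((\<lambda>h::real. max 0 h) \<longlongrightarrow> max 0 0) (at 0)" by (intro tendsto_intros)
    moreover have "\<forall>\<^sub>F h in at (0::real). max 0 h = ((max 0 (0 + h))\<^sup>2 - (max 0 0)\<^sup>2) / h"
      by (auto simp: eventually_at_filter max_def power2_eq_square)
    ultimately have "((\<lambda>h::real. ((max 0 (0 + h))\<^sup>2 - (max 0 0)\<^sup>2) / h) \<longlongrightarrow> 0) (at 0)"
      by (simp cong: filterlim_cong)
    then show ?thesis using 3 by (simp add: DERIV_def)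
  qed
qed

lemma Ck_max_square: "Ck_on 1 UNIV (\<lambda>t::real. (max 0 t)\<^sup>2)"
proof -
  have D: "((\<lambda>t::real. (max 0 t)\<^sup>2) has_derivative (*) (2 * max 0 t)) (at t)" for t
    using has_real_derivative_max_square by (simp add: has_field_derivative_def)
  have "frechet_derivative (\<lambda>t::real. (max 0 t)\<^sup>2) (at t) = (*) (2 * max 0 t)" for t
    by (rule frechet_derivative_at'[OF D])
  then show ?thesis
    using differentiableI[OF D] by (auto simp: One_nat_def intro!: continuous_intros)
qed

text \<open>The outer square makes the first derivative vanish on the sphere of radius
  \<open>r\<close>, so that the truncated polynomial is of class C^1 on the whole space.\<close>

definition bump :: "'a::euclidean_space \<Rightarrow> real \<Rightarrow> 'a \<Rightarrow> real" where
  "bump x0 r x = (max 0 (r\<^sup>2 - (x - x0) \<bullet> (x - x0)))\<^sup>2"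

lemma Ck_bump: "Ck_on 1 UNIV (bump x0 r)"
proof -
  have "Ck_on 1 UNIV (\<lambda>x::'a. r\<^sup>2 - (x - x0) \<bullet> (x - x0))"
    by (intro Ck_on_diff Ck_on_bilinear[OF _ bounded_bilinear_inner] Ck_on_ident Ck_on_const open_UNIV)
  from Ck_on_compose[OF open_UNIV _ this Ck_max_square] show ?thesis
    by (simp add: bump_def[abs_def])
qed

lemma bump_pos_iff:
  assumes "r > 0"
  shows "0 < bump x0 r x \<longleftrightarrow> x \<in> ball x0 r" and "bump x0 r x = 0 \<longleftrightarrow> x \<notin> ball x0 r"
proof -
  have "(x - x0) \<bullet> (x - x0) = (dist x0 x)\<^sup>2"
    by (simp add: dist_norm power2_norm_eq_inner[symmetric] norm_minus_commute)
  moreover have "(dist x0 x)\<^sup>2 < r\<^sup>2 \<longleftrightarrow> dist x0 x < r"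
    using assms power2_less_imp_less[of "dist x0 x" r] power_strict_mono[of "dist x0 x" r 2] by auto
  ultimately show "0 < bump x0 r x \<longleftrightarrow> x \<in> ball x0 r" "bump x0 r x = 0 \<longleftrightarrow> x \<notin> ball x0 r"
    by (auto simp: bump_def max_def not_less)
qed

context riem_manifold
begin

definition C1_fun :: "('a \<Rightarrow> real) \<Rightarrow> bool" where
  "C1_fun f \<longleftrightarrow> (\<forall>c\<in>A. Ck_on 1 (chart_image c) (\<lambda>x. f (chart_inv c x)))"

definition C0_fun :: "('a \<Rightarrow> real) \<Rightarrow> bool" where
  "C0_fun f \<longleftrightarrow> (\<forall>c\<in>A. continuous_on (chart_image c) (\<lambda>x. f (chart_inv c x)))"

lemma chart_inv_image_iff:
  assumes x: "x \<in> chart_image c" and K: "K \<subseteq> chart_image c"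
  shows "chart_inv c x \<in> chart_inv c ` K \<longleftrightarrow> x \<in> K"
proof
  assume "chart_inv c x \<in> chart_inv c ` K"
  then obtain y where y: "y \<in> K" "chart_inv c x = chart_inv c y" by blast
  then have "coords c (chart_inv c x) = coords c (chart_inv c y)" by simp
  then show "x \<in> K" using y(1) K coords_inv[OF x] coords_inv[of y c] by auto
qed simp

lemma C1_C0: "C1_fun f \<Longrightarrow> C0_fun f"
  unfolding C1_fun_def C0_fun_def using Ck_on_continuous by blast

lemma C0_preimage_open:
  assumes f: "C0_fun f" and T: "open T"
  shows "openin M {p \<in> topspace M. f p \<in> T}"
proof -
  have eq: "{p \<in> topspace M. f p \<in> T} = (\<Union>c\<in>A. chart_inv c ` {x \<in> chart_image c. f (chart_inv c x) \<in> T})"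
  proof (intro equalityI subsetI)
    fix p assume p: "p \<in> {p \<in> topspace M. f p \<in> T}"
    then obtain c where c: "c \<in> A" "p \<in> chart_dom c" using cover by blast
    have "p = chart_inv c (coords c p)" "coords c p \<in> {x \<in> chart_image c. f (chart_inv c x) \<in> T}"
      using c p coords_in[OF c(2)] by (simp_all add: inv_coords)
    then show "p \<in> (\<Union>c\<in>A. chart_inv c ` {x \<in> chart_image c. f (chart_inv c x) \<in> T})"
      using c(1) by blast
  next
    fix p assume "p \<in> (\<Union>c\<in>A. chart_inv c ` {x \<in> chart_image c. f (chart_inv c x) \<in> T})"
    then obtain c x where "c \<in> A" "x \<in> chart_image c" "f (chart_inv c x) \<in> T" "p = chart_inv c x" by blast
    then show "p \<in> {p \<in> topspace M. f p \<in> T}" using dom_sub inv_in_dom by blast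
  qed
  have "open {x \<in> chart_image c. f (chart_inv c x) \<in> T}" if c: "c \<in> A" for c
    using continuous_open_preimage[of "chart_image c" "\<lambda>x. f (chart_inv c x)" T] f c T image_open[OF c]
    by (simp add: C0_fun_def vimage_def Int_def)
  then show ?thesis unfolding eq
    by (intro openin_Union) (auto intro!: open_inv_image)
qed

lemma C0_measurable:
  assumes "C0_fun f"
  shows "f \<in> borel_measurable borelM"
proof (rule borel_measurableI)
  fix T :: "real set" assume "open T"
  then have "{p \<in> topspace M. f p \<in> T} \<in> sets borelM"
    by (intro open_in_borelM C0_preimage_open assms)
  moreover have "f -` T \<inter> space borelM = {p \<in> topspace M. f p \<in> T}" by (auto simp: space_borelM)
  ultimately show "f -` T \<inter> space borelM \<in> sets borelM" by simp
qed

text \<open>A coordinate bump is extended by zero. In another chart it is C^1 because the overlap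
  and the complement of the support cover the chart; the complement is open since compact sets are
  closed in a Hausdorff space.\<close>

lemma bump_function:
  assumes p: "p \<in> topspace M"
  shows "\<exists>c K \<eta>. c \<in> A \<and> compact K \<and> K \<subseteq> chart_image c \<and> C1_fun \<eta> \<and> (\<forall>q. 0 \<le> \<eta> q) \<and> 0 < \<eta> p \<and>
    (\<forall>q\<in>topspace M. q \<notin> chart_inv c ` K \<longrightarrow> \<eta> q = 0)"
proof -
  obtain c where c: "c \<in> A" "p \<in> chart_dom c" using p cover by blast
  obtain r where r: "r > 0" "cball (coords c p) r \<subseteq> chart_image c"
    using open_contains_cball image_open[OF c(1)] coords_in[OF c(2)] by blast
  let ?K = "cball (coords c p) r"
  define \<eta> where "\<eta> q = (if q \<in> chart_dom c then bump (coords c p) r (coords c q) else 0)" for q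
  have supp: "\<eta> q = 0" if "q \<notin> chart_inv c ` ?K" for q
    using that r inv_image_eq[OF c(1) r(2)] bump_pos_iff(2)[OF r(1), of "coords c p" "coords c q"] by (auto simp: \<eta>_def)
  have closed: "closedin M (chart_inv c ` ?K)"
    by (rule compactin_imp_closedin[OF Hausdorff compact_inv_image[OF c(1) compact_cball r(2)]])
  have "Ck_on 1 (chart_image d) (\<lambda>x. \<eta> (chart_inv d x))" if d: "d \<in> A" for d
  proof -
    let ?W = "coords d ` (chart_dom d - chart_inv c ` ?K)"
    have oW: "open ?W"
      using dom_open[OF d] closed by (intro open_coords_image[OF d]) auto
    have "Ck_on 1 (overlap d c) (\<lambda>x. bump (coords c p) r (transition d c x))"
      using smooth_transition[OF d c(1)]
      by (intro Ck_on_compose[OF open_overlap[OF d c(1)] _ _ Ck_bump]) (auto simp: smooth_on_def)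
    then have 1: "Ck_on 1 (overlap d c) (\<lambda>x. \<eta> (chart_inv d x))"
      by (rule Ck_on_cong[THEN iffD1, OF open_overlap[OF d c(1)], rotated])
         (auto simp: \<eta>_def inv_coords d transition_coords)
    have 2: "Ck_on 1 ?W (\<lambda>x. \<eta> (chart_inv d x))"
      by (rule Ck_on_cong[THEN iffD1, OF oW _ Ck_on_const[of 1 ?W 0]]) (auto simp: inv_coords d supp)
    have "chart_image d \<subseteq> overlap d c \<union> ?W"
    proof
      fix x assume "x \<in> chart_image d"
      then obtain q where q: "x = coords d q" "q \<in> chart_dom d" by (auto simp: chart_image_def)
      show "x \<in> overlap d c \<union> ?W"
        using q inv_image_eq[OF c(1) r(2)] by (cases "q \<in> chart_dom c") auto
    qed
    then show ?thesis
      using Ck_on_subset[OF Ck_on_Un[OF open_overlap[OF d c(1)] oW 1 2]] by blast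
  qed
  then have "C1_fun \<eta>" by (simp add: C1_fun_def)
  moreover have "0 \<le> \<eta> q" for q by (simp add: \<eta>_def bump_def)
  moreover have "0 < \<eta> p" using c r bump_pos_iff(1)[OF r(1), of "coords c p" "coords c p"] by (simp add: \<eta>_def)
  ultimately show ?thesis
    using c(1) r(2) supp by (intro exI[of _ c] exI[of _ ?K] exI[of _ \<eta>] conjI allI ballI impI) auto
qed

end

context compact_riem_manifold
begin

text \<open>The supports are recorded as compact sets of coordinates, since integration by parts
  takes place in coordinate space.\<close>

definition subordinate_partition ::
  "'a set \<Rightarrow> ('a \<Rightarrow> ('a, 'n) chart) \<Rightarrow> ('a \<Rightarrow> (real^'n) set) \<Rightarrow> ('a \<Rightarrow> 'a \<Rightarrow> real) \<Rightarrow> bool" where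
  "subordinate_partition F c K \<psi> \<longleftrightarrow> finite F \<and>
     (\<forall>a\<in>F. c a \<in> A \<and> compact (K a) \<and> K a \<subseteq> chart_image (c a) \<and> C1_fun (\<psi> a) \<and>
        (\<forall>q\<in>topspace M. q \<notin> chart_inv (c a) ` K a \<longrightarrow> \<psi> a q = 0)) \<and>
     (\<forall>q\<in>topspace M. (\<Sum>a\<in>F. \<psi> a q) = 1)"

lemma subordinate_partitionD:
  assumes "subordinate_partition F c K \<psi>"
  shows "finite F" "\<And>a. a \<in> F \<Longrightarrow> c a \<in> A" "\<And>a. a \<in> F \<Longrightarrow> compact (K a)"
    "\<And>a. a \<in> F \<Longrightarrow> K a \<subseteq> chart_image (c a)" "\<And>a. a \<in> F \<Longrightarrow> C1_fun (\<psi> a)"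
    "\<And>a q. a \<in> F \<Longrightarrow> q \<in> topspace M \<Longrightarrow> q \<notin> chart_inv (c a) ` K a \<Longrightarrow> \<psi> a q = 0"
    "\<And>q. q \<in> topspace M \<Longrightarrow> (\<Sum>a\<in>F. \<psi> a q) = 1"
  using assms unfolding subordinate_partition_def by blast+

text \<open>Compactness selects finitely many bumps whose positivity sets cover \<open>M\<close>;
  division by their positive sum normalizes them.\<close>

lemma partition_of_unity: "\<exists>F c K \<psi>. subordinate_partition F c K \<psi>"
proof -
  have "\<forall>p\<in>topspace M. \<exists>c K \<eta>. c \<in> A \<and> compact K \<and> K \<subseteq> chart_image c \<and> C1_fun \<eta> \<and> (\<forall>q. 0 \<le> \<eta> q) \<and> 0 < \<eta> p \<and>
    (\<forall>q\<in>topspace M. q \<notin> chart_inv c ` K \<longrightarrow> \<eta> q = 0)"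
    using bump_function by blast
  then obtain c K \<eta> where c: "\<forall>p\<in>topspace M. c p \<in> A \<and> compact (K p) \<and> K p \<subseteq> chart_image (c p) \<and> C1_fun (\<eta> p) \<and>
     (\<forall>q. 0 \<le> \<eta> p q) \<and> 0 < \<eta> p p \<and> (\<forall>q\<in>topspace M. q \<notin> chart_inv (c p) ` K p \<longrightarrow> \<eta> p q = 0)"
    by metis
  let ?W = "\<lambda>p. {q \<in> topspace M. \<eta> p q \<in> {0<..}}"
  have "openin M (?W p)" if "p \<in> topspace M" for p
    by (intro C0_preimage_open C1_C0) (use c that in auto)
  then have "\<forall>W\<in>?W ` topspace M. openin M W" by blast
  moreover have "topspace M \<subseteq> \<Union>(?W ` topspace M)" using c by auto
  ultimately obtain FF where FF: "finite FF" "FF \<subseteq> ?W ` topspace M" "topspace M \<subseteq> \<Union>FF"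
    using compact unfolding compact_space_alt by meson
  obtain F where F: "F \<subseteq> topspace M" "finite F" "FF = ?W ` F"
    using finite_subset_image[OF FF(1,2)] by blast
  define s where "s q = (\<Sum>a\<in>F. \<eta> a q)" for q
  have spos: "0 < s q" if q: "q \<in> topspace M" for q
  proof -
    obtain a where a: "a \<in> F" "0 < \<eta> a q" using FF(3) F(3) q by auto
    have "\<And>b. b \<in> F \<Longrightarrow> 0 \<le> \<eta> b q" using c F(1) by blast
    then show ?thesis unfolding s_def by (intro sum_pos2[of F a "\<lambda>b. \<eta> b q"] F(2) a)
  qed
  have "subordinate_partition F c K (\<lambda>a q. \<eta> a q * inverse (s q))"
    unfolding subordinate_partition_def
  proof (intro conjI ballI impI)
    show "finite F" by (rule F(2))
    fix a assume a: "a \<in> F"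
    then show "c a \<in> A" "compact (K a)" "K a \<subseteq> chart_image (c a)" using c F(1) by blast+
    show "C1_fun (\<lambda>q. \<eta> a q * inverse (s q))"
      unfolding C1_fun_def
    proof
      fix d assume d: "d \<in> A"
      have C: "Ck_on 1 (chart_image d) (\<lambda>x. \<eta> b (chart_inv d x))" if "b \<in> F" for b
        using that c F(1) d by (auto simp: C1_fun_def)
      have "s (chart_inv d x) \<noteq> 0" if "x \<in> chart_image d" for x
        using spos[of "chart_inv d x"] dom_sub[OF d] inv_in_dom[OF that] by fastforce
      then have "Ck_on 1 (chart_image d) (\<lambda>x. inverse (s (chart_inv d x)))"
        using Ck_on_sum[OF image_open[OF d], of F 1 "\<lambda>b x. \<eta> b (chart_inv d x)"] C
        by (intro Ck_on_inverse image_open[OF d]) (simp_all add: s_def)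
      then show "Ck_on 1 (chart_image d) (\<lambda>x. \<eta> a (chart_inv d x) * inverse (s (chart_inv d x)))"
        by (intro Ck_on_mult image_open[OF d] C a)
    qed
    show "\<eta> a q * inverse (s q) = 0" if "q \<in> topspace M" "q \<notin> chart_inv (c a) ` K a" for q
    proof -
      have "\<eta> a q = 0" using c a F(1) that by blast
      then show ?thesis by simp
    qed
  next
    fix q assume "q \<in> topspace M"
    then show "(\<Sum>a\<in>F. \<eta> a q * inverse (s q)) = 1"
      using spos[of q] by (simp add: sum_distrib_right[symmetric] s_def[symmetric])
  qed
  then show ?thesis by blast
qed

text \<open>On the compact set \<open>K\<close> the weighted function is continuous, hence
  integrable, and \<open>supp\<close> allows \<open>K\<close> to be replaced by the whole chart
  image.\<close>

lemma C0_integrable_support: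
  assumes c: "c \<in> A" and f: "C0_fun f" and K: "compact K" "K \<subseteq> chart_image c"
    and supp: "\<And>q. q \<in> topspace M \<Longrightarrow> q \<notin> chart_inv c ` K \<Longrightarrow> f q = 0"
  shows "integrable V f"
    and "(\<integral>p. f p \<partial>V) = (\<integral>x. indicator (chart_image c) x *\<^sub>R (vdens c x * f (chart_inv c x)) \<partial>lborel)"
    and "integrable lborel (\<lambda>x. indicator (chart_image c) x *\<^sub>R (vdens c x * f (chart_inv c x)))"
proof -
  have outside: "f p = 0" if "p \<in> topspace M" "p \<notin> chart_dom c" for p
    using supp[OF that(1)] that(2) inv_image_eq[OF c K(2)] by blast
  have iff: "integrable V f \<longleftrightarrow> integrable lborel (\<lambda>x. indicator (chart_image c) x *\<^sub>R (vdens c x * f (chart_inv c x)))"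
    by (rule integral_in_chart(1)[OF c C0_measurable[OF f] outside])
  show "(\<integral>p. f p \<partial>V) = (\<integral>x. indicator (chart_image c) x *\<^sub>R (vdens c x * f (chart_inv c x)) \<partial>lborel)"
    by (rule integral_in_chart(2)[OF c C0_measurable[OF f] outside])
  have "continuous_on K (\<lambda>x. vdens c x * f (chart_inv c x))"
    using f c unfolding C0_fun_def
    by (intro continuous_on_mult continuous_on_subset[OF _ K(2)] continuous_vdens) blast+
  then have "integrable lborel (\<lambda>x. indicator K x *\<^sub>R (vdens c x * f (chart_inv c x)))"
    by (intro borel_integrable_compact K)
  moreover have "indicator K x *\<^sub>R (vdens c x * f (chart_inv c x)) = indicator (chart_image c) x *\<^sub>R (vdens c x * f (chart_inv c x))" for x
  proof (cases "x \<in> chart_image c \<and> x \<notin> K")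
    case True
    have "chart_inv c x \<notin> chart_inv c ` K"
      using True chart_inv_image_iff[OF _ K(2)] by blast
    then have "f (chart_inv c x) = 0"
      using True dom_sub[OF c] inv_in_dom[of x c] by (intro supp) auto
    then show ?thesis by simp
  qed (use K(2) in \<open>auto simp: indicator_def\<close>)
  ultimately show int: "integrable lborel (\<lambda>x. indicator (chart_image c) x *\<^sub>R (vdens c x * f (chart_inv c x)))"
    by (simp only:)
  then show "integrable V f" by (simp only: iff)
qed

lemma C0_fun_mult: "C0_fun f \<Longrightarrow> C0_fun h \<Longrightarrow> C0_fun (\<lambda>p. f p * h p)"
  unfolding C0_fun_def by (auto intro: continuous_on_mult)

text \<open>Linearity of the integral needs integrable functions; this licenses every splitting of
  an integral below, including that of the two sides of the theorem.\<close>

lemma C0_integrable: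
  assumes f: "C0_fun f"
  shows "integrable V f"
proof -
  obtain F c K \<psi> where part: "subordinate_partition F c K \<psi>" using partition_of_unity by blast
  note P = subordinate_partitionD[OF part]
  have "integrable V (\<lambda>q. \<Sum>a\<in>F. \<psi> a q * f q)"
  proof (rule Bochner_Integration.integrable_sum)
    fix a assume a: "a \<in> F"
    show "integrable V (\<lambda>q. \<psi> a q * f q)"
      by (rule C0_integrable_support(1)[OF P(2)[OF a] C0_fun_mult[OF C1_C0[OF P(5)[OF a]] f] P(3)[OF a] P(4)[OF a]])
         (simp add: P(6)[OF a])
  qed
  moreover have "(\<Sum>a\<in>F. \<psi> a q * f q) = f q" if "q \<in> space V" for q
    using P(7) that by (simp add: V(2) sum_distrib_right[symmetric])
  ultimately show ?thesis
    by (simp cong: Bochner_Integration.integrable_cong)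
qed

text \<open>For a partition of unity \<open>\<psi>\<close> the integrals of \<open>div (\<psi>\<^sub>a Y)\<close> vanish, and the terms \<open>d\<psi>\<^sub>a(Y)\<close> add
  up to \<open>d1(Y) = 0\<close>.\<close>

lemma integral_divergence:
  fixes Y :: "('a, 'n) chart \<Rightarrow> real^'n \<Rightarrow> real^'n" and D :: "'a \<Rightarrow> real"
  assumes Y: "\<And>c. c \<in> A \<Longrightarrow> Ck_on 1 (chart_image c) (Y c)"
    and change: "\<And>c d p. c \<in> charts_at A p \<Longrightarrow> d \<in> charts_at A p \<Longrightarrow> Y d (coords d p) = jac c d p *v Y c (coords c p)"
    and D: "C0_fun D"
    and div: "\<And>c x. c \<in> A \<Longrightarrow> x \<in> chart_image c \<Longrightarrow>
      (\<Sum>i\<in>UNIV. pd i (\<lambda>y. vdens c y * Y c y $ i) x) = vdens c x * D (chart_inv c x)"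
  shows "(\<integral>p. D p \<partial>V) = 0"
proof -
  obtain F cc K \<psi> where part: "subordinate_partition F cc K \<psi>" using partition_of_unity by blast
  note P = subordinate_partitionD[OF part]
  let ?\<psi> = "\<lambda>a c x. \<psi> a (chart_inv c x)"
  have C\<psi>: "Ck_on 1 (chart_image c) (?\<psi> a c)" if "a \<in> F" "c \<in> A" for a c
    using P(5)[OF that(1)] that(2) by (simp add: C1_fun_def)
  have d\<psi>: "?\<psi> a c differentiable (at x)" if "a \<in> F" "c \<in> A" "x \<in> chart_image c" for a c x
    using C\<psi>[OF that(1,2)] that(3) by (simp add: One_nat_def)
  \<comment> \<open>The derivative of \<open>\<psi> a\<close> along \<open>Y\<close>. It is
    evaluated in a selected chart; the next fact shows that every chart gives the same
    value.\<close>
  define \<omega> where "\<omega> a p = (let c = chart_at A p in frechet_derivative (?\<psi> a c) (at (coords c p)) (Y c (coords c p)))" for a p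
  have \<omega>: "\<omega> a p = frechet_derivative (?\<psi> a c) (at (coords c p)) (Y c (coords c p))"
    if a: "a \<in> F" and c: "c \<in> charts_at A p" for a c p
  proof -
    define d where "d = chart_at A p"
    have d: "d \<in> charts_at A p" unfolding d_def by (rule chart_at[OF charts_at_topspace[OF c]])
    note o = overlap_charts[OF c d]
    have p: "p \<in> chart_dom c" "p \<in> chart_dom d" using c d by (simp_all add: charts_at_iff)
    have "frechet_derivative (?\<psi> a c) (at (coords c p))
       = frechet_derivative (\<lambda>x. ?\<psi> a d (transition c d x)) (at (coords c p))"
      by (rule frechet_derivative_cong_open[OF open_overlap[OF o(1,2)] o(3)])
         (auto simp: inv_coords transition_coords o(1,2))
    then have "frechet_derivative (?\<psi> a c) (at (coords c p)) (Y c (coords c p))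
       = frechet_derivative (?\<psi> a d) (at (coords d p)) (jac c d p *v Y c (coords c p))"
      using frechet_derivative_compose[OF transition_differentiable[OF o(1,2) p], of "?\<psi> a d" "Y c (coords c p)"]
        d\<psi>[OF a o(2) coords_in[OF p(2)]]
      by (simp only: o(4) frechet_transition[OF o(1,2) p])
    then show ?thesis by (simp add: \<omega>_def Let_def d_def[symmetric] change[OF c d])
  qed
  have \<omega>_chart: "\<omega> a (chart_inv c x) = (\<Sum>i\<in>UNIV. Y c x $ i * pd i (?\<psi> a c) x)"
    if "a \<in> F" "c \<in> A" "x \<in> chart_image c" for a c x
    using \<omega>[OF that(1) inv_charts_at[OF that(2,3)]] frechet_derivative_pd[OF d\<psi>[OF that], of "Y c x"]
    by (simp add: coords_inv[OF that(3)])
  have \<omega>_C0: "C0_fun (\<omega> a)" if a: "a \<in> F" for a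
    unfolding C0_fun_def
  proof
    fix c assume c: "c \<in> A"
    have "continuous_on (chart_image c) (\<lambda>x. \<Sum>i\<in>UNIV. Y c x $ i * pd i (?\<psi> a c) x)"
      using C\<psi>[OF a c]
      by (intro continuous_intros Ck_on_continuous[OF Y[OF c]]) (simp add: One_nat_def)
    then show "continuous_on (chart_image c) (\<lambda>x. \<omega> a (chart_inv c x))"
      by (rule continuous_on_cong[THEN iffD1, OF refl, rotated]) (simp add: \<omega>_chart a c)
  qed
  have \<omega>_supp: "\<omega> a q = 0" if a: "a \<in> F" and q: "q \<in> topspace M" "q \<notin> chart_inv (cc a) ` K a" for a q
  proof -
    obtain c where c: "c \<in> charts_at A q" using chart_at[OF q(1)] by blast
    then have cA: "c \<in> A" "q \<in> chart_dom c" by (simp_all add: charts_at_iff)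
    have "closedin M (chart_inv (cc a) ` K a)"
      by (rule compactin_imp_closedin[OF Hausdorff compact_inv_image[OF P(2)[OF a] P(3)[OF a] P(4)[OF a]]])
    then have o: "open (coords c ` (chart_dom c - chart_inv (cc a) ` K a))"
      using dom_open[OF cA(1)] by (intro open_coords_image[OF cA(1)]) auto
    have "frechet_derivative (?\<psi> a c) (at (coords c q)) = frechet_derivative (\<lambda>x. 0) (at (coords c q))"
      by (rule frechet_derivative_cong_open[OF o])
         (use cA q dom_sub[OF cA(1)] P(6)[OF a] in \<open>auto simp: inv_coords\<close>)
    then show ?thesis using \<omega>[OF a c] by (simp add: frechet_derivative_const_zero)
  qed
  have \<omega>_sum: "(\<Sum>a\<in>F. \<omega> a p) = 0" if p: "p \<in> topspace M" for p
  proof -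
    obtain c where c: "c \<in> charts_at A p" using chart_at[OF p] by blast
    then have cA: "c \<in> A" "p \<in> chart_dom c" by (simp_all add: charts_at_iff)
    let ?x = "coords c p"
    have "(\<Sum>a\<in>F. \<omega> a p) = frechet_derivative (\<lambda>x. \<Sum>a\<in>F. ?\<psi> a c x) (at ?x) (Y c ?x)"
      by (subst frechet_derivative_sum) (auto simp: \<omega>[OF _ c] intro!: d\<psi> cA coords_in)
    also have "frechet_derivative (\<lambda>x. \<Sum>a\<in>F. ?\<psi> a c x) (at ?x) = frechet_derivative (\<lambda>x. 1) (at ?x)"
    proof (rule frechet_derivative_cong_open[OF image_open[OF cA(1)] coords_in[OF cA(2)]])
      fix y assume "y \<in> chart_image c"
      then have "chart_inv c y \<in> topspace M" using dom_sub[OF cA(1)] inv_in_dom[of y c] by auto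
      then show "(\<Sum>a\<in>F. ?\<psi> a c y) = 1" by (rule P(7))
    qed
    finally show ?thesis by (simp add: frechet_derivative_const_zero)
  qed
  have local: "(\<integral>q. \<psi> a q * D q \<partial>V) = - (\<integral>q. \<omega> a q \<partial>V)" if a: "a \<in> F" for a
  proof -
    let ?c = "cc a"
    let ?I = "chart_image ?c"
    note c = P(2)[OF a] and K = P(3)[OF a] P(4)[OF a]
    let ?s = "vdens ?c"
    \<comment> \<open>The density-weighted components of \<open>\<psi> a\<close> times
      \<open>Y\<close>, extended by zero. They are C^1 everywhere, because the chart image and the
      complement of \<open>K a\<close> are open and cover the space.\<close>
    define Z where "Z i x = (if x \<in> ?I then ?\<psi> a ?c x * (?s x * Y ?c x $ i) else 0)" for i x
    have Zs: "Z i x = 0" if "x \<notin> K a" for i x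
    proof (cases "x \<in> ?I")
      case True
      have "chart_inv ?c x \<notin> chart_inv ?c ` K a"
        using that chart_inv_image_iff[OF True K(2)] by blast
      then have "?\<psi> a ?c x = 0"
        using dom_sub[OF c] inv_in_dom[OF True] by (intro P(6)[OF a]) auto
      then show ?thesis by (simp add: Z_def)
    qed (simp add: Z_def)
    have ZC: "Ck_on 1 UNIV (Z i)" for i
    proof -
      have "Ck_on 1 ?I (\<lambda>x. ?\<psi> a ?c x * (?s x * Y ?c x $ i))"
        by (intro Ck_on_mult image_open c C\<psi> a metric_patch.Ck_sqrt_det[OF patch] Ck_on_nth Y)
      then have 1: "Ck_on 1 ?I (Z i)"
        by (rule Ck_on_cong[THEN iffD1, OF image_open[OF c], rotated]) (simp add: Z_def)
      have o: "open (- K a)" using compact_imp_closed[OF K(1)] by (simp add: open_Compl)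
      have 2: "Ck_on 1 (- K a) (Z i)"
        by (rule Ck_on_cong[THEN iffD1, OF o _ Ck_on_const[of 1 "- K a" 0]]) (simp add: Zs)
      have "?I \<union> - K a = UNIV" using K(2) by auto
      then show ?thesis using Ck_on_Un[OF image_open[OF c] o 1 2] by simp
    qed
    have Z0: "integrable lborel (pd i (Z i))" "(\<integral>x. pd i (Z i) x \<partial>lborel) = 0" for i
    proof -
      have "Z i differentiable (at x)" for x using ZC[of i] by (simp add: One_nat_def)
      moreover have "continuous_on UNIV (pd i (Z i))" using ZC[of i] by (simp add: One_nat_def)
      ultimately show "integrable lborel (pd i (Z i))" "(\<integral>x. pd i (Z i) x \<partial>lborel) = 0"
        using integral_partial_compact_support[of "Z i" i "K a"] K(1) Zs by blast+
    qed
    \<comment> \<open>The product rule: the divergence of \<open>\<psi> a\<close> times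
      \<open>Y\<close> is \<open>\<psi> a\<close> times \<open>D\<close> plus
      \<open>\<omega> a\<close>, both weighted by the density.\<close>
    have expand: "(\<Sum>i\<in>UNIV. pd i (Z i) x)
      = indicator ?I x *\<^sub>R (?s x * (?\<psi> a ?c x * D (chart_inv ?c x))) + indicator ?I x *\<^sub>R (?s x * \<omega> a (chart_inv ?c x))" for x
    proof (cases "x \<in> ?I")
      case True
      have dsY: "(\<lambda>y. ?s y * Y ?c y $ i) differentiable (at x)" for i
        using Ck_on_mult[OF image_open[OF c] metric_patch.Ck_sqrt_det[OF patch[OF c]] Ck_on_nth[OF image_open[OF c] Y[OF c], of i]] True
        by (simp add: One_nat_def)
      have "pd i (Z i) x = ?\<psi> a ?c x * pd i (\<lambda>y. ?s y * Y ?c y $ i) x + pd i (?\<psi> a ?c) x * (?s x * Y ?c x $ i)" for i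
      proof -
        have "pd i (Z i) x = pd i (\<lambda>y. ?\<psi> a ?c y * (?s y * Y ?c y $ i)) x"
          by (rule metric_patch.pd_congI[OF patch[OF c] True]) (simp add: Z_def)
        also have "\<dots> = ?\<psi> a ?c x * pd i (\<lambda>y. ?s y * Y ?c y $ i) x + pd i (?\<psi> a ?c) x * (?s x * Y ?c x $ i)"
          by (rule frechet_derivative_bilinear[OF bounded_bilinear_mult d\<psi>[OF a c True] dsY])
        finally show ?thesis .
      qed
      then have "(\<Sum>i\<in>UNIV. pd i (Z i) x) = ?\<psi> a ?c x * (\<Sum>i\<in>UNIV. pd i (\<lambda>y. ?s y * Y ?c y $ i) x)
         + ?s x * (\<Sum>i\<in>UNIV. Y ?c x $ i * pd i (?\<psi> a ?c) x)"
        by (simp add: sum.distrib sum_distrib_left mult_ac)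
      then have "(\<Sum>i\<in>UNIV. pd i (Z i) x)
         = ?\<psi> a ?c x * (?s x * D (chart_inv ?c x)) + ?s x * \<omega> a (chart_inv ?c x)"
        by (simp only: div[OF c True] \<omega>_chart[OF a c True])
      then show ?thesis using True by simp
    next
      case False
      have "pd i (Z i) x = 0" for i
      proof -
        have "pd i (Z i) x = frechet_derivative (\<lambda>y. 0::real) (at x) (axis i 1)"
          by (rule arg_cong[where f="\<lambda>F. F (axis i 1)"], rule frechet_derivative_cong_open[of "- K a"])
             (use compact_imp_closed[OF K(1)] K(2) False Zs in auto)
        then show ?thesis by (simp add: frechet_derivative_const_zero)
      qed
      then show ?thesis using False by simp
    qed
    have \<psi>D: "C0_fun (\<lambda>q. \<psi> a q * D q)" by (rule C0_fun_mult[OF C1_C0[OF P(5)[OF a]] D])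
    have \<psi>D_supp: "\<psi> a q * D q = 0" if "q \<in> topspace M" "q \<notin> chart_inv ?c ` K a" for q
      using P(6)[OF a that] by simp
    have "0 = (\<integral>x. (\<Sum>i\<in>UNIV. pd i (Z i) x) \<partial>lborel)"
      using Z0 by simp
    also have "\<dots> = (\<integral>x. indicator ?I x *\<^sub>R (?s x * (?\<psi> a ?c x * D (chart_inv ?c x))) \<partial>lborel)
        + (\<integral>x. indicator ?I x *\<^sub>R (?s x * \<omega> a (chart_inv ?c x)) \<partial>lborel)"
      unfolding expand
      by (intro Bochner_Integration.integral_add)
         (rule C0_integrable_support(3)[OF c \<psi>D K \<psi>D_supp] C0_integrable_support(3)[OF c \<omega>_C0[OF a] K \<omega>_supp[OF a]]; assumption)+
    also have "(\<integral>x. indicator ?I x *\<^sub>R (?s x * (?\<psi> a ?c x * D (chart_inv ?c x))) \<partial>lborel) = (\<integral>q. \<psi> a q * D q \<partial>V)"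
      by (rule C0_integrable_support(2)[OF c \<psi>D K \<psi>D_supp, symmetric])
    also have "(\<integral>x. indicator ?I x *\<^sub>R (?s x * \<omega> a (chart_inv ?c x)) \<partial>lborel) = (\<integral>q. \<omega> a q \<partial>V)"
      by (rule C0_integrable_support(2)[OF c \<omega>_C0[OF a] K \<omega>_supp[OF a], symmetric])
    finally show ?thesis by simp
  qed
  have "(\<integral>p. D p \<partial>V) = (\<integral>p. (\<Sum>a\<in>F. \<psi> a p * D p) \<partial>V)"
    by (rule Bochner_Integration.integral_cong) (use P(7) in \<open>auto simp: V(2) sum_distrib_right[symmetric]\<close>)
  also have "\<dots> = (\<Sum>a\<in>F. \<integral>p. \<psi> a p * D p \<partial>V)"
    by (rule Bochner_Integration.integral_sum) (intro C0_integrable C0_fun_mult C1_C0 P(5) D)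
  also have "\<dots> = - (\<Sum>a\<in>F. \<integral>p. \<omega> a p \<partial>V)"
    by (simp add: local sum_negf)
  also have "(\<Sum>a\<in>F. \<integral>p. \<omega> a p \<partial>V) = (\<integral>p. (\<Sum>a\<in>F. \<omega> a p) \<partial>V)"
    by (rule Bochner_Integration.integral_sum[symmetric]) (intro C0_integrable \<omega>_C0)
  also have "\<dots> = (\<integral>p. 0 \<partial>V)"
    by (rule Bochner_Integration.integral_cong) (auto simp: \<omega>_sum V(2))
  finally show ?thesis by simp
qed

end

section \<open>The integral identity\<close>

theorem lemma2p2:
  fixes M :: "'a topology" and A :: "('a, 'n::finite) chart set"
    and g :: "('a, 'n) tensor2" and \<xi> :: "'a \<Rightarrow> ('a, 'n) tvec"
    and lam :: "'a \<Rightarrow> real" and \<rho> :: real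
  assumes "almost_RB_soliton M A g \<xi> lam \<rho>"
    and "compact_space M"
  shows "(\<integral>p. (tensor_norm A g
               (\<lambda>q u v. ricci A g q u v - scalar_curvature A g q / real CARD('n) * g q u v) p)\<^sup>2
            \<partial>riemannian_volume M A g)
       = (real CARD('n) - 2) / (2 * real CARD('n)) *
         (\<integral>p. g p (grad A g (scalar_curvature A g) p) (\<xi> p) \<partial>riemannian_volume M A g)"
proof -
  have sol: "smooth_manifold M A" "riemannian_metric M A g" and vf: "smooth_vector_field M A \<xi>"
    and eq: "\<And>p u v. p \<in> topspace M \<Longrightarrow> u \<in> tangent_space A p \<Longrightarrow> v \<in> tangent_space A p \<Longrightarrow>
        ricci A g p u v + 1 / 2 * lie_derivative A \<xi> g p u v = (lam p + \<rho> * scalar_curvature A g p) * g p u v"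
    using assms(1) unfolding almost_RB_soliton_def by blast+
  interpret compact_riem_manifold M A g
    using sol assms(2) by unfold_locales
  let ?n = "real CARD('n)"
  let ?X = "\<lambda>c x. \<xi> (chart_inv c x) c"
  \<comment> \<open>The field Y of the overview in the chart \<open>c\<close>: E with an index
    raised, applied to \<open>\<xi>\<close>.\<close>
  let ?Y = "\<lambda>c x. (matrix_inv (L c x) ** metric_patch.tfric (L c) x) *v ?X c x"
  let ?S = "scalar_curvature A g"
  define N where "N p = (tensor_norm A g traceless p)\<^sup>2" for p
  define W where "W p = g p (grad A g ?S p) (\<xi> p)" for p
  have tangent: "\<xi> p \<in> tangent_space A p" if "p \<in> topspace M" for p
    by (rule vector_field_tangent[OF vf that])
  have CX: "Ck_on k (chart_image c) (?X c)" if "c \<in> A" for c k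
    using vector_field_smooth[OF vf that] by (simp add: smooth_on_def)
  have CY: "Ck_on k (chart_image c) (?Y c)" if c: "c \<in> A" for c k
  proof -
    interpret metric_patch "chart_image c" "L c" by (rule patch[OF c])
    show ?thesis
      by (intro Ck_on_bilinear[OF _ bounded_bilinear_matrix_vector] Ck_on_matrix_mult open_U Ck_H Ck_tfric CX c)
  qed
  have change: "?Y d (coords d p) = jac c d p *v ?Y c (coords c p)"
    if c: "c \<in> charts_at A p" and d: "d \<in> charts_at A p" for c d p
  proof -
    note o = overlap_charts[OF c d]
    interpret patch_change "overlap c d" "L c" "chart_image d" "L d" "transition c d"
      by (rule patch_change[OF o(1,2)])
    have "\<xi> p d = jac c d p *v \<xi> p c"
      by (rule tangent_change[OF tangent[OF charts_at_topspace[OF c]] c d])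
    then show ?thesis
      using field_change[OF o(3), of "\<xi> p c"] c d
      by (simp add: o(4) jac_eq_P[OF o(1,2)] inv_coords charts_at_iff)
  qed
  have S_chart: "?S (chart_inv c x) = metric_patch.scal (L c) x" if "c \<in> A" "x \<in> chart_image c" for c x
    using scalar_coords[OF inv_charts_at[OF that]] by (simp add: coords_inv that)
  have S_diff: "(?S \<circ> chart_inv c) differentiable (at x)"
    and S_deriv: "frechet_derivative (?S \<circ> chart_inv c) (at x) = frechet_derivative (metric_patch.scal (L c)) (at x)"
    if c: "c \<in> A" and x: "x \<in> chart_image c" for c x
  proof -
    interpret metric_patch "chart_image c" "L c" by (rule patch[OF c])
    have "scal differentiable (at x)" by (rule Ck_on_differentiable[OF Ck_scal x])
    then show "(?S \<circ> chart_inv c) differentiable (at x)"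
      using differentiable_cong_open[OF open_U x, of "?S \<circ> chart_inv c" scal] S_chart[OF c] by simp
    show "frechet_derivative (?S \<circ> chart_inv c) (at x) = frechet_derivative scal (at x)"
      by (rule frechet_derivative_cong_open[OF open_U x]) (simp add: S_chart[OF c])
  qed
  \<comment> \<open>\<open>scalar_curvature\<close> is differentiable in every chart, so the
    gradient may be replaced by the differential and then evaluated in the given chart.\<close>
  have W_chart: "W (chart_inv c x) = frechet_derivative (metric_patch.scal (L c)) (at x) (?X c x)"
    if c: "c \<in> A" and x: "x \<in> chart_image c" for c x
  proof -
    let ?p = "chart_inv c x"
    have cp: "c \<in> charts_at A ?p" by (rule inv_charts_at[OF c x])
    have p: "?p \<in> topspace M" by (rule charts_at_topspace[OF cp])
    have f: "(?S \<circ> chart_inv d) differentiable (at (coords d ?p))" if "d \<in> charts_at A ?p" for d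
      using that coords_in[of ?p d] by (intro S_diff) (simp_all add: charts_at_iff)
    have "W ?p = differential A ?S ?p (\<xi> ?p)"
      unfolding W_def by (rule g_grad[OF p tangent[OF p] f])
    also have "\<dots> = frechet_derivative (?S \<circ> chart_inv c) (at (coords c ?p)) (\<xi> ?p c)"
      by (rule differential_coords[OF cp tangent[OF p] f])
    finally show ?thesis by (simp add: coords_inv[OF x] S_deriv[OF c x])
  qed
  have N_chart: "N (chart_inv c x) = norm_chart c x" if "c \<in> A" "x \<in> chart_image c" for c x
    unfolding N_def using norm_coords[OF inv_charts_at[OF that]] by (simp add: coords_inv that)
  have N0: "C0_fun N"
    unfolding C0_fun_def
  proof
    fix c assume c: "c \<in> A"
    interpret metric_patch "chart_image c" "L c" by (rule patch[OF c])
    have "Ck_on 0 (chart_image c) (norm_chart c)"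
      unfolding norm_chart_def[abs_def] trace_def
      by (intro Ck_on_sum Ck_on_nth Ck_on_matrix_mult Ck_on_bounded_linear[OF _ bounded_linear_transpose Ck_tfric]
          open_U Ck_H Ck_tfric)
    then have "continuous_on (chart_image c) (norm_chart c)" by (rule Ck_on_continuous)
    then show "continuous_on (chart_image c) (\<lambda>x. N (chart_inv c x))"
      by (rule continuous_on_cong[THEN iffD1, OF refl, rotated]) (simp add: N_chart c)
  qed
  have W0: "C0_fun W"
    unfolding C0_fun_def
  proof
    fix c assume c: "c \<in> A"
    interpret metric_patch "chart_image c" "L c" by (rule patch[OF c])
    have "continuous_on (chart_image c) (\<lambda>x. \<Sum>a\<in>UNIV. ?X c x $ a *\<^sub>R pd a scal x)"
      by (intro continuous_intros Ck_on_continuous[OF CX[OF c]] Ck_on_continuous[OF Ck_on_deriv[OF Ck_scal]])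
    then show "continuous_on (chart_image c) (\<lambda>x. W (chart_inv c x))"
      by (rule continuous_on_cong[THEN iffD1, OF refl, rotated])
         (simp only: W_chart[OF c] frechet_derivative_pd[OF Ck_on_differentiable[OF Ck_scal], of _ "?X c _"])
  qed
  let ?k = "1 / 2 - 1 / ?n"
  let ?D = "\<lambda>p. ?k * W p - N p"
  have div: "(\<Sum>i\<in>UNIV. pd i (\<lambda>y. vdens c y * ?Y c y $ i) x) = vdens c x * ?D (chart_inv c x)"
    if c: "c \<in> A" and x: "x \<in> chart_image c" for c x
  proof -
    interpret metric_patch "chart_image c" "L c" by (rule patch[OF c])
    define \<mu> where "\<mu> y = lam (chart_inv c y) + \<rho> * ?S (chart_inv c y)" for y
    \<comment> \<open>Evaluating the soliton equation on coordinate vectors turns it into the matrix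
      equation required by \<open>divergence_of_soliton_field\<close>.\<close>
    have sol: "ricci_matrix (L c) y + (1/2) *\<^sub>R lie_matrix (L c) (?X c) y = \<mu> y *\<^sub>R L c y"
      if y: "y \<in> chart_image c" for y
    proof (subst vec_eq_iff, intro allI, subst vec_eq_iff, intro allI)
      fix i j
      let ?p = "chart_inv c y"
      have cp: "c \<in> charts_at A ?p" by (rule inv_charts_at[OF c y])
      note e = coord_vec_tangent[OF cp]
      have "ricci A g ?p (coord_vec A c ?p i) (coord_vec A c ?p j) + 1 / 2 * lie_derivative A \<xi> g ?p (coord_vec A c ?p i) (coord_vec A c ?p j)
         = \<mu> y * g ?p (coord_vec A c ?p i) (coord_vec A c ?p j)"
        unfolding \<mu>_def by (rule eq[OF charts_at_topspace[OF cp] e e])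
      then show "(ricci_matrix (L c) y + (1/2) *\<^sub>R lie_matrix (L c) (?X c) y) $ i $ j = (\<mu> y *\<^sub>R L c y) $ i $ j"
        unfolding ricci_coords[OF cp e e] lie_coords[OF vf cp e e] g_coords[OF cp e e] L_coords[OF cp, symmetric]
        by (simp add: coord_vec_self[OF cp] axis_inner_matrix coords_inv[OF y])
    qed
    show ?thesis
      unfolding W_chart[OF c x] N_chart[OF c x] norm_chart_def
      by (rule divergence_of_soliton_field[OF x vector_field_smooth[OF vf c] sol])
  qed
  have "C0_fun ?D"
    using N0 W0 unfolding C0_fun_def by (auto intro!: continuous_intros)
  then have "(\<integral>p. ?D p \<partial>V) = 0"
    using CY change div by (intro integral_divergence[where Y="?Y" and D="?D"]) blast+
  \<comment> \<open>Both integrands are continuous, hence integrable on the compact manifold, so the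
    integral of the difference splits.\<close>
  then have "?k * (\<integral>p. W p \<partial>V) = (\<integral>p. N p \<partial>V)"
    using C0_integrable[OF N0] C0_integrable[OF W0] by simp
  moreover have "?k = (?n - 2) / (2 * ?n)" by (simp add: field_simps)
  ultimately show ?thesis
    unfolding N_def W_def traceless_def[abs_def] by simp
qed

end
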